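(* Let $n \ge 0$ be an integer and let $\beta>1$ be a real number with $\gamma_{n+1} \le \beta < \gamma_n$. Then the set of gaps of the transformation $T_{-\beta}$ is $\mathcal{G}_n(\beta)$, and $\mathcal{G}_n(\beta)$ consists of $g_n = \lfloor 2^{n+1}/3 \rfloor$ disjoint non-empty intervals.
   Context: For real $\beta>1$, the $(-\beta)$-transformation is $T_{-\beta}:(0,1]\to(0,1]$, $x\mapsto -\beta x+\lfloor \beta x\rfloor+1$. It admits a unique invariant probability measure that is absolutely continuous with respect to Lebesgue measure. A gap of $T_{-\beta}$ is a maximal open interval contained in $(0,1]$ on which the density of this measure vanishes (almost everywhere). For $n\ge 0$ let $g_n=\lfloor 2^{n+1}/3\rfloor$. For $n\ge1$, $\gamma_n$ is the unique positive real number with $\gamma_n^{g_n+1}=\gamma_n+1$, and $\gamma_0=\infty$; one has $2>\gamma_1>\gamma_2>\cdots>1$ and $\gamma_n\to 1$. For $n\ge 0$ and $1<\beta<\gamma_n$, $$\mathcal{G}_n(\beta)=\Big\{G_{m,k}(\beta)\ \Big|\ 0\le m<n,\ 0\le k<\tfrac{2^{m+1}+(-1)^m}{3}\Big\},$$ where $m,k$ are integers and $G_{m,k}(\beta)$ is the open interval $$G_{m,k}(\beta)=\begin{cases}\big(T_{-\beta}^{2^{m+1}+k}(1),\,T_{-\beta}^{(2^{m+2}-(-1)^m)/3+k}(1)\big)&\text{if } k \text{ is even},\\ \big(T_{-\beta}^{(2^{m+2}-(-1)^m)/3+k}(1),\,T_{-\beta}^{2^{m+1}+k}(1)\big)&\text{if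 } k\text{ is odd}.\end{cases}$$ In particular $\mathcal{G}_0(\beta)=\emptyset$. *)

theory Defs
  imports "HOL-Probability.Probability"
begin

text \<open>The formula makes sense on all of \<open>\<real>\<close> and takes values in \<open>{0<..1}\<close> there;
  the transformation proper is its restriction to \<open>{0<..1}\<close>.\<close>

definition neg_beta :: "real \<Rightarrow> real \<Rightarrow> real" where
  "neg_beta \<beta> x = - \<beta> * x + real_of_int \<lfloor>\<beta> * x\<rfloor> + 1"

definition leb01 :: "real measure" where
  "leb01 = restrict_space lborel {0<..1}"

definition is_acim :: "real \<Rightarrow> real measure \<Rightarrow> bool" where
  "is_acim \<beta> \<mu> \<longleftrightarrow>
     sets \<mu> = sets leb01 \<and> prob_space \<mu> \<and> absolutely_continuous leb01 \<mu> \<and>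
     distr \<mu> \<mu> (neg_beta \<beta>) = \<mu>"

text \<open>Meaningful for \<open>\<beta> > 1\<close>, where there is exactly one such measure.\<close>

definition acim :: "real \<Rightarrow> real measure" where
  "acim \<beta> = (THE \<mu>. is_acim \<beta> \<mu>)"

definition inv_density :: "real \<Rightarrow> real \<Rightarrow> ennreal" where
  "inv_density \<beta> = RN_deriv leb01 (acim \<beta>)"

text \<open>Open intervals are required to be non-empty: otherwise the empty set would count as a
  maximal one whenever there are no gaps.\<close>

definition vanishing_interval :: "real \<Rightarrow> real set \<Rightarrow> bool" where
  "vanishing_interval \<beta> I \<longleftrightarrow>
     (\<exists>a b. a < b \<and> I = {a<..<b}) \<and> I \<subseteq> {0<..1} \<and>
     (AE x in leb01. x \<in> I \<longrightarrow> inv_density \<beta> x = 0)"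

definition gaps :: "real \<Rightarrow> real set set" where
  "gaps \<beta> = {I. vanishing_interval \<beta> I \<and> (\<forall>J. vanishing_interval \<beta> J \<and> I \<subseteq> J \<longrightarrow> J = I)}"

definition g :: "nat \<Rightarrow> nat" where
  "g n = 2 ^ (n + 1) div 3"

definition gamma :: "nat \<Rightarrow> ereal" where
  "gamma n = (if n = 0 then \<infinity> else ereal (THE x::real. x > 0 \<and> x ^ (g n + 1) = x + 1))"

text \<open>Both integer divisions below are exact.\<close>

definition gap_exp :: "nat \<Rightarrow> nat" where
  "gap_exp m = nat ((2 ^ (m + 2) - (- 1) ^ m) div 3)"

definition gap_count :: "nat \<Rightarrow> nat" where
  "gap_count m = nat ((2 ^ (m + 1) + (- 1) ^ m) div 3)"

definition G :: "real \<Rightarrow> nat \<Rightarrow> nat \<Rightarrow> real set" where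
  "G \<beta> m k =
     (if even k
      then {(neg_beta \<beta> ^^ (2 ^ (m + 1) + k)) 1 <..< (neg_beta \<beta> ^^ (gap_exp m + k)) 1}
      else {(neg_beta \<beta> ^^ (gap_exp m + k)) 1 <..< (neg_beta \<beta> ^^ (2 ^ (m + 1) + k)) 1})"

definition G_set :: "nat \<Rightarrow> real \<Rightarrow> real set set" where
  "G_set n \<beta> = {G \<beta> m k | m k. m < n \<and> k < gap_count m}"

end

theory Submission
  imports Defs
begin

text \<open>Write \<open>T\<close> for the transformation, \<open>t\<^sub>j\<close> for the iterates \<open>T\<^sup>j(1)\<close> and \<open>J\<^sub>m = gap_count m\<close>, so
  that \<open>J\<^sub>0 = J\<^sub>1 = 1\<close> and \<open>J\<^sub>m\<^sub>+\<^sub>2 = J\<^sub>m\<^sub>+\<^sub>1 + 2 J\<^sub>m\<close>. The idea is to renormalise. For \<open>\<beta> < \<gamma>\<^sub>n\<close> with \<open>n = m + 1\<close>, the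
  first return map of \<open>T\<close> to an interval \<open>(a, 1)\<close> with \<open>a = t\<^sub>j\<close>, \<open>j = J\<^sub>n\<close>, has two affine branches: the upper one
  is decreasing with slope \<open>-s\<close>, \<open>s = \<beta>\<close> to the power \<open>J\<^sub>n\<close>, and onto; the lower one is increasing with
  slope \<open>r = \<beta>\<close> to the power \<open>2 J\<^sub>m\<close> and image \<open>(q, 1)\<close>. If \<open>q\<close> is above the fixed point of the upper branch, that is
  \<open>r s\<^sup>2 < r + s\<close>, equivalently \<open>\<beta> < \<gamma>\<^sub>n\<^sub>+\<^sub>1\<close>, then the return map leaves out an interval around this fixed point,
  whose first \<open>J\<^sub>n\<close> iterates are the new gaps, and the return map to \<open>(q, 1)\<close> has the same shape.
  Otherwise the images of every interval eventually cover \<open>(a, 1)\<close>: the growth between two visits to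
  the break point compensates for the cut there.

  On the measure side, a forward invariant set of positive measure contains an interval up to null
  sets, hence all of the complement of the gaps. Applied to the sets where one invariant density
  exceeds another one, this gives uniqueness; applied to the support of the density, it gives the
  set on which the density vanishes. An invariant density is obtained from the positive part of
  the sum of \<open>(-\<beta>)\<^sup>-\<^sup>j\<close> times the indicator function of \<open>(0, t\<^sub>j]\<close>.\<close>

section \<open>The Jacobsthal numbers and the thresholds\<close>

text \<open>The recurrence of \<open>gap_count\<close> mirrors the renormalisation: on the smaller
  interval \<open>(q, 1)\<close> the new upper branch is an upper return followed by a lower one,
  which takes \<open>gap_count (m + 1) + 2 * gap_count m\<close> steps, and the new lower branch is
  two upper returns. The endpoints in \<open>G\<close> have the same origin: \<open>q\<close> is the
  point of the orbit of 1 at time \<open>gap_count (m + 2)\<close>, and its return \<open>b\<close>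
  comes \<open>gap_count (m + 1)\<close> steps later, at time \<open>2 ^ (m + 2)\<close>. The
  obstacle at the last level is that the slopes can be smaller than 2, so that a cut at the break
  point may cost more length than one expansion gains; growth has to be counted over several
  returns. The interval argument runs on an abstract predicate \<open>cov\<close>, closed under
  subsets, finite unions and images of intervals under branches, so that null sets never enter it.
  Since \<open>acim\<close> is a definite description, existence and uniqueness of the measure have
  to be settled before its density can be discussed.\<close>

lemma gap_count_closed: "3 * int (gap_count m) = 2 ^ (m + 1) + (- 1) ^ m"
proof -
  \<comment> \<open>The division by 3 in \<open>gap_count\<close> is exact: passing from
    \<open>k\<close> to \<open>k + 2\<close> adds the multiple
    \<open>3 * 2 ^ (k + 1)\<close>.\<close>
  have d: "(3::int) dvd 2 ^ (m + 1) + (- 1) ^ m \<and> (0::int) \<le> 2 ^ (m + 1) + (- 1) ^ m"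
  proof (induction m rule: less_induct)
    case (less m)
    show ?case
    proof (cases "m < 2")
      case True
      then have "m = 0 \<or> m = 1" by auto
      then show ?thesis by auto
    next
      case False
      then obtain k where k: "m = Suc (Suc k)"
        by (metis add_2_eq_Suc less_eqE linorder_not_less)
      have "(3::int) dvd 2 ^ (k + 1) + (- 1) ^ k" "(0::int) \<le> 2 ^ (k + 1) + (- 1) ^ k"
        using less.IH[of k] k by auto
      moreover have "(2::int) ^ (m + 1) + (- 1) ^ m = 3 * 2 ^ (k + 1) + (2 ^ (k + 1) + (- 1) ^ k)"
        by (simp add: k)
      ultimately show ?thesis
        by (metis add_nonneg_nonneg dvd_add dvd_triv_left mult_nonneg_nonneg zero_le_numeral zero_le_power)
    qed
  qed
  then obtain z where z: "(2::int) ^ (m + 1) + (- 1) ^ m = 3 * z" by (auto elim: dvdE)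
  then have "z \<ge> 0" using d by linarith
  then show ?thesis using z by (simp add: gap_count_def)
qed

lemma gap_count_rec: "gap_count (m + 2) = gap_count (m + 1) + 2 * gap_count m"
proof -
  have "3 * int (gap_count (m + 2)) = 3 * int (gap_count (m + 1)) + 2 * (3 * int (gap_count m))"
    unfolding gap_count_closed by simp
  then show ?thesis by linarith
qed

lemma gap_count_0: "gap_count 0 = 1" and gap_count_1: "gap_count 1 = 1"
  using gap_count_closed[of 0] gap_count_closed[of 1] by simp_all

lemma gap_count_add: "gap_count m + gap_count (m + 1) = 2 ^ (m + 1)"
proof -
  have "3 * (int (gap_count m) + int (gap_count (m + 1))) = 3 * 2 ^ (m + 1)"
    unfolding distrib_left gap_count_closed by simp
  then have "int (gap_count m + gap_count (m + 1)) = int (2 ^ (m + 1))" by simp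
  then show ?thesis by linarith
qed

lemma gap_exp_eq: "gap_exp m = gap_count (m + 1)"
  by (simp add: gap_exp_def gap_count_def)

lemma odd_gap_count: "odd (gap_count m)"
proof (induction m rule: less_induct)
  case (less m)
  show ?case
  proof (cases "m < 2")
    case True
    then have "m = 0 \<or> m = 1" by auto
    then show ?thesis using gap_count_0 gap_count_1 by auto
  next
    case False
    then obtain k where "m = k + 2" by (metis add.commute less_eqE linorder_not_less)
    then show ?thesis using less.IH[of "k + 1"] gap_count_rec[of k] by simp
  qed
qed

text \<open>The times of the two return branches differ by a single step, and which one is longer
  alternates with \<open>m\<close>. This lets \<open>gap_condition\<close> reduce an inequality in
  two powers to one in a single power.\<close>

lemma gap_count_double:
  "2 * gap_count m + (if even m then 0 else 1) = gap_count (m + 1) + (if even m then 1 else 0)"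
proof -
  have "2 * (3 * int (gap_count m)) = 3 * int (gap_count (m + 1)) + 3 * (- 1) ^ m"
    unfolding gap_count_closed by simp
  then show ?thesis by (auto split: if_splits simp: minus_one_power_iff)
qed

text \<open>The remainder of \<open>2 ^ (m + 2)\<close> modulo 3 is 1 or 2 according to the parity
  of \<open>m\<close>; in the second case \<open>gap_count\<close> rounds up where \<open>g\<close>
  rounds down.\<close>

lemma gap_count_g: "gap_count (m + 1) = g (m + 1) + (if even m then 0 else 1)"
proof -
  have *: "3 * int (gap_count (m + 1)) + (- 1) ^ m = int (2 ^ (m + 2))"
    unfolding gap_count_closed by simp
  show ?thesis
  proof (cases "even m")
    case True
    then have "int (2 ^ (m + 2)) = int (3 * gap_count (m + 1) + 1)"
      using * by simp
    then have "2 ^ (m + 2) = 3 * gap_count (m + 1) + 1"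
      unfolding of_nat_eq_iff .
    then show ?thesis using True by (simp add: g_def)
  next
    case False
    moreover have "gap_count (m + 1) \<ge> 1"
      using odd_pos[OF odd_gap_count[of "m + 1"]] by simp
    ultimately have "int (2 ^ (m + 2)) = int (3 * (gap_count (m + 1) - 1) + 2)"
      using * False by (simp add: of_nat_diff)
    then have "2 ^ (m + 2) = 3 * (gap_count (m + 1) - 1) + 2"
      unfolding of_nat_eq_iff .
    then show ?thesis using False \<open>gap_count (m + 1) \<ge> 1\<close> by (simp add: g_def)
  qed
qed

text \<open>Counts the pairs \<open>(m, k)\<close> that index the gaps; it also makes
  \<open>g\<close> visibly monotone.\<close>

lemma sum_gap_count: "(\<Sum>m<n. gap_count m) = g n"
proof (induction n)
  case 0 show ?case by (simp add: g_def)
next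
  case (Suc n)
  show ?case
  proof (cases n)
    case 0 then show ?thesis using gap_count_0 by (simp add: g_def)
  next
    case (Suc k)
    then show ?thesis using Suc.IH gap_count_g[of k] gap_count_g[of n] gap_count_double[of n]
      by (auto split: if_splits)
  qed
qed

lemma g_mono: "g m \<le> g (Suc m)"
  using sum_gap_count[of m] sum_gap_count[of "Suc m"] by simp

lemma g_pos: "g (Suc m) \<ge> 1"
proof (induction m)
  case 0 show ?case by (simp add: g_def)
next
  case (Suc m) then show ?case using g_mono[of "Suc m"] by simp
qed

text \<open>The equation says \<open>x * (x ^ g n - 1) = 1\<close>. For a positive solution both
  factors are positive, and from there on the product increases strictly.\<close>

lemma gamma_root_unique:
  assumes "n \<ge> 1"
  shows "\<exists>!x::real. x > 0 \<and> x ^ (g n + 1) = x + 1"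
proof -
  let ?f = "\<lambda>x::real. x ^ (g n + 1) - x - 1"
  have gn: "g n \<ge> 1" using g_pos[of "n - 1"] assms by simp
  have "\<exists>x\<ge>1. x \<le> 2 \<and> ?f x = 0"
  proof (rule IVT)
    have "(2::real) ^ 2 \<le> 2 ^ (g n + 1)" using gn by (intro power_increasing) auto
    then show "0 \<le> ?f 2" by simp
  qed (auto intro!: continuous_intros)
  then obtain x where x: "x \<ge> 1" "?f x = 0" by blast
  have uniq: "y = z" if "y > 0" "y ^ (g n + 1) = y + 1" "z > 0" "z ^ (g n + 1) = z + 1" for y z :: real
  proof -
    have lt: False if "0 < y" "y < z" "y ^ (g n + 1) = y + 1" "z ^ (g n + 1) = z + 1" for y z :: real
    proof -
      have yz: "y * (y ^ g n - 1) = 1" "z * (z ^ g n - 1) = 1" using that by (simp_all add: algebra_simps)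
      have "y ^ g n < z ^ g n" using that gn by (intro power_strict_mono) auto
      moreover have "y ^ g n - 1 > 0" using yz(1) that(1)
        by (metis zero_less_mult_pos zero_less_one)
      ultimately have "y * (y ^ g n - 1) < z * (z ^ g n - 1)"
        using that by (intro mult_strict_mono) auto
      then show False using yz by simp
    qed
    show ?thesis using lt[of y z] lt[of z y] that by force
  qed
  have "x > 0 \<and> x ^ (g n + 1) = x + 1" using x by linarith
  then show ?thesis using uniq by blast
qed

text \<open>The thresholds enter the dynamics only through this polynomial inequality.\<close>

lemma gamma_less_iff:
  assumes "n \<ge> 1" "\<beta> > 1"
  shows "ereal \<beta> < gamma n \<longleftrightarrow> \<beta> ^ (g n + 1) < \<beta> + 1"
proof -
  define c where "c = (THE x::real. x > 0 \<and> x ^ (g n + 1) = x + 1)"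
  have c: "c > 0" "c ^ (g n + 1) = c + 1" using theI'[OF gamma_root_unique[OF assms(1)]] by (auto simp: c_def)
  have gn: "g n \<ge> 1" using g_pos[of "n - 1"] assms by simp
  have mono: "y * (y ^ g n - 1) < z * (z ^ g n - 1)"
    if "0 < y" "y < z" "1 < y \<or> 1 < z" "y \<ge> 1 \<or> y ^ g n - 1 > 0" for y z :: real
  proof -
    have "y ^ g n < z ^ g n" using that gn by (intro power_strict_mono) auto
    moreover have "y ^ g n \<ge> 1" using that by (auto simp: one_le_power)
    ultimately show ?thesis
      using that by (intro mult_strict_mono) auto
  qed
  have cc: "c * (c ^ g n - 1) = 1" using c by (simp add: algebra_simps)
  have c1: "c ^ g n - 1 > 0" using cc c(1) by (metis zero_less_mult_pos zero_less_one)
  have "\<beta> < c \<longleftrightarrow> \<beta> * (\<beta> ^ g n - 1) < 1"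
    using mono[of \<beta> c] mono[of c \<beta>] cc c c1 assms by (cases \<beta> c rule: linorder_cases) auto
  also have "\<dots> \<longleftrightarrow> \<beta> ^ (g n + 1) < \<beta> + 1" by (auto simp: algebra_simps)
  finally show ?thesis using assms by (simp add: gamma_def c_def)
qed

section \<open>Covering by images of intervals\<close>

lemma neg_beta_floor:
  assumes "of_int k \<le> \<beta> * x" "\<beta> * x < of_int k + 1"
  shows "neg_beta \<beta> x = of_int k + 1 - \<beta> * x"
proof -
  have "\<lfloor>\<beta> * x\<rfloor> = k" using assms by (simp add: floor_unique)
  then show ?thesis by (simp add: neg_beta_def)
qed

lemma neg_beta_range: "0 < neg_beta \<beta> x" "neg_beta \<beta> x \<le> 1"
  unfolding neg_beta_def by linarith+

text \<open>As long as \<open>Q\<close> fails, intervals satisfying \<open>P\<close> grow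
  geometrically, against the bound \<open>B\<close>. In the applications \<open>Q\<close> is a
  covering claim, so that a single favourable step may end the process.\<close>

lemma expanding_intervals:
  fixes P :: "real \<Rightarrow> real \<Rightarrow> bool"
  assumes step: "\<And>u v. P u v \<Longrightarrow> u < v \<Longrightarrow> Q \<or> (\<exists>u' v'. P u' v' \<and> \<rho> * (v - u) \<le> v' - u')"
    and bound: "\<And>u v. P u v \<Longrightarrow> v - u \<le> B"
    and "\<rho> > 1" "P u v" "u < v"
  shows Q
proof (rule ccontr)
  assume nQ: "\<not> Q"
  have "\<exists>u' v'. P u' v' \<and> \<rho> ^ k * (v - u) \<le> v' - u'" for k
  proof (induction k)
    case 0
    then show ?case using assms by auto
  next
    case (Suc k)
    then obtain u' v' where uv: "P u' v'" "\<rho> ^ k * (v - u) \<le> v' - u'" by blast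
    have "0 < \<rho> ^ k * (v - u)" using assms by simp
    then have "u' < v'" using uv by linarith
    then obtain u'' v'' where "P u'' v''" "\<rho> * (v' - u') \<le> v'' - u''"
      using step[OF uv(1)] nQ by blast
    moreover have "\<rho> * (\<rho> ^ k * (v - u)) \<le> \<rho> * (v' - u')"
      using uv assms by (intro mult_left_mono) auto
    ultimately show ?case by (intro exI[of _ u''] exI[of _ v'']) (auto simp: mult.assoc)
  qed
  moreover obtain k where "B / (v - u) < \<rho> ^ k"
    using real_arch_pow[OF \<open>\<rho> > 1\<close>] by blast
  ultimately show False using bound assms by (metis diff_gt_0_iff_gt leD order_trans pos_divide_less_eq)
qed

text \<open>The intended reading of \<open>cov S\<close> is that a fixed forward invariant set contains \<open>S\<close> up to a null set.\<close>

locale covering =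
  fixes cov :: "real set \<Rightarrow> bool"
  assumes cov_mono: "cov S \<Longrightarrow> S' \<subseteq> S \<Longrightarrow> cov S'"
    and cov_Un: "cov S \<Longrightarrow> cov S' \<Longrightarrow> cov (S \<union> S')"
    and cov_finite: "finite S \<Longrightarrow> cov S"
begin

text \<open>When the intervals only abut, the point \<open>v\<close> belongs to neither of them;
  \<open>cov_finite\<close> fills it in.\<close>

lemma cov_join:
  assumes "cov {u<..<v}" "cov {v'<..<w}" "v' \<le> v"
  shows "cov {u<..<w}"
proof -
  have "cov ({u<..<v} \<union> {v'<..<w} \<union> {v})"
    using cov_Un[OF cov_Un[OF assms(1,2)] cov_finite[of "{v}"]] by simp
  then show ?thesis by (rule cov_mono) (use assms(3) in auto)
qed

text \<open>Between two visits to the break point \<open>c\<close> the interval grows by a factor of at least \<open>r\<close>,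
  because the condition \<open>r + s \<le> r * s\<^sup>2\<close> makes up for the cut at \<open>c\<close>. That condition also says
  that the left end \<open>q\<close> of the lower image is at most the fixed point of the upper branch.\<close>

lemma two_branch_covering:
  assumes ac: "a < c" "c < 1" and sr: "1 < s" "1 < r"
    and full: "s * (1 - c) = 1 - a" and q: "q = 1 - r * (c - a)"
      "a \<le> q" and rs: "r + s \<le> r * s\<^sup>2"
    and upper: "\<And>u v. c \<le> u \<Longrightarrow> u < v \<Longrightarrow> v \<le> 1 \<Longrightarrow> cov {u<..<v} \<Longrightarrow>
      cov {a + s * (1 - v)<..<a + s * (1 - u)}"
    and lower: "\<And>u v. a \<le> u \<Longrightarrow> u < v \<Longrightarrow> v \<le> c \<Longrightarrow> cov {u<..<v} \<Longrightarrow>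
      cov {1 - r * (c - u)<..<1 - r * (c - v)}"
    and uv: "cov {u<..<v}" "a \<le> u" "u < v" "v \<le> 1"
  shows "cov {a<..<1}"
proof (rule expanding_intervals[where P =
  "\<lambda>u v. a \<le> u \<and> v \<le> 1 \<and> cov {u<..<v}" and \<rho> = "min r s" and B =
    "1 - a" and u = u and v = v])
  have top: "a + s * (1 - c) = 1" using full by simp
  have upper_full: "cov {a<..<1}" if "cov {c<..<1}"
    using upper[of c 1] that ac top by simp
  \<comment> \<open>The upper branch has the fixed point \<open>(a + s) / (s + 1)\<close>, and being
    below it is the same as being below one's own return.\<close>
  have fixed: "q \<le> a + s * (1 - q)"
  proof -
    have sc: "s * (c - a) = (s - 1) * (1 - a)" using full by (simp add: algebra_simps)
    have "s * ((s + 1) * (1 - q)) = (s + 1) * r * (s * (c - a))" using q by simp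
    also have "\<dots> = (r * s\<^sup>2 - r) * (1 - a)"
      unfolding sc by (simp add: power2_eq_square algebra_simps)
    finally have e: "s * ((s + 1) * (1 - q)) = (r * s\<^sup>2 - r) * (1 - a)" .
    have "s * (1 - a) \<le> (r * s\<^sup>2 - r) * (1 - a)"
      using rs ac by (intro mult_right_mono) auto
    then have "s * (1 - a) \<le> s * ((s + 1) * (1 - q))" using e by simp
    then have "1 - a \<le> (s + 1) * (1 - q)" using sr by simp
    then show ?thesis by (simp add: algebra_simps)
  qed
  fix u v assume P: "a \<le> u \<and> v \<le> 1 \<and> cov {u<..<v}" and uv: "u < v"
  have len: "min r s * (v - u) \<le> r * (v - u)" "min r s * (v - u) \<le> s * (v - u)"
    using uv by (auto intro!: mult_right_mono)
  show "cov {a<..<1} \<or> (\<exists>u' v'. (a \<le> u' \<and> v' \<le> 1 \<and> cov {u'<..<v'}) \<and> min r s * (v - u) \<le> v' - u')"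
  proof (cases "v \<le> c \<or> c \<le> u")
    case True
    then show ?thesis
    proof
      assume vc: "v \<le> c"
      have "r * (c - u) \<le> r * (c - a)" "0 \<le> r * (c - v)" using P vc sr by auto
      then have "a \<le> 1 - r * (c - u)" "1 - r * (c - v) \<le> 1" using q by auto
      moreover have "(1 - r * (c - v)) - (1 - r * (c - u)) = r * (v - u)" by (simp add: algebra_simps)
      ultimately show ?thesis using lower[of u v] P uv vc len by metis
    next
      assume cu: "c \<le> u"
      have "s * (1 - u) \<le> s * (1 - c)" "0 \<le> s * (1 - v)" using P cu sr by auto
      then have "a \<le> a + s * (1 - v)" "a + s * (1 - u) \<le> 1" using top by auto
      moreover have "(a + s * (1 - u)) - (a + s * (1 - v)) = s * (v - u)" by (simp add: algebra_simps)
      ultimately show ?thesis using upper[of u v] P uv cu len by metis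
    qed
  next
    case False
    define x y where "x = c - u" and "y = v - c"
    have xy: "0 < x" "0 < y" "v - u = x + y" using False by (auto simp: x_def y_def)
    have "cov {u<..<c}" "cov {c<..<v}" using P False by (auto intro: cov_mono)
    then have near: "cov {1 - r * x<..<1}" "cov {1 - s * y<..<1}"
      using lower[of u c] upper[of c v] P False ac top by (auto simp: x_def y_def algebra_simps)
    \<comment> \<open>Both halves of a cut interval are mapped to intervals ending at 1, so the
      images are nested and only the longer one matters.\<close>
    define w where "w = max (r * x) (s * y)"
    have w: "cov {1 - w<..<1}" using near by (auto simp: w_def max_def)
    have w0: "0 < w" using xy sr by (auto simp: w_def max_def)
    \<comment> \<open>Since \<open>x + y\<close> is at most \<open>w / r + w / s\<close>, the
      condition on \<open>r\<close> and \<open>s\<close> bounds it by \<open>s * w\<close>: one more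
      upper return makes up for the cut, and a lower return after it is pure gain.\<close>
    have "r * s * (x + y) = s * (r * x) + r * (s * y)" by (simp add: algebra_simps)
    also have "\<dots> \<le> s * w + r * w" using sr by (intro add_mono mult_left_mono) (auto simp: w_def)
    also have "\<dots> = (r + s) * w" by (simp add: algebra_simps)
    also have "\<dots> \<le> (r * s\<^sup>2) * w" using rs w0 by (intro mult_right_mono) auto
    finally have "r * s * (x + y) \<le> r * s * (s * w)" by (simp add: power2_eq_square algebra_simps)
    then have grow: "x + y \<le> s * w" using sr by simp
    show ?thesis
    proof (cases "1 - w < c")
      case True
      then have "cov {c<..<1}" by (intro cov_mono[OF w]) auto
      then show ?thesis using upper_full by blast
    next
      case False
      then have a1: "cov {a<..<a + s * w}" using upper[of "1 - w" 1] w w0 by simp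
      show ?thesis
      proof (cases "a + s * w \<le> c")
        case True
        have "0 < s * w" using w0 sr by simp
        then have "cov {q<..<1 - r * (c - (a + s * w))}" using lower[of a "a + s * w"] a1 True q by simp
        moreover have "1 - r * (c - (a + s * w)) - q = r * (s * w)" by (simp add: q algebra_simps)
        moreover have "0 \<le> r * (c - (a + s * w))" using True sr by simp
        moreover have "min r s * (v - u) \<le> r * (s * w)"
          using len(1) grow xy sr
          by (metis less_eq_real_def mult_left_mono order_trans zero_less_one order_less_trans)
        ultimately show ?thesis
          using q by (intro disjI2 exI[of _ q] exI[of _ "1 - r * (c - (a + s * w))"]) auto
      next
        case False
        \<comment> \<open>With \<open>(a, c)\<close> covered, so is \<open>(q, 1)\<close>. If this
          contains \<open>(c, 1)\<close>, the upper branch is onto; otherwise the upper return of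
          \<open>(q, 1)\<close> reaches from \<open>a\<close> to at least \<open>q\<close>, by
          \<open>fixed\<close>.\<close>
        then have "cov {a<..<c}" using a1 by (auto intro: cov_mono)
        then have q1: "cov {q<..<1}" using lower[of a c] ac q by simp
        show ?thesis
        proof (cases "q \<le> c")
          case True
          then have "cov {c<..<1}" by (intro cov_mono[OF q1]) auto
          then show ?thesis using upper_full by blast
        next
          case False
          have "0 < r * (c - a)" using ac sr by simp
          then have "q < 1" using q by simp
          then have "cov {a<..<a + s * (1 - q)}" using upper[of q 1] q1 False by simp
          then show ?thesis using cov_join[OF _ q1 fixed] by blast
        qed
      qed
    qed
  qed
qed (use assms in auto)

end

section \<open>Covering along branches of the transformation\<close>

locale neg_beta_covering = covering +
  fixes \<beta> :: real
  assumes beta: "1 < \<beta>"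
    and cov_image: "\<And>u v b. u < v \<Longrightarrow> cov {u<..<v} \<Longrightarrow> (\<And>x. u < x \<Longrightarrow> x < v \<Longrightarrow> neg_beta \<beta> x = b - \<beta> * x)
      \<Longrightarrow> cov {b - \<beta> * v<..<b - \<beta> * u}"
begin

lemma cov_branch:
  assumes "u < v" "cov {u<..<v}" "of_int k \<le> \<beta> * u" "\<beta> * v \<le> of_int k + 1"
  shows "cov {of_int k + 1 - \<beta> * v<..<of_int k + 1 - \<beta> * u}"
proof (rule cov_image)
  fix x assume "u < x" "x < v"
  then have "\<beta> * u < \<beta> * x" "\<beta> * x < \<beta> * v" using beta by auto
  then show "neg_beta \<beta> x = of_int k + 1 - \<beta> * x" using assms by (intro neg_beta_floor) auto
qed (use assms in auto)

lemma cov_uncut: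
  assumes "u < v" "cov {u<..<v}"
    "\<not> (\<exists>k::int. \<beta> * u < of_int k \<and> of_int k < \<beta> * v)"
  obtains w where "0 \<le> w" "w + \<beta> * (v - u) \<le> 1" "cov {w<..<w + \<beta> * (v - u)}"
proof -
  define k where "k = \<lfloor>\<beta> * u\<rfloor>"
  have k: "of_int k \<le> \<beta> * u" "\<beta> * u < of_int k + 1" unfolding k_def by linarith+
  have "\<beta> * v \<le> of_int k + 1"
    using assms(3) k by (metis of_int_1 of_int_add linorder_not_less)
  then show ?thesis using cov_branch[OF assms(1,2) k(1)] that[of "of_int k + 1 - \<beta> * v"] k
    by (simp add: algebra_simps)
qed

text \<open>Immediately to the right of a break point \<open>k / \<beta>\<close> the map takes
  values close to 1. An interval around such a point has an image ending at 1, and an interval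
  without break points grows by the factor \<beta>. This brings every interval into the domain of
  the first return map.\<close>

lemma cov_near_one:
  assumes "cov {u<..<v}" "0 \<le> u" "u < v" "v \<le> 1"
  shows "\<exists>w<1. 0 \<le> w \<and> cov {w<..<1}"
proof (rule expanding_intervals[where P =
  "\<lambda>u v. 0 \<le> u \<and> v \<le> 1 \<and> cov {u<..<v}" and \<rho> = \<beta> and B = 1])
  fix u v assume P: "0 \<le> u \<and> v \<le> 1 \<and> cov {u<..<v}" and uv: "u < v"
  show "(\<exists>w<1. 0 \<le> w \<and> cov {w<..<1}) \<or> (\<exists>u' v'. (0 \<le> u' \<and> v' \<le> 1 \<and> cov {u'<..<v'}) \<and> \<beta> * (v - u) \<le> v' - u')"
  proof (cases "\<exists>k::int. \<beta> * u < of_int k \<and> of_int k < \<beta> * v")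
    case True
    then obtain k :: int where k: "\<beta> * u < of_int k" "of_int k < \<beta> * v" by blast
    define v' where "v' = min v ((of_int k + 1) / \<beta>)"
    have v': "of_int k / \<beta> < v'" "\<beta> * v' \<le> of_int k + 1" "v' \<le> v"
      using k beta by (auto simp: v'_def min_def field_simps)
    have "u < of_int k / \<beta>" using k beta by (simp add: field_simps)
    then have "cov {of_int k / \<beta><..<v'}" using P v' by (auto intro: cov_mono)
    then have "cov {of_int k + 1 - \<beta> * v'<..<of_int k + 1 - \<beta> * (of_int k / \<beta>)}"
      using v' beta by (intro cov_branch) auto
    moreover have "of_int k < \<beta> * v'" using v' beta by (simp add: field_simps)
    ultimately show ?thesis using v' beta by (intro disjI1 exI[of _ "of_int k + 1 - \<beta> * v'"]) auto
  next
    case False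
    obtain w where "0 \<le> w" "w + \<beta> * (v - u) \<le> 1" "cov {w<..<w + \<beta> * (v - u)}"
      using cov_uncut[OF uv _ False] P by blast
    then show ?thesis by (intro disjI2 exI[of _ w] exI[of _ "w + \<beta> * (v - u)"]) auto
  qed
qed (use assms beta in auto)

text \<open>The case without gaps, where there may be many branches. The two sides of a cut again
  lead to nested intervals ending at 1, the left one after two steps and the right one after one; a
  piece that contains a full branch ends the argument at once.\<close>

lemma cov_all_large_beta:
  assumes large: "\<beta> + 1 \<le> \<beta>\<^sup>2" and uv: "cov {u<..<v}" "0 \<le> u" "u < v" "v \<le> 1"
  shows "cov {0<..<1}"
proof (rule expanding_intervals[where P =
  "\<lambda>u v. 0 \<le> u \<and> v \<le> 1 \<and> cov {u<..<v}" and \<rho> = "min \<beta> (4/3)" and B = 1])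
  have branch_full: "cov {0<..<1}"
    if "cov {u<..<v}" "u \<le> of_int k / \<beta>" "(of_int k + 1) / \<beta> \<le> v" for u v and k :: int
  proof -
    have "cov {of_int k / \<beta><..<(of_int k + 1) / \<beta>}" using that by (auto intro: cov_mono)
    then show ?thesis using cov_branch[of "of_int k / \<beta>" "(of_int k + 1) / \<beta>" k] beta
      by (simp add: divide_strict_right_mono)
  qed
  fix u v assume P: "0 \<le> u \<and> v \<le> 1 \<and> cov {u<..<v}" and uv: "u < v"
  have len: "min \<beta> (4/3) * (v - u) \<le> \<beta> * (v - u)"
    "min \<beta> (4/3) * (v - u) \<le> 4/3 * (v - u)"
    using uv by (intro mult_right_mono; simp)+
  show "cov {0<..<1} \<or> (\<exists>u' v'. (0 \<le> u' \<and> v' \<le> 1 \<and> cov {u'<..<v'}) \<and> min \<beta> (4/3) * (v - u) \<le> v' - u')"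
  proof (cases "\<exists>k::int. \<beta> * u < of_int k \<and> of_int k < \<beta> * v")
    case False
    obtain w where "0 \<le> w" "w + \<beta> * (v - u) \<le> 1" "cov {w<..<w + \<beta> * (v - u)}"
      using cov_uncut[OF uv _ False] P by blast
    then show ?thesis using len by (intro disjI2 exI[of _ w] exI[of _ "w + \<beta> * (v - u)"]) auto
  next
    case True
    then obtain k :: int where k: "\<beta> * u < of_int k" "of_int k < \<beta> * v" by blast
    define x y where "x = of_int k - \<beta> * u" and "y = \<beta> * v - of_int k"
    have xy: "0 < x" "0 < y" "\<beta> * (v - u) = x + y" using k by (auto simp: x_def y_def algebra_simps)
    have kb: "u < of_int k / \<beta>" "of_int k / \<beta> < v" using k beta by (auto simp: field_simps)
    show ?thesis
    proof (cases "1 < x \<or> 1 < y \<or> 1 < \<beta> * x")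
      case True
      moreover have "cov {0<..<1}" if "1 < x"
        using that P kb beta by (intro branch_full[of u v "k - 1"]) (auto simp: x_def field_simps)
      moreover have "cov {0<..<1}" if "1 < y"
        using that P kb beta by (intro branch_full[of u v k]) (auto simp: y_def field_simps)
      moreover have "cov {0<..<1}" if "1 < \<beta> * x" "x \<le> 1"
      proof -
        have "cov {u<..<of_int k / \<beta>}" using P kb by (auto intro: cov_mono)
        then have "cov {of_int (k - 1) + 1 - \<beta> * (of_int k / \<beta>)<..<of_int (k - 1) + 1 - \<beta> * u}"
          using kb beta that by (intro cov_branch) (auto simp: x_def)
        then have "cov {0<..<x}" using beta by (simp add: x_def)
        then show ?thesis using that beta by (intro branch_full[of 0 x 0]) (auto simp: field_simps)
      qed
      ultimately show ?thesis by fastforce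
    next
      case False
      then have small: "x \<le> 1" "y \<le> 1" "\<beta> * x \<le> 1" by auto
      have "cov {u<..<of_int k / \<beta>}" using P kb by (auto intro: cov_mono)
      then have "cov {of_int (k - 1) + 1 - \<beta> * (of_int k / \<beta>)<..<of_int (k - 1) + 1 - \<beta> * u}"
        using kb beta small by (intro cov_branch) (auto simp: x_def)
      then have "cov {0<..<x}" using beta by (simp add: x_def)
      then have near1: "cov {1 - \<beta> * x<..<1}" using cov_branch[of 0 x 0] xy small by simp
      have "cov {of_int k / \<beta><..<v}" using P kb by (auto intro: cov_mono)
      then have "cov {of_int k + 1 - \<beta> * v<..<of_int k + 1 - \<beta> * (of_int k / \<beta>)}"
        using kb beta small by (intro cov_branch) (auto simp: y_def)
      then have near2: "cov {1 - y<..<1}" using beta by (simp add: y_def algebra_simps)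
      define w where "w = max (\<beta> * x) y"
      have w: "cov {1 - w<..<1}" "0 < w" "w \<le> 1"
        using near1 near2 xy small by (auto simp: w_def max_def)
      have "\<beta> * (\<beta> * (v - u)) = \<beta> * x + \<beta> * y"
        unfolding xy by (simp add: algebra_simps)
      also have "\<dots> \<le> w + \<beta> * w"
        using beta by (intro add_mono mult_left_mono) (auto simp: w_def)
      finally have "\<beta>\<^sup>2 * (v - u) \<le> (\<beta> + 1) * w"
        by (simp add: power2_eq_square algebra_simps)
      show ?thesis
      proof (cases "\<beta> < 2")
        case False
        \<comment> \<open>The quotient \<open>\<beta>\<^sup>2 / (\<beta> + 1)\<close> increases with
          \<beta> and equals \<open>4/3\<close> at 2, which is the origin of the rate.\<close>
        have "4 * (\<beta> + 1) * (v - u) \<le> 3 * \<beta>\<^sup>2 * (v - u)"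
        proof (intro mult_right_mono)
          have "0 \<le> (\<beta> - 2) * (3 * \<beta> + 2)" using False by simp
          then show "4 * (\<beta> + 1) \<le> 3 * \<beta>\<^sup>2"
            by (simp add: power2_eq_square algebra_simps)
        qed (use uv in auto)
        then have "(\<beta> + 1) * (4 / 3 * (v - u)) \<le> (\<beta> + 1) * w"
          using \<open>\<beta>\<^sup>2 * (v - u) \<le> (\<beta> + 1) * w\<close> by (simp add: algebra_simps)
        then have "4 / 3 * (v - u) \<le> w" using beta by simp
        then show ?thesis using w len by (intro disjI2 exI[of _ "1 - w"] exI[of _ 1]) auto
      next
        case b2: True
        have "(\<beta> + 1) * (v - u) \<le> \<beta>\<^sup>2 * (v - u)"
          using large uv by (intro mult_right_mono) auto
        then have "(\<beta> + 1) * (v - u) \<le> (\<beta> + 1) * w"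
          using \<open>\<beta>\<^sup>2 * (v - u) \<le> (\<beta> + 1) * w\<close> by linarith
        then have vw: "v - u \<le> w" using beta by simp
        \<comment> \<open>For \<beta> < 2 the cut has merely been compensated. The branch above
          \<open>1 / \<beta>\<close> stretches \<open>(1 - w, 1)\<close> by the factor \<beta>,
          unless that interval reaches below \<open>1 / \<beta>\<close>. In the latter case
          \<open>(2 - \<beta>, 1)\<close> is covered, and the image of its part below
          \<open>1 / \<beta>\<close> closes the rest.\<close>
        show ?thesis
        proof (cases "1 \<le> \<beta> * (1 - w)")
          case True
          have "cov {of_int 1 + 1 - \<beta> * 1<..<of_int 1 + 1 - \<beta> * (1 - w)}"
            using w b2 True by (intro cov_branch) auto
          moreover have "\<beta> * (v - u) \<le> \<beta> * w" using vw beta by simp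
          ultimately show ?thesis using True b2 len
            by (intro disjI2 exI[of _ "2 - \<beta>"] exI[of _
            "2 - \<beta> * (1 - w)"]) (auto simp: algebra_simps)
        next
          case False
          then have "1 - w \<le> 1 / \<beta>" using beta by (simp add: field_simps)
          then have "cov {1 / \<beta><..<1}" using w by (auto intro: cov_mono)
          then have "cov {of_int 1 + 1 - \<beta> * 1<..<of_int 1 + 1 - \<beta> * (1 / \<beta>)}"
            using beta b2 by (intro cov_branch) auto
          then have c1: "cov {2 - \<beta><..<1}" using beta by simp
          have "0 < (\<beta> - 1) * (\<beta> - 1)" using beta by simp
          then have lt: "\<beta> * (2 - \<beta>) < 1" by (simp add: algebra_simps)
          have "1 / \<beta> < 1" using beta by simp
          then have "cov {2 - \<beta><..<1 / \<beta>}" by (intro cov_mono[OF c1]) auto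
          then have "cov {of_int 0 + 1 - \<beta> * (1 / \<beta>)<..<of_int 0 + 1 - \<beta> * (2 - \<beta>)}"
            using beta b2 lt by (intro cov_branch) (auto simp: field_simps)
          then have "cov {0<..<1 - \<beta> * (2 - \<beta>)}" using beta by simp
          moreover have "2 - \<beta> \<le> 1 - \<beta> * (2 - \<beta>)"
            using large by (simp add: power2_eq_square algebra_simps)
          ultimately show ?thesis using cov_join[OF _ c1] by blast
        qed
      qed
    qed
  qed
qed (use assms beta in auto)

end

section \<open>Return towers and gaps\<close>

abbreviation orb :: "real \<Rightarrow> nat \<Rightarrow> real" where
  "orb \<beta> j \<equiv> (neg_beta \<beta> ^^ j) 1"

text \<open>The Kakutani tower over the domain of the return map, with the return times as heights;
  the break point is left out of the base.\<close>

definition tower :: "real \<Rightarrow> nat \<Rightarrow> real \<Rightarrow> (real \<times> nat) set" where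
  "tower \<beta> m c = {c<..<1} \<times> {..<gap_count (Suc m)} \<union> {orb \<beta> (gap_count (Suc m))<..<c} \<times> {..<2 * gap_count m}"

definition tower_map :: "real \<Rightarrow> real \<times> nat \<Rightarrow> real" where
  "tower_map \<beta> = (\<lambda>(x, j). (neg_beta \<beta> ^^ j) x)"

definition tower_image :: "real \<Rightarrow> nat \<Rightarrow> real \<Rightarrow> real set" where
  "tower_image \<beta> m c = tower_map \<beta> ` tower \<beta> m c"

definition gap_index :: "nat \<Rightarrow> (nat \<times> nat) set" where
  "gap_index n = (SIGMA m:{..<n}. {..<gap_count m})"

text \<open>Disjointness is demanded of the closures: two gaps with a common endpoint would merge
  into one maximal interval up to a null set. The finite remainder absorbs endpoints and images of
  break points.\<close>

definition gap_decomposition :: "real \<Rightarrow> nat \<Rightarrow> real set \<Rightarrow> bool" where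
  "gap_decomposition \<beta> n W \<longleftrightarrow>
     open W \<and> W \<subseteq> {0<..<1} \<and> W \<noteq> {} \<and>
     finite ({0<..<1} - W - (\<Union>(m, k)\<in>gap_index n. G \<beta> m k)) \<and>
     (\<forall>(m, k)\<in>gap_index n. (\<exists>l u. l < u \<and> G \<beta> m k = {l<..<u}) \<and> G \<beta> m k \<subseteq> {0<..<1} \<and> G \<beta> m k \<inter> W = {}) \<and>
     disjoint_family_on (\<lambda>(m, k). closure (G \<beta> m k)) (gap_index n)"

lemma affine_image_open:
  fixes A B :: real
  assumes "B \<noteq> 0"
  shows "(\<lambda>x. A + B * (x - x0)) ` {l<..<u} =
    (if 0 < B then {A + B * (l - x0)<..<A + B * (u - x0)} else {A + B * (u - x0)<..<A + B * (l - x0)})"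
proof -
  have *: "y \<in> (\<lambda>x. A + B * (x - x0)) ` S \<longleftrightarrow> (y - A) / B + x0 \<in> S" for y S
  proof -
    have "y = A + B * (x - x0) \<longleftrightarrow> x = (y - A) / B + x0" for x
      using assms by (auto simp: field_simps)
    then show ?thesis by (simp add: image_iff)
  qed
  show ?thesis unfolding set_eq_iff * using assms by (auto simp: field_simps)
qed

lemma affine_image_closed:
  fixes A B :: real
  assumes "B \<noteq> 0"
  shows "(\<lambda>x. A + B * (x - x0)) ` {l..u} =
    (if 0 < B then {A + B * (l - x0)..A + B * (u - x0)} else {A + B * (u - x0)..A + B * (l - x0)})"
proof -
  have *: "y \<in> (\<lambda>x. A + B * (x - x0)) ` S \<longleftrightarrow> (y - A) / B + x0 \<in> S" for y S
  proof -
    have "y = A + B * (x - x0) \<longleftrightarrow> x = (y - A) / B + x0" for x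
      using assms by (auto simp: field_simps)
    then show ?thesis by (simp add: image_iff)
  qed
  show ?thesis unfolding set_eq_iff * using assms by (auto simp: field_simps)
qed

lemma open_subset_Ioc: "open S \<Longrightarrow> S \<subseteq> {l<..u::real} \<Longrightarrow> S \<subseteq> {l<..<u}"
proof
  fix x assume S: "open S" "S \<subseteq> {l<..u}" and x: "x \<in> S"
  then obtain e where "e > 0" "cball x e \<subseteq> S" using open_contains_cball by blast
  then have "x + e \<in> S" "x \<in> S" using x by (auto simp: subset_iff dist_real_def)
  then show "x \<in> {l<..<u}" using S \<open>e > 0\<close> by force
qed

lemma iterate_pos: "0 < x \<Longrightarrow> 0 < (neg_beta \<beta> ^^ j) x"
  by (cases j) (auto simp: neg_beta_range)

lemma iterate_le_1: "x \<le> 1 \<Longrightarrow> (neg_beta \<beta> ^^ j) x \<le> 1"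
  by (cases j) (auto simp: neg_beta_range)

lemma funpow_add_apply: "(f ^^ (i + j)) x = (f ^^ j) ((f ^^ i) x)"
  by (metis add.commute comp_apply funpow_add)

lemma gap_count_pos: "0 < gap_count m"
  using odd_gap_count by (rule odd_pos)

lemma gap_count_Suc: "gap_count (Suc (Suc m)) = gap_count (Suc m) + 2 * gap_count m"
  using gap_count_rec[of m] by simp

lemma power_two_gap_count: "2 ^ (m + 1) = gap_count m + gap_count (Suc m)"
  using gap_count_add[of m] by simp

text \<open>The two branches of the first return map, above and below the break point \<open>c\<close>, are given together
  with all intermediate iterates. Injectivity of \<open>tower_map\<close> says that each of these iterates is
  injective on its branch and that their images are pairwise disjoint.\<close>

locale first_return =
  fixes \<beta> :: real and m :: nat and c :: real
  assumes beta: "1 < \<beta>"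
    and c_gt: "orb \<beta> (gap_count (Suc m)) < c" and c_lt: "c < 1"
    and upper: "\<And>x j. c < x \<Longrightarrow> x \<le> 1 \<Longrightarrow> j \<le> gap_count (Suc m) \<Longrightarrow>
      (neg_beta \<beta> ^^ j) x = orb \<beta> j + (- \<beta>) ^ j * (x - 1)"
    and lower: "\<And>x j. orb \<beta> (gap_count (Suc m)) \<le> x \<Longrightarrow> x < c \<Longrightarrow> j \<le> 2 * gap_count m \<Longrightarrow>
      (neg_beta \<beta> ^^ j) x = orb \<beta> (gap_count (Suc m) + j) + (- \<beta>) ^ j * (x - orb \<beta> (gap_count (Suc m)))"
    and upper_full: "\<beta> ^ gap_count (Suc m) * (1 - c) = 1 - orb \<beta> (gap_count (Suc m))"
    and lower_top: "\<beta> ^ (2 * gap_count m) * (c - orb \<beta> (gap_count (Suc m))) = 1 - orb \<beta> (gap_count (Suc (Suc m)))"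
    and lower_bot: "orb \<beta> (gap_count (Suc m)) \<le> orb \<beta> (gap_count (Suc (Suc m)))"
    and tower_inj: "inj_on (tower_map \<beta>) (tower \<beta> m c)"
begin

definition a where "a = orb \<beta> (gap_count (Suc m))"
definition q where "q = orb \<beta> (gap_count (Suc (Suc m)))"
definition s where "s = \<beta> ^ gap_count (Suc m)"
definition r where "r = \<beta> ^ (2 * gap_count m)"

lemma s_gt: "1 < s" and r_gt: "1 < r"
  unfolding s_def r_def using beta gap_count_pos by (auto intro!: one_less_power)

lemma neg_s: "(- \<beta>) ^ gap_count (Suc m) = - s"
  unfolding s_def using odd_gap_count by simp

lemma return_upper: "c < x \<Longrightarrow> x \<le> 1 \<Longrightarrow> (neg_beta \<beta> ^^ gap_count (Suc m)) x = a + s * (1 - x)"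
  using upper[of x "gap_count (Suc m)"] by (simp add: neg_s a_def[symmetric] algebra_simps)

lemma q_eq: "q = 1 - r * (c - a)"
  using lower_top by (simp add: q_def r_def a_def)

lemma return_lower: "a \<le> x \<Longrightarrow> x < c \<Longrightarrow> (neg_beta \<beta> ^^ (2 * gap_count m)) x = q + r * (x - a)"
  using lower[of x "2 * gap_count m"] by (simp add: r_def a_def q_def gap_count_Suc)

lemma a_lt_c: "a < c" and a_le_q: "a \<le> q" and full: "s * (1 - c) = 1 - a" and a_pos: "0 < a"
  using c_gt lower_bot upper_full iterate_pos[of 1] by (simp_all add: a_def q_def s_def)

lemma q_lt_1: "q < 1"
  using q_eq a_lt_c r_gt by simp

abbreviation W where "W \<equiv> tower_image \<beta> m c"

lemma tower_mem: "(x, j) \<in> tower \<beta> m c \<longleftrightarrow>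
    c < x \<and> x < 1 \<and> j < gap_count (Suc m) \<or> a < x \<and> x < c \<and> j < 2 * gap_count m"
  by (auto simp: tower_def a_def)

lemma W_memI: "(x, j) \<in> tower \<beta> m c \<Longrightarrow> (neg_beta \<beta> ^^ j) x \<in> W"
  by (force simp: tower_image_def tower_map_def)

lemma W_memE:
  assumes "y \<in> W"
  obtains x j where "(x, j) \<in> tower \<beta> m c" "y = (neg_beta \<beta> ^^ j) x"
  using assms by (auto simp: tower_image_def tower_map_def)

lemma W_eq: "W = (\<Union>j<gap_count (Suc m). (neg_beta \<beta> ^^ j) ` {c<..<1}) \<union> (\<Union>j<2 * gap_count m. (neg_beta \<beta> ^^ j) ` {a<..<c})"
  unfolding tower_image_def tower_map_def tower_def a_def by force

lemma upper_image: "j \<le> gap_count (Suc m) \<Longrightarrow> S \<subseteq> {c<..1} \<Longrightarrow>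
    (neg_beta \<beta> ^^ j) ` S = (\<lambda>x. orb \<beta> j + (- \<beta>) ^ j * (x - 1)) ` S"
  by (rule image_cong[OF refl]) (rule upper, auto)

lemma lower_image: "j \<le> 2 * gap_count m \<Longrightarrow> S \<subseteq> {a..<c} \<Longrightarrow>
    (neg_beta \<beta> ^^ j) ` S = (\<lambda>x. orb \<beta> (gap_count (Suc m) + j) + (- \<beta>) ^ j * (x - a)) ` S"
  unfolding a_def by (rule image_cong[OF refl]) (rule lower, auto)

lemma open_W: "open W"
proof -
  have "open ((neg_beta \<beta> ^^ j) ` {c<..<1})" if "j < gap_count (Suc m)" for j
    using that beta by (subst upper_image) (auto simp: affine_image_open)
  moreover have "open ((neg_beta \<beta> ^^ j) ` {a<..<c})" if "j < 2 * gap_count m" for j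
    using that beta by (subst lower_image) (auto simp: affine_image_open)
  ultimately show ?thesis unfolding W_eq by blast
qed

lemma W_subset: "W \<subseteq> {0<..<1}"
proof (rule open_subset_Ioc[OF open_W], rule subsetI)
  fix y assume "y \<in> W"
  then obtain x j where x: "(x, j) \<in> tower \<beta> m c" "y = (neg_beta \<beta> ^^ j) x" by (rule W_memE)
  then have "0 < x" "x \<le> 1" using a_pos a_lt_c c_lt unfolding tower_mem by auto
  then show "y \<in> {0<..1}" using x iterate_pos iterate_le_1 by simp
qed

lemma base_in_W: "a < x \<Longrightarrow> x < 1 \<Longrightarrow> x \<noteq> c \<Longrightarrow> x \<in> W"
  using W_memI[of x 0] gap_count_pos[of m] gap_count_pos[of "Suc m"] by (simp add: tower_mem) linarith

lemma W_nonempty: "W \<noteq> {}"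
proof -
  obtain x where "c < x" "x < 1" using c_lt dense by blast
  then show ?thesis using base_in_W[of x] a_lt_c by auto
qed

text \<open>Below the top of the tower the map climbs one level; from the top it returns to
  \<open>(a, 1)\<close>, where only the break point is missing from the base.\<close>

lemma W_forward: "neg_beta \<beta> ` W \<subseteq> insert c W"
proof
  fix z assume "z \<in> neg_beta \<beta> ` W"
  then obtain x j where x: "(x, j) \<in> tower \<beta> m c" "z = (neg_beta \<beta> ^^ Suc j) x"
    by (auto elim: W_memE)
  show "z \<in> insert c W"
  proof (cases "(x, Suc j) \<in> tower \<beta> m c")
    case True
    then show ?thesis using W_memI x by blast
  next
    case False
    then consider "c < x" "x < 1" "Suc j = gap_count (Suc m)" | "a < x" "x < c" "Suc j = 2 * gap_count m"
      using x unfolding tower_mem by linarith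
    then have "a < z \<and> z < 1"
    proof cases
      case 1
      then have "z = a + s * (1 - x)" using return_upper[of x] x by simp
      moreover have "s * (1 - x) < s * (1 - c)" "0 < s * (1 - x)" using 1 s_gt by auto
      ultimately show ?thesis using full by simp
    next
      case 2
      then have "z = q + r * (x - a)" using return_lower[of x] x by simp
      moreover have "r * (x - a) < r * (c - a)" "0 < r * (x - a)" using 2 r_gt by auto
      ultimately show ?thesis using q_eq a_le_q by simp
    qed
    then show ?thesis using base_in_W[of z] by blast
  qed
qed

definition b where "b = a + s * (1 - q)"

text \<open>The assumption says that \<open>q\<close> lies above the fixed point of the upper branch. Then \<open>b\<close>, the return
  of \<open>q\<close>, lies below it, and no point of \<open>{q<..<1}\<close> ever returns to \<open>{b<..<q}\<close>.\<close>

context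
  assumes gap: "r * s\<^sup>2 < r + s"
begin

lemma b_lt_q: "b < q"
proof -
  have sc: "s * (c - a) = (s - 1) * (1 - a)" using full by (simp add: algebra_simps)
  have "s * ((s + 1) * (1 - q)) = (s + 1) * r * (s * (c - a))" using q_eq by simp
  also have "\<dots> = (r * s\<^sup>2 - r) * (1 - a)"
    unfolding sc by (simp add: power2_eq_square algebra_simps)
  also have "\<dots> < s * (1 - a)" using gap a_lt_c c_lt by (intro mult_strict_right_mono) auto
  finally have "(s + 1) * (1 - q) < 1 - a" using s_gt by simp
  then show ?thesis by (simp add: b_def algebra_simps)
qed

lemma c_lt_q: "c < q"
proof (rule ccontr)
  assume "\<not> c < q"
  then have "s * (1 - c) \<le> s * (1 - q)" using s_gt by auto
  then have "1 \<le> b" using full by (simp add: b_def)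
  then show False using b_lt_q q_lt_1 by simp
qed

lemma c_lt_b: "c < b"
proof (rule ccontr)
  assume "\<not> c < b"
  then have "r * (b - a) \<le> r * (c - a)" using r_gt by simp
  then have "r * s * (1 - q) \<le> 1 * (1 - q)" using q_eq by (simp add: b_def)
  then have "r * s \<le> 1" using q_lt_1 by (subst (asm) mult_le_cancel_right) auto
  moreover have "1 < r * s" using less_1_mult[OF r_gt s_gt] .
  ultimately show False by simp
qed

text \<open>The point whose upper return is \<open>c\<close>; it is the break point of the next
  return map.\<close>

definition c' where "c' = 1 - (c - a) / s"

lemma s_c': "s * (1 - c') = c - a"
  using s_gt by (simp add: c'_def)

lemma q_lt_c': "q < c'" and c'_lt_1: "c' < 1"
proof -
  have "s * (1 - c') < s * (1 - q)" using s_c' c_lt_b by (simp add: b_def)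
  then show "q < c'" using s_gt by simp
  have "0 < s * (1 - c')" using s_c' a_lt_c by simp
  then show "c' < 1" using s_gt by (simp add: zero_less_mult_iff)
qed

lemma return_above: "c' < x \<Longrightarrow> x \<le> 1 \<Longrightarrow> a \<le> a + s * (1 - x) \<and> a + s * (1 - x) < c"
proof -
  assume x: "c' < x" "x \<le> 1"
  then have "s * (1 - x) < s * (1 - c')" "0 \<le> s * (1 - x)" using s_gt by auto
  then show ?thesis using s_c' by simp
qed

lemma return_below: "q \<le> x \<Longrightarrow> x < c' \<Longrightarrow> c < a + s * (1 - x) \<and> a + s * (1 - x) \<le> b"
proof -
  assume x: "q \<le> x" "x < c'"
  then have "s * (1 - c') < s * (1 - x)" "s * (1 - x) \<le> s * (1 - q)" using s_gt by auto
  then show ?thesis using s_c' by (simp add: b_def)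
qed

lemma orb_q: "orb \<beta> (gap_count (Suc (Suc m)) + j) = (neg_beta \<beta> ^^ j) q"
  unfolding q_def by (rule funpow_add_apply)

lemma orb_b: "orb \<beta> (gap_count (Suc (Suc m)) + gap_count (Suc m) + j) = (neg_beta \<beta> ^^ j) b"
  using return_upper[of q] c_lt_q q_lt_1 unfolding funpow_add_apply q_def[symmetric] by (simp add: b_def)

text \<open>An upper return from above \<open>c'\<close> lands in \<open>[a, c)\<close>, so a lower
  return follows; the times add up to \<open>gap_count (Suc (Suc m))\<close>.\<close>

lemma next_upper:
  assumes x: "c' < x" "x \<le> 1" and j: "j \<le> gap_count (Suc (Suc m))"
  shows "(neg_beta \<beta> ^^ j) x = orb \<beta> j + (- \<beta>) ^ j * (x - 1)"
proof (cases "j \<le> gap_count (Suc m)")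
  case True
  then show ?thesis using upper[of x j] x q_lt_c' c_lt_q by simp
next
  case False
  define i where "i = j - gap_count (Suc m)"
  have i: "j = gap_count (Suc m) + i" "i \<le> 2 * gap_count m"
    using False j by (auto simp: i_def gap_count_Suc)
  have "(neg_beta \<beta> ^^ j) x = (neg_beta \<beta> ^^ i) (a + s * (1 - x))"
    using return_upper[of x] x q_lt_c' c_lt_q unfolding i funpow_add_apply by simp
  also have "\<dots> = orb \<beta> j + (- \<beta>) ^ i * (s * (1 - x))"
    using lower[of "a + s * (1 - x)" i] return_above[OF x] i by (simp add: a_def[symmetric])
  also have "(- \<beta>) ^ i * (s * (1 - x)) = (- \<beta>) ^ j * (x - 1)"
    unfolding i power_add neg_s by (simp add: algebra_simps)
  finally show ?thesis .
qed

text \<open>An upper return from \<open>[q, c')\<close> lands in \<open>(c, b]\<close>, so a second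
  upper return follows and orientation is restored.\<close>

lemma next_lower:
  assumes x: "q \<le> x" "x < c'" and j: "j \<le> 2 * gap_count (Suc m)"
  shows "(neg_beta \<beta> ^^ j) x = orb \<beta> (gap_count (Suc (Suc m)) + j) + (- \<beta>) ^ j * (x - q)"
proof (cases "j \<le> gap_count (Suc m)")
  case True
  then show ?thesis using upper[of x j] upper[of q j] x c'_lt_1 c_lt_q q_lt_1
    unfolding orb_q by (simp add: algebra_simps)
next
  case False
  define i where "i = j - gap_count (Suc m)"
  have i: "j = gap_count (Suc m) + i" "i \<le> gap_count (Suc m)" using False j by (auto simp: i_def)
  have "(neg_beta \<beta> ^^ j) x = (neg_beta \<beta> ^^ i) (a + s * (1 - x))"
    using return_upper[of x] x c_lt_q c'_lt_1 unfolding i funpow_add_apply by simp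
  also have "\<dots> = orb \<beta> i + (- \<beta>) ^ i * (a + s * (1 - x) - 1)"
    using upper[of "a + s * (1 - x)" i] return_below[OF x] i b_lt_q q_lt_1 by simp
  \<comment> \<open>The affine formula is anchored at \<open>b\<close> instead of 1, because
    \<open>b\<close> is the return of \<open>q\<close> and so supplies the orbit time in the
    claim.\<close>
  also have "\<dots> = (neg_beta \<beta> ^^ i) b + (- \<beta>) ^ i * (a + s * (1 - x) - b)"
    using upper[of b i] c_lt_b i b_lt_q q_lt_1 by (simp add: algebra_simps)
  also have "(neg_beta \<beta> ^^ i) b = orb \<beta> (gap_count (Suc (Suc m)) + j)"
    using orb_b[of i] i by (simp add: add.assoc)
  also have "(- \<beta>) ^ i * (a + s * (1 - x) - b) = (- \<beta>) ^ j * (x - q)"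
    unfolding i power_add neg_s b_def by (simp add: algebra_simps)
  finally show ?thesis .
qed

text \<open>Points of the next tower above height \<open>gap_count (Suc m)\<close> are relabelled by the point of the
  present base where they have returned.\<close>

definition relabel :: "real \<times> nat \<Rightarrow> real \<times> nat" where
  "relabel = (\<lambda>(x, j). if j < gap_count (Suc m) then (x, j) else (a + s * (1 - x), j - gap_count (Suc m)))"

lemma next_tower_mem: "(x, j) \<in> tower \<beta> (Suc m) c' \<longleftrightarrow>
    c' < x \<and> x < 1 \<and> j < gap_count (Suc (Suc m)) \<or> q < x \<and> x < c' \<and> j < 2 * gap_count (Suc m)"
  by (auto simp: tower_def q_def)

lemma relabel_cases:
  assumes "(x, j) \<in> tower \<beta> (Suc m) c'"
  shows "q < x \<and> x < 1 \<and> x \<noteq> c' \<and>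
    (j < gap_count (Suc m) \<and> relabel (x, j) = (x, j) \<or>
     gap_count (Suc m) \<le> j \<and> relabel (x, j) = (a + s * (1 - x), j - gap_count (Suc m)) \<and>
       (c' < x \<and> a < a + s * (1 - x) \<and> a + s * (1 - x) < c \<or> x < c' \<and> c < a + s * (1 - x) \<and> a + s * (1 - x) < b))"
proof -
  have x: "q < x" "x < 1" "x \<noteq> c'" using assms q_lt_c' c'_lt_1 unfolding next_tower_mem by auto
  have "0 < s * (1 - x)" "s * (1 - x) < s * (1 - q)" using x s_gt by auto
  then show ?thesis
    using x return_above[of x] return_below[of x] by (cases "c' < x") (auto simp: relabel_def b_def)
qed

lemma relabel_in_tower:
  assumes "(x, j) \<in> tower \<beta> (Suc m) c'"
  shows "relabel (x, j) \<in> tower \<beta> m c"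
proof (cases "j < gap_count (Suc m)")
  case True
  then show ?thesis using relabel_cases[OF assms] c_lt_q by (auto simp: tower_mem)
next
  case False
  then show ?thesis using relabel_cases[OF assms] assms b_lt_q q_lt_1 c_lt a_lt_c
    unfolding next_tower_mem by (auto simp: tower_mem gap_count_Suc)
qed

lemma relabel_map:
  assumes "(x, j) \<in> tower \<beta> (Suc m) c'"
  shows "tower_map \<beta> (relabel (x, j)) = tower_map \<beta> (x, j)"
proof (cases "j < gap_count (Suc m)")
  case False
  then have "(neg_beta \<beta> ^^ j) x = (neg_beta \<beta> ^^ (j - gap_count (Suc m))) ((neg_beta \<beta> ^^ gap_count (Suc m)) x)"
    by (metis funpow_add_apply le_add_diff_inverse linorder_not_less)
  then show ?thesis using False return_upper[of x] relabel_cases[OF assms] c_lt_q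
    by (simp add: tower_map_def relabel_def)
qed (simp add: tower_map_def relabel_def)

lemma relabel_inj: "inj_on relabel (tower \<beta> (Suc m) c')"
proof (rule inj_onI, clarify)
  fix x j y i
  assume xy: "(x, j) \<in> tower \<beta> (Suc m) c'"
    "(y, i) \<in> tower \<beta> (Suc m) c'" and eq: "relabel (x, j) = relabel (y, i)"
  then show "x = y \<and> j = i"
    using relabel_cases[OF xy(1)] relabel_cases[OF xy(2)] b_lt_q c_lt_q s_gt by auto
qed

lemma next_tower_inj: "inj_on (tower_map \<beta>) (tower \<beta> (Suc m) c')"
proof -
  have "inj_on (tower_map \<beta> \<circ> relabel) (tower \<beta> (Suc m) c')"
    using relabel_inj tower_inj relabel_in_tower
    by (intro comp_inj_on) (auto intro!: inj_on_subset[OF tower_inj] simp: image_subset_iff)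
  then show ?thesis using relabel_map by (subst inj_on_cong[of _ _ "tower_map \<beta> \<circ> relabel"]) auto
qed

lemma next_first_return: "first_return \<beta> (Suc m) c'"
proof
  show "1 < \<beta>" by (rule beta)
  show "orb \<beta> (gap_count (Suc (Suc m))) < c'" using q_lt_c' by (simp add: q_def)
  show "c' < 1" by (rule c'_lt_1)
  show "\<beta> ^ gap_count (Suc (Suc m)) * (1 - c') = 1 - orb \<beta> (gap_count (Suc (Suc m)))"
  proof -
    have "\<beta> ^ gap_count (Suc (Suc m)) * (1 - c') = r * (s * (1 - c'))"
      by (simp add: gap_count_Suc power_add r_def s_def)
    also have "\<dots> = 1 - q" using s_c' q_eq by simp
    finally show ?thesis by (simp add: q_def)
  qed
  \<comment> \<open>Two upper returns take \<open>q\<close> to \<open>b\<close> and on to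
    \<open>a + s * (1 - b)\<close>; each of them adds \<open>gap_count (Suc m)\<close> to the orbit
    time.\<close>
  have q3: "orb \<beta> (gap_count (Suc (Suc (Suc m)))) = a + s * (1 - b)"
    using orb_b[of "gap_count (Suc m)"] return_upper[of b] c_lt_b b_lt_q q_lt_1
    by (simp add: gap_count_Suc[of "Suc m"] add.assoc mult_2)
  show "\<beta> ^ (2 * gap_count (Suc m)) * (c' - orb \<beta> (gap_count (Suc (Suc m)))) = 1 - orb \<beta> (gap_count (Suc (Suc (Suc m))))"
  proof -
    have "\<beta> ^ (2 * gap_count (Suc m)) * (c' - q) = s * (s * (1 - q) - s * (1 - c'))"
      unfolding mult_2 power_add s_def by (simp add: algebra_simps)
    also have "\<dots> = s * (1 - c) - s * (1 - b)" unfolding s_c' by (simp add: b_def algebra_simps)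
    finally show ?thesis using full q3 by (simp add: q_def)
  qed
  \<comment> \<open>By definition of \<open>b\<close> the second return of \<open>q\<close> equals
    \<open>b + s * (q - b)\<close>, which is above \<open>q\<close> because
    \<open>s > 1\<close>.\<close>
  show "orb \<beta> (gap_count (Suc (Suc m))) \<le> orb \<beta> (gap_count (Suc (Suc (Suc m))))"
  proof -
    have "1 * (q - b) \<le> s * (q - b)" using s_gt b_lt_q by (intro mult_right_mono) auto
    then have "q \<le> a + s * (1 - b)" by (simp add: b_def algebra_simps)
    then show ?thesis using q3 by (simp add: q_def)
  qed
  show "inj_on (tower_map \<beta>) (tower \<beta> (Suc m) c')" by (rule next_tower_inj)
next
  fix x j assume "c' < x" "x \<le> 1" "j \<le> gap_count (Suc (Suc m))"
  then show "(neg_beta \<beta> ^^ j) x = orb \<beta> j + (- \<beta>) ^ j * (x - 1)" by (rule next_upper)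
next
  fix x j assume "orb \<beta> (gap_count (Suc (Suc m))) \<le> x" "x < c'" "j \<le> 2 * gap_count (Suc m)"
  then show "(neg_beta \<beta> ^^ j) x = orb \<beta> (gap_count (Suc (Suc m)) + j) + (- \<beta>) ^ j * (x - orb \<beta> (gap_count (Suc (Suc m))))"
    using next_lower unfolding q_def by blast
qed

abbreviation W' where "W' \<equiv> tower_image \<beta> (Suc m) c'"

lemma W'_subset: "W' \<subseteq> W"
proof
  fix y assume "y \<in> W'"
  then obtain x j where "(x, j) \<in> tower \<beta> (Suc m) c'" "y = tower_map \<beta> (x, j)"
    by (auto simp: tower_image_def)
  then show "y \<in> W" using relabel_map relabel_in_tower unfolding tower_image_def by (metis image_eqI)
qed

text \<open>The times in \<open>G\<close> are those of \<open>orb_q\<close> and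
  \<open>orb_b\<close>, because \<open>2 ^ (Suc m + 1)\<close> is the sum of two consecutive values
  of \<open>gap_count\<close>. Every step reverses orientation, hence the parity cases; the affine
  formula applies throughout since \<open>[b, q]\<close> lies above \<open>c\<close>.\<close>

lemma gap_image_open: "k < gap_count (Suc m) \<Longrightarrow> G \<beta> (Suc m) k = (neg_beta \<beta> ^^ k) ` {b<..<q}"
  and gap_image_closed: "k < gap_count (Suc m) \<Longrightarrow> closure (G \<beta> (Suc m) k) = (neg_beta \<beta> ^^ k) ` {b..q}"
  and gap_interval: "k < gap_count (Suc m) \<Longrightarrow> \<exists>l u. l < u \<and> G \<beta> (Suc m) k = {l<..<u}"
proof -
  assume k: "k < gap_count (Suc m)"
  have sub: "{b<..<q} \<subseteq> {c<..1}" "{b..q} \<subseteq> {c<..1}" using c_lt_b q_lt_1 by auto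
  have e1: "(neg_beta \<beta> ^^ (2 ^ (Suc m + 1) + k)) 1 = (neg_beta \<beta> ^^ k) b"
    unfolding power_two_gap_count using orb_b[of k] by (simp add: add.commute)
  have e2: "(neg_beta \<beta> ^^ (gap_exp (Suc m) + k)) 1 = (neg_beta \<beta> ^^ k) q"
    unfolding gap_exp_eq using orb_q[of k] by simp
  have vals: "(neg_beta \<beta> ^^ k) b = orb \<beta> k + (- \<beta>) ^ k * (b - 1)"
    "(neg_beta \<beta> ^^ k) q = orb \<beta> k + (- \<beta>) ^ k * (q - 1)"
    using k c_lt_b b_lt_q q_lt_1 by (auto intro!: upper)
  have pos: "0 < \<beta> ^ k" using beta by simp
  have Geq: "G \<beta> (Suc m) k = (if even k then {(neg_beta \<beta> ^^ k) b<..<(neg_beta \<beta> ^^ k) q} else {(neg_beta \<beta> ^^ k) q<..<(neg_beta \<beta> ^^ k) b})"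
    unfolding G_def e1 e2 ..
  have lt: "\<beta> ^ k * b < \<beta> ^ k * q" using b_lt_q pos by simp
  have ord: "if even k then (neg_beta \<beta> ^^ k) b < (neg_beta \<beta> ^^ k) q else (neg_beta \<beta> ^^ k) q < (neg_beta \<beta> ^^ k) b"
    unfolding vals using lt by (auto simp: algebra_simps)
  show "G \<beta> (Suc m) k = (neg_beta \<beta> ^^ k) ` {b<..<q}"
    unfolding Geq using k pos beta by (subst upper_image[OF _ sub(1)]) (auto simp: affine_image_open vals)
  show "closure (G \<beta> (Suc m) k) = (neg_beta \<beta> ^^ k) ` {b..q}"
    unfolding Geq
    using k pos beta ord by (subst upper_image[OF _ sub(2)]) (auto simp: affine_image_closed vals)
  show "\<exists>l u. l < u \<and> G \<beta> (Suc m) k = {l<..<u}"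
    unfolding Geq using ord by (cases "even k") auto
qed

lemma gap_tower: "k < gap_count (Suc m) \<Longrightarrow> x \<in> {b..q} \<Longrightarrow> (x, k) \<in> tower \<beta> m c"
  using c_lt_b q_lt_1 by (auto simp: tower_mem)

text \<open>As \<open>[b, q]\<close> stays inside \<open>(c, 1)\<close>, even the closures of the
  new gaps lie in \<open>W\<close>. The older gaps avoid this open set, and hence so do their
  closures; this separates the generations.\<close>

lemma gap_closure_subset: "k < gap_count (Suc m) \<Longrightarrow> closure (G \<beta> (Suc m) k) \<subseteq> W"
  unfolding gap_image_closed using gap_tower W_memI by blast

lemma gap_closure_disjoint:
  assumes "k < gap_count (Suc m)" "k' < gap_count (Suc m)" "k \<noteq> k'"
  shows "closure (G \<beta> (Suc m) k) \<inter> closure (G \<beta> (Suc m) k') = {}"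
proof -
  have "(neg_beta \<beta> ^^ k) x \<noteq> (neg_beta \<beta> ^^ k') y"
    if "x \<in> {b..q}" "y \<in> {b..q}" for x y
    using inj_onD[OF tower_inj, of "(x, k)" "(y, k')"] gap_tower that assms by (auto simp: tower_map_def)
  then show ?thesis using assms by (auto simp: gap_image_closed)
qed

text \<open>A common point would have one and the same label in the present tower, but relabelled
  points of the next tower never sit over \<open>(b, q)\<close>.\<close>

lemma gap_W'_disjoint:
  assumes k: "k < gap_count (Suc m)"
  shows "G \<beta> (Suc m) k \<inter> W' = {}"
proof -
  have False
    if x: "x \<in> {b<..<q}" and y: "(y, j) \<in> tower \<beta> (Suc m) c'" and eq: "tower_map \<beta> (y, j) = tower_map \<beta> (x, k)" for x y j
  proof -
    have "tower_map \<beta> (relabel (y, j)) = tower_map \<beta> (x, k)"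
      unfolding relabel_map[OF y] by (rule eq)
    moreover have "(x, k) \<in> tower \<beta> m c" using gap_tower[OF k] x by auto
    ultimately have "relabel (y, j) = (x, k)"
      using inj_onD[OF tower_inj] relabel_in_tower[OF y] by blast
    then show False using relabel_cases[OF y] x b_lt_q c_lt_b by auto
  qed
  then have "tower_map \<beta> (x, k) \<notin> W'" if "x \<in> {b<..<q}" for x
    unfolding tower_image_def using that by (metis imageE surj_pair)
  then show ?thesis unfolding gap_image_open[OF k] by (auto simp: tower_map_def)
qed

text \<open>Columns over \<open>(a, c)\<close> and \<open>(c, b)\<close> are reached by upper
  returns from \<open>(c', 1)\<close> and \<open>(q, c')\<close>, those over \<open>(b, q)\<close>
  are gaps, and those over \<open>(q, 1)\<close> without \<open>c'\<close> already belong to the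
  next tower. Only the columns over \<open>b\<close>, \<open>q\<close> and \<open>c'\<close>
  remain.\<close>

lemma finite_rest: "finite (W - W' - (\<Union>k<gap_count (Suc m). G \<beta> (Suc m) k))"
proof (rule finite_subset)
  show "W - W' - (\<Union>k<gap_count (Suc m). G \<beta> (Suc m) k) \<subseteq> (\<lambda>(x, k). (neg_beta \<beta> ^^ k) x) ` ({b, q, c'} \<times> {..<gap_count (Suc m)})"
  proof
    fix z assume z: "z \<in> W - W' - (\<Union>k<gap_count (Suc m). G \<beta> (Suc m) k)"
    then have "z \<in> W" by blast
    then obtain x k where x: "(x, k) \<in> tower \<beta> m c" "z = (neg_beta \<beta> ^^ k) x" by (rule W_memE)
    have W'I: "z \<in> W'" if "(y, j) \<in> tower \<beta> (Suc m) c'" "z = (neg_beta \<beta> ^^ j) y" for y j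
      unfolding tower_image_def using that by (intro image_eqI[of _ _ "(y, j)"]) (auto simp: tower_map_def)
    have via_return: "z \<in> W'"
      if "relabel (y, k + gap_count (Suc m)) = (x, k)"
      "(y, k + gap_count (Suc m)) \<in> tower \<beta> (Suc m) c'" for y
      by (rule W'I[OF that(2)]) (use relabel_map[OF that(2)] that(1) x in \<open>simp add: tower_map_def\<close>)
    \<comment> \<open>The preimage of \<open>x\<close> under the upper branch; in the next tower the
      same point is labelled \<open>gap_count (Suc m)\<close> levels higher.\<close>
    define y where "y = 1 - (x - a) / s"
    have y: "a + s * (1 - y) = x" using s_gt by (simp add: y_def)
    have rl: "relabel (y, k + gap_count (Suc m)) = (x, k)" by (simp add: relabel_def y)
    show "z \<in> (\<lambda>(x, k). (neg_beta \<beta> ^^ k) x) ` ({b, q, c'} \<times> {..<gap_count (Suc m)})"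
    proof (cases "x < c")
      case True
      then have xa: "a < x" "k < 2 * gap_count m" using x by (auto simp: tower_mem)
      have "0 < s * (1 - y)" "s * (1 - y) < s * (1 - c')" using y s_c' xa True by auto
      then have "y < 1" "c' < y" using s_gt by (auto simp: zero_less_mult_iff)
      then show ?thesis using via_return[OF rl] xa z by (auto simp: next_tower_mem gap_count_Suc)
    next
      case False
      then have xc: "c < x" "x < 1" "k < gap_count (Suc m)" using x by (auto simp: tower_mem)
      show ?thesis
      proof (cases "x < b")
        case True
        have "s * (1 - c') < s * (1 - y)" "s * (1 - y) < s * (1 - q)"
          using y s_c' xc True by (auto simp: b_def)
        then have "q < y" "y < c'" using s_gt by auto
        then show ?thesis using via_return[OF rl] xc z by (auto simp: next_tower_mem)
      next
        case False
        have "z \<in> (\<Union>k<gap_count (Suc m). G \<beta> (Suc m) k)" if "b < x" "x < q"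
          using that xc gap_image_open[of k] unfolding x(2) by auto
        moreover have "z \<in> W'" if "q < x" "x \<noteq> c'"
          using that x xc gap_count_Suc by (intro W'I[of x k]) (auto simp: next_tower_mem)
        ultimately have "\<not> (b < x \<and> x < q)" "\<not> (q < x \<and> x \<noteq> c')" using z by blast+
        then have "x \<in> {b, q, c'}" using False by auto
        then have "(x, k) \<in> {b, q, c'} \<times> {..<gap_count (Suc m)}" using xc by simp
        then show ?thesis unfolding x(2) by (rule rev_image_eqI) simp
      qed
    qed
  qed
qed auto

end

end

text \<open>By \<open>gap_count_double\<close> one of the two powers is \<beta> times the other.
  Cancelling the smaller one leaves \<beta> + 1 on the right.\<close>

lemma gap_condition:
  assumes "1 < \<beta>"
  shows "\<beta> ^ (2 * gap_count m) * (\<beta> ^ gap_count (Suc m))\<^sup>2 < \<beta> ^ (2 * gap_count m) + \<beta> ^ gap_count (Suc m) \<longleftrightarrow>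
    \<beta> ^ (g (Suc (Suc m)) + 1) < \<beta> + (1::real)"
proof (cases "even m")
  case True
  define s where "s = \<beta> ^ gap_count (Suc m)"
  have "s > 0" using assms by (simp add: s_def)
  have "2 * gap_count m = gap_count (Suc m) + 1" using gap_count_double[of m] True by simp
  then have r: "\<beta> ^ (2 * gap_count m) = \<beta> * s" by (simp add: s_def)
  have "g (Suc (Suc m)) + 1 = gap_count (Suc m) + gap_count (Suc m) + 1"
    using gap_count_g[of "m + 1"] gap_count_Suc[of m] gap_count_double[of m] True by simp
  then have "\<beta> ^ (g (Suc (Suc m)) + 1) = s * s * \<beta>"
    by (simp only: power_add power_one_right s_def)
  moreover have "\<beta> * s * s\<^sup>2 < \<beta> * s + s \<longleftrightarrow> s * (s * s * \<beta>) < s * (\<beta> + 1)"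
    by (simp add: power2_eq_square algebra_simps)
  ultimately show ?thesis
    using mult_less_cancel_left_pos[OF \<open>s > 0\<close>] by (simp only: r s_def[symmetric])
next
  case False
  define r where "r = \<beta> ^ (2 * gap_count m)"
  have "r > 0" using assms by (simp add: r_def)
  have e: "gap_count (Suc m) = 2 * gap_count m + 1" using gap_count_double[of m] False by simp
  then have s: "\<beta> ^ gap_count (Suc m) = \<beta> * r" by (simp add: r_def)
  have "g (Suc (Suc m)) + 1 = gap_count (Suc m) + gap_count (Suc m)"
    using gap_count_g[of "m + 1"] gap_count_Suc[of m] e False by simp
  then have "\<beta> ^ (g (Suc (Suc m)) + 1) = \<beta> * r * (\<beta> * r)" by (simp only: power_add s)
  moreover have "r * (\<beta> * r)\<^sup>2 < r + \<beta> * r \<longleftrightarrow> r * (\<beta> * r * (\<beta> * r)) < r * (\<beta> + 1)"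
    by (simp add: power2_eq_square algebra_simps)
  ultimately show ?thesis
    using mult_less_cancel_left_pos[OF \<open>r > 0\<close>] by (simp only: s r_def[symmetric])
qed

lemma gap_index_Suc: "gap_index (Suc n) = gap_index n \<union> {n} \<times> {..<gap_count n}"
  by (auto simp: gap_index_def less_Suc_eq)

lemma gap_index_0: "gap_index 0 = {}" and gap_index_1: "gap_index (Suc 0) = {(0, 0)}"
  using gap_count_0 by (auto simp: gap_index_def)

lemma gap_decomposition_0: "gap_decomposition \<beta> 0 {0<..<1}"
  by (auto simp: gap_decomposition_def gap_index_0 disjoint_family_on_def)

lemma (in first_return) gap_decomposition_step:
  assumes gap: "r * s\<^sup>2 < r + s" and dec: "gap_decomposition \<beta> (Suc m) W"
  shows "gap_decomposition \<beta> (Suc (Suc m)) (tower_image \<beta> (Suc m) c')"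
proof -
  interpret nxt: first_return \<beta> "Suc m" c' by (rule next_first_return[OF gap])
  let ?W' = "tower_image \<beta> (Suc m) c'"
  let ?U = "\<lambda>n. \<Union>(m, k)\<in>gap_index n. G \<beta> m k"
  have U: "?U (Suc (Suc m)) = ?U (Suc m) \<union> (\<Union>k<gap_count (Suc m). G \<beta> (Suc m) k)"
    by (auto simp: gap_index_Suc)
  have "finite ({0<..<1} - W - ?U (Suc m))" using dec by (simp add: gap_decomposition_def)
  then have "finite (({0<..<1} - W - ?U (Suc m)) \<union> (W - ?W' - (\<Union>k<gap_count (Suc m). G \<beta> (Suc m) k)))"
    using finite_rest[OF gap] by blast
  then have fin: "finite ({0<..<1} - ?W' - ?U (Suc (Suc m)))"
    unfolding U by (rule finite_subset[rotated]) blast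
  have old: "(\<exists>l u. l < u \<and> G \<beta> i k = {l<..<u}) \<and> G \<beta> i k \<subseteq> {0<..<1} \<and> G \<beta> i k \<inter> W = {}"
    if "(i, k) \<in> gap_index (Suc m)" for i k
    using dec that by (auto simp: gap_decomposition_def)
  have new: "(\<exists>l u. l < u \<and> G \<beta> (Suc m) k = {l<..<u}) \<and> G \<beta> (Suc m) k \<subseteq> W \<and> G \<beta> (Suc m) k \<inter> ?W' = {}"
    if "k < gap_count (Suc m)" for k
    using gap_interval[OF gap that] gap_closure_subset[OF gap that] gap_W'_disjoint[OF gap that] closure_subset by blast
  have props: "\<forall>(i, k)\<in>gap_index (Suc (Suc m)). (\<exists>l u. l < u \<and> G \<beta> i k = {l<..<u}) \<and> G \<beta> i k \<subseteq> {0<..<1} \<and> G \<beta> i k \<inter> ?W' = {}"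
  proof (rule ballI, clarify)
    fix i k assume "(i, k) \<in> gap_index (Suc (Suc m))"
    then consider "(i, k) \<in> gap_index (Suc m)" | "i = Suc m" "k < gap_count (Suc m)"
      by (auto simp: gap_index_Suc[of "Suc m"])
    then show "(\<exists>l u. l < u \<and> G \<beta> i k = {l<..<u}) \<and> G \<beta> i k \<subseteq> {0<..<1} \<and> G \<beta> i k \<inter> ?W' = {}"
    proof cases
      case 1
      then show ?thesis using old[OF 1] W'_subset[OF gap] by blast
    next
      case 2
      then show ?thesis using new[OF 2(2)] W_subset by blast
    qed
  qed
  have old_new: "closure (G \<beta> i k) \<inter> closure (G \<beta> (Suc m) k') = {}"
    if "(i, k) \<in> gap_index (Suc m)" "k' < gap_count (Suc m)" for i k k'
  proof -
    have "W \<inter> closure (G \<beta> i k) = {}"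
      using old[OF that(1)] open_W open_Int_closure_eq_empty by blast
    then show ?thesis using gap_closure_subset[OF gap that(2)] by blast
  qed
  have "disjoint_family_on (\<lambda>(m, k). closure (G \<beta> m k)) (gap_index (Suc m))"
    using dec by (simp add: gap_decomposition_def)
  then have old_old: "closure (G \<beta> i k) \<inter> closure (G \<beta> i' k') = {}"
    if "(i, k) \<in> gap_index (Suc m)" "(i', k') \<in> gap_index (Suc m)" "(i, k) \<noteq> (i', k')"
    for i k i' k'
    using that unfolding disjoint_family_on_def by blast
  have "closure (G \<beta> i k) \<inter> closure (G \<beta> i' k') = {}"
    if "(i, k) \<in> gap_index (Suc (Suc m))" "(i', k') \<in> gap_index (Suc (Suc m))"
    "(i, k) \<noteq> (i', k')" for i k i' k'
  proof -
    have split: "(i, k) \<in> gap_index (Suc m) \<or> i = Suc m \<and> k < gap_count (Suc m)"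
      if "(i, k) \<in> gap_index (Suc (Suc m))" for i k
      using that by (auto simp: gap_index_Suc[of "Suc m"])
    show ?thesis
      using split[OF that(1)] split[OF that(2)] that(3) old_old[of i k i' k'] old_new[of i k k'] old_new[of i' k' k]
        gap_closure_disjoint[OF gap, of k k'] by blast
  qed
  then have "disjoint_family_on (\<lambda>(m, k). closure (G \<beta> m k)) (gap_index (Suc (Suc m)))"
    unfolding disjoint_family_on_def by blast
  then show ?thesis
    unfolding gap_decomposition_def using nxt.open_W nxt.W_subset nxt.W_nonempty fin props by blast
qed

text \<open>Start of the renormalisation. Since \<beta> < 2, the only break point inside is
  \<open>1 / \<beta>\<close>: above it the map itself returns to \<open>(t1, 1)\<close>, below it
  the second iterate does, after a visit to \<open>(0, t2)\<close>. Apart from endpoints and the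
  break point, the tower misses just \<open>(t2, t1)\<close>, the first gap.\<close>

lemma first_return_base:
  assumes beta: "1 < \<beta>" and small: "\<beta>\<^sup>2 < \<beta> + 1"
  shows "first_return \<beta> 0 (1 / \<beta>)"
    "gap_decomposition \<beta> (Suc 0) (tower_image \<beta> 0 (1 / \<beta>))"
proof -
  have J: "gap_count 0 = 1" "gap_count (Suc 0) = 1" "gap_count (Suc (Suc 0)) = 3"
    using gap_count_0 gap_count_1 gap_count_Suc[of 0] by simp_all
  have sq: "0 < (\<beta> - 1) * (\<beta> - 1)" using beta by simp
  have b2: "\<beta> < 2"
  proof (rule ccontr)
    assume "\<not> \<beta> < 2"
    then have "2 * \<beta> \<le> \<beta>\<^sup>2" using beta by (simp add: power2_eq_square)
    then show False using small beta by linarith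
  qed
  have low: "neg_beta \<beta> x = 1 - \<beta> * x" if "0 \<le> x" "x < 1 / \<beta>" for x
    using neg_beta_floor[of 0 \<beta> x] that beta by (simp add: field_simps)
  have high: "neg_beta \<beta> x = 2 - \<beta> * x" if "1 / \<beta> \<le> x" "x \<le> 1" for x
  proof -
    have "\<beta> * x \<le> \<beta> * 1" using that beta by (intro mult_left_mono) auto
    then have "\<beta> * x < 2" using b2 by linarith
    then show ?thesis using neg_beta_floor[of 1 \<beta> x] that beta by (simp add: field_simps)
  qed
  define d where "d = 1 / \<beta>"
  have d: "\<beta> * d = 1" "0 < d" "d < 1" using beta by (simp_all add: d_def)
  define t1 t2 t3 where "t1 = 2 - \<beta>" and "t2 = 1 - \<beta> * t1" and "t3 = 1 - \<beta> * t2"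
  have t1: "0 < t1" "t1 < d"
  proof -
    have "\<beta> * t1 < \<beta> * d" unfolding d t1_def using sq by (simp add: algebra_simps)
    then show "t1 < d" using beta by simp
  qed (use b2 in \<open>simp add: t1_def\<close>)
  have t21: "t2 < t1" using small by (simp add: t1_def t2_def power2_eq_square algebra_simps)
  have t2: "0 < t2" using sq by (simp add: t2_def t1_def algebra_simps)
  have orb: "neg_beta \<beta> 1 = t1" "neg_beta \<beta> t1 = t2" "neg_beta \<beta> t2 = t3"
    using high[of 1] low[of t1] low[of t2] t1 t2 t21 d
    by (simp_all add: d_def[symmetric] t1_def[symmetric] t2_def[symmetric] t3_def[symmetric])
  have t3: "t1 \<le> t3"
  proof -
    \<comment> \<open>The left side equals \<open>t1 - t3\<close>.\<close>
    have "(\<beta> - 1) * (\<beta>\<^sup>2 - \<beta> - 1) \<le> 0"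
      using beta small by (intro mult_nonneg_nonpos) auto
    then show ?thesis by (simp add: t1_def t2_def t3_def power2_eq_square algebra_simps)
  qed
  have image_eq: "tower_image \<beta> 0 d = {d<..<1} \<union> {t1<..<d} \<union> {0<..<t2}"
  proof -
    have "tower \<beta> 0 d = (\<lambda>x. (x, 0)) ` {d<..<1} \<union> (\<lambda>x. (x, 0)) ` {t1<..<d} \<union> (\<lambda>x. (x, 1)) ` {t1<..<d}"
      by (auto simp: tower_def J orb less_2_cases_iff)
    then have "tower_image \<beta> 0 d = {d<..<1} \<union> {t1<..<d} \<union> neg_beta \<beta> ` {t1<..<d}"
      unfolding tower_image_def by (simp add: image_Un image_image tower_map_def)
    also have "neg_beta \<beta> ` {t1<..<d} = (\<lambda>x. 1 + (- \<beta>) * (x - 0)) ` {t1<..<d}"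
      using low t1 d_def by (intro image_cong) auto
    also have "\<dots> = {0<..<t2}" using beta d by (subst affine_image_open) (auto simp: t2_def)
    finally show ?thesis .
  qed
  have full_eq: "\<beta> * (1 - d) = 1 - t1" using d by (simp add: t1_def algebra_simps)
  have "\<beta> * \<beta> * (d - t1) = \<beta> * (\<beta> * d) - \<beta> * \<beta> * t1"
    by (simp add: algebra_simps)
  then have low_eq: "\<beta> * \<beta> * (d - t1) = 1 - t3"
    unfolding d t2_def t3_def by (simp add: algebra_simps)
  show fr: "first_return \<beta> 0 (1 / \<beta>)"
    unfolding d_def[symmetric]
  proof
    fix x j assume "d < x" "x \<le> 1" "j \<le> gap_count (Suc 0)"
    then have "j = 0 \<or> j = 1" by (auto simp: J)
    then show "(neg_beta \<beta> ^^ j) x = orb \<beta> j + (- \<beta>) ^ j * (x - 1)"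
      using high[of x] high[of 1] \<open>d < x\<close> \<open>x \<le> 1\<close> d
      by (auto simp: d_def algebra_simps)
  next
    fix x j assume x: "orb \<beta> (gap_count (Suc 0)) \<le> x" "x < d" and j: "j \<le> 2 * gap_count 0"
    have x': "t1 \<le> x" using x by (simp add: J orb)
    have T: "neg_beta \<beta> x = 1 - \<beta> * x" using low[of x] x' x t1 d_def by simp
    have T2: "neg_beta \<beta> (1 - \<beta> * x) = 1 - \<beta> * (1 - \<beta> * x)"
    proof -
      have "\<beta> * x < \<beta> * d" "\<beta> * t1 \<le> \<beta> * x" using x x' beta by auto
      then have "0 \<le> 1 - \<beta> * x" "1 - \<beta> * x < d" using d t2_def t21 t1 by auto
      then show ?thesis using low d_def by simp
    qed
    have e1: "1 - \<beta> * x = t2 + (- \<beta>) * (x - t1)" by (simp add: t2_def algebra_simps)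
    have e2: "1 - \<beta> * (1 - \<beta> * x) = t3 + \<beta> * \<beta> * (x - t1)"
      by (simp add: t2_def t3_def algebra_simps)
    have "j = 0 \<or> j = 1 \<or> j = 2" using j J by auto
    then show "(neg_beta \<beta> ^^ j) x = orb \<beta> (gap_count (Suc 0) + j) + (- \<beta>) ^ j * (x - orb \<beta> (gap_count (Suc 0)))"
    proof (elim disjE)
      assume "j = 1" then show ?thesis using e1 by (simp add: J orb T)
    next
      assume "j = 2" then show ?thesis using e2 by (simp add: J orb T T2 numeral_2_eq_2)
    qed (simp add: J orb)
  next
    show "inj_on (tower_map \<beta>) (tower \<beta> 0 d)"
    proof -
      have T: "neg_beta \<beta> x = 1 - \<beta> * x \<and> 1 - \<beta> * x < t2" if "t1 < x" "x < d" for x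
        using low[of x] that t1 d_def beta by (simp add: t2_def)
      show ?thesis
      proof (rule inj_onI, clarify)
        fix x i y j assume xy: "(x, i) \<in> tower \<beta> 0 d" "(y, j) \<in> tower \<beta> 0 d"
          "tower_map \<beta> (x, i) = tower_map \<beta> (y, j)"
        have cases: "d < x \<and> i = 0 \<or> t1 < x \<and> x < d \<and> (i = 0 \<or> i = 1)"
          if "(x, i) \<in> tower \<beta> 0 d" for x i
          using that by (auto simp: tower_def J orb less_2_cases_iff)
        show "x = y \<and> i = j"
          using cases[OF xy(1)] cases[OF xy(2)] xy(3) T[of x] T[of y] t21 t1 beta
          by (auto simp: tower_map_def)
      qed
    qed
  qed (use beta d t1 t3 full_eq low_eq in \<open>simp_all add: J orb numeral_3_eq_3 power2_eq_square\<close>)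
  interpret first_return \<beta> 0 d using fr unfolding d_def .
  have G0: "G \<beta> 0 0 = {t2<..<t1}" by (simp add: G_def gap_exp_eq J orb numeral_2_eq_2)
  show "gap_decomposition \<beta> (Suc 0) (tower_image \<beta> 0 (1 / \<beta>))"
    unfolding gap_decomposition_def d_def[symmetric] gap_index_1
  proof (intro conjI)
    show "finite ({0<..<1} - tower_image \<beta> 0 d - (\<Union>(m, k)\<in>{(0, 0)}. G \<beta> m k))"
      by (rule finite_subset[of _ "{d, t1, t2}"]) (auto simp: image_eq G0)
    have "G \<beta> 0 0 \<inter> tower_image \<beta> 0 d = {}" unfolding image_eq G0 using t1 t2 t21 d by auto
    then show "\<forall>(m, k)\<in>{(0, 0)}. (\<exists>l u. l < u \<and> G \<beta> m k = {l<..<u}) \<and> G \<beta> m k \<subseteq> {0<..<1} \<and> G \<beta> m k \<inter> tower_image \<beta> 0 d = {}"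
      using t21 t1 t2 d G0 by auto
  qed (use open_W W_subset W_nonempty in \<open>auto simp: disjoint_family_on_def\<close>)
qed

lemma first_return_exists:
  assumes beta: "1 < \<beta>" and small: "\<beta> ^ (g (Suc m) + 1) < \<beta> + 1"
  shows "\<exists>c. first_return \<beta> m c \<and> gap_decomposition \<beta> (Suc m) (tower_image \<beta> m c)"
  using small
proof (induction m)
  case 0
  then have "\<beta>\<^sup>2 < \<beta> + 1" by (simp add: g_def power2_eq_square)
  then show ?case using first_return_base[OF beta] by blast
next
  case (Suc m)
  have "\<beta> ^ (g (Suc m) + 1) \<le> \<beta> ^ (g (Suc (Suc m)) + 1)"
    using beta g_mono[of "Suc m"] by (intro power_increasing) auto
  then obtain c where c: "first_return \<beta> m c"
    "gap_decomposition \<beta> (Suc m) (tower_image \<beta> m c)"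
    using Suc by fastforce
  interpret first_return \<beta> m c by fact
  have gap: "r * s\<^sup>2 < r + s" using Suc.prems gap_condition[OF beta, of m] by (simp add: r_def s_def)
  show ?case using next_first_return[OF gap] gap_decomposition_step[OF gap c(2)] by blast
qed

section \<open>Covering of the tower when no further gap opens\<close>

lemma (in covering) cov_UN:
  assumes "finite I" "\<And>i. i \<in> I \<Longrightarrow> cov (S i)"
  shows "cov (\<Union>i\<in>I. S i)"
  using assms by (induction rule: finite_induct) (auto intro: cov_Un cov_finite)

text \<open>The floors along the way are not known explicitly. Affine formulas for two consecutive
  iterates determine the map on the image interval as \<open>B - \<beta> * y\<close>, which is why
  \<open>cov_image\<close> admits an arbitrary intercept.\<close>

lemma (in neg_beta_covering) cov_iterate:
  assumes affine: "\<And>i x. i \<le> N \<Longrightarrow> u < x \<Longrightarrow> x < v \<Longrightarrow> (neg_beta \<beta> ^^ i) x = A i + (- \<beta>) ^ i * (x - z)"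
    and uv: "u < v" "cov {u<..<v}" and "j \<le> N"
  shows "cov ((neg_beta \<beta> ^^ j) ` {u<..<v})"
  using \<open>j \<le> N\<close>
proof (induction j)
  case 0
  then show ?case using uv by simp
next
  case (Suc j)
  have img: "(neg_beta \<beta> ^^ i) ` {u<..<v} = (\<lambda>x. A i + (- \<beta>) ^ i * (x - z)) ` {u<..<v}"
    if "i \<le> N" for i
    using affine that by (intro image_cong) auto
  have bj: "(- \<beta>) ^ j \<noteq> 0" using beta by simp
  define l w where "l = (if 0 < (- \<beta>) ^ j then A j + (- \<beta>) ^ j * (u - z) else A j + (- \<beta>) ^ j * (v - z))"
    and "w = (if 0 < (- \<beta>) ^ j then A j + (- \<beta>) ^ j * (v - z) else A j + (- \<beta>) ^ j * (u - z))"
  have lw: "(neg_beta \<beta> ^^ j) ` {u<..<v} = {l<..<w}"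
    using img[of j] Suc.prems affine_image_open[OF bj, of "A j" z u v] by (simp add: l_def w_def)
  define B where "B = A (Suc j) + \<beta> * A j"
  have T: "neg_beta \<beta> y = B - \<beta> * y" if y: "y \<in> {l<..<w}" for y
  proof -
    obtain x where x: "x \<in> {u<..<v}" "y = (neg_beta \<beta> ^^ j) x"
      using y unfolding lw[symmetric] by blast
    have "neg_beta \<beta> y = (neg_beta \<beta> ^^ Suc j) x" using x by simp
    also have "\<dots> = A (Suc j) + (- \<beta>) ^ Suc j * (x - z)" using x Suc.prems by (intro affine) auto
    also have "\<dots> = B - \<beta> * (A j + (- \<beta>) ^ j * (x - z))" by (simp add: B_def algebra_simps)
    also have "A j + (- \<beta>) ^ j * (x - z) = y" using affine[of j x] x Suc.prems by simp
    finally show ?thesis .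
  qed
  have "{l<..<w} \<noteq> {}" unfolding lw[symmetric] using uv by simp
  then have "l < w" by simp
  then have "cov {B - \<beta> * w<..<B - \<beta> * l}" using Suc lw T by (intro cov_image) auto
  moreover have "(neg_beta \<beta> ^^ Suc j) ` {u<..<v} = {B - \<beta> * w<..<B - \<beta> * l}"
  proof -
    have "(neg_beta \<beta> ^^ Suc j) ` {u<..<v} = neg_beta \<beta> ` {l<..<w}"
      unfolding lw[symmetric] by (simp add: image_image)
    also have "\<dots> = (\<lambda>x. B + (- \<beta>) * (x - 0)) ` {l<..<w}"
      using T by (intro image_cong) auto
    also have "\<dots> = {B - \<beta> * w<..<B - \<beta> * l}" using beta by (subst affine_image_open) auto
    finally show ?thesis .
  qed
  ultimately show ?case by simp
qed

lemma (in first_return) tower_covered: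
  assumes "neg_beta_covering cov \<beta>" and no_gap: "r + s \<le> r * s\<^sup>2"
    and uv: "cov {u<..<v}" "0 \<le> u" "u < v" "v \<le> 1"
  shows "cov W"
proof -
  interpret neg_beta_covering cov \<beta> by fact
  have up: "cov ((neg_beta \<beta> ^^ j) ` {u<..<v})"
    if "c \<le> u" "u < v" "v \<le> 1" "cov {u<..<v}" "j \<le> gap_count (Suc m)" for u v j
    using that
    by (intro cov_iterate[where A = "orb \<beta>" and z = 1 and N = "gap_count (Suc m)"] upper) auto
  have lo: "cov ((neg_beta \<beta> ^^ j) ` {u<..<v})"
    if "a \<le> u" "u < v" "v \<le> c" "cov {u<..<v}" "j \<le> 2 * gap_count m" for u v j
    using that unfolding a_def
    by (intro cov_iterate[where A = "\<lambda>j. orb \<beta> (gap_count (Suc m) + j)" and N =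
    "2 * gap_count m"
          and z = "orb \<beta> (gap_count (Suc m))"] lower) auto
  obtain w where w: "w < 1" "0 \<le> w" "cov {w<..<1}" using cov_near_one[OF uv] by blast
  have full_base: "cov {a<..<1}"
  proof (rule two_branch_covering[OF a_lt_c c_lt s_gt r_gt full q_eq a_le_q no_gap])
    fix u v assume uv: "c \<le> u" "u < v" "v \<le> 1" "cov {u<..<v}"
    have "(neg_beta \<beta> ^^ gap_count (Suc m)) ` {u<..<v} = (\<lambda>x. a + (- s) * (x - 1)) ` {u<..<v}"
      using uv return_upper by (intro image_cong) (auto simp: algebra_simps)
    also have "\<dots> = {a + s * (1 - v)<..<a + s * (1 - u)}"
      using s_gt by (subst affine_image_open) (auto simp: algebra_simps)
    finally show "cov {a + s * (1 - v)<..<a + s * (1 - u)}" using up[OF uv, of "gap_count (Suc m)"] by simp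
  next
    fix u v assume uv: "a \<le> u" "u < v" "v \<le> c" "cov {u<..<v}"
    have "(neg_beta \<beta> ^^ (2 * gap_count m)) ` {u<..<v} = (\<lambda>x. q + r * (x - a)) ` {u<..<v}"
      using uv return_lower by (intro image_cong) auto
    also have "\<dots> = {1 - r * (c - u)<..<1 - r * (c - v)}"
      using r_gt by (subst affine_image_open) (auto simp: q_eq algebra_simps)
    finally show "cov {1 - r * (c - u)<..<1 - r * (c - v)}" using lo[OF uv, of "2 * gap_count m"] by simp
  next
    show "cov {max w a<..<1}" by (rule cov_mono[OF w(3)]) auto
  qed (use w a_lt_c c_lt in auto)
  have c1: "cov {c<..<1}" and ac: "cov {a<..<c}"
    by (rule cov_mono[OF full_base], use a_lt_c c_lt in auto)+
  show ?thesis unfolding W_eq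
    using up[OF _ _ _ c1] lo[OF _ _ _ ac] a_lt_c c_lt by (intro cov_Un cov_UN) auto
qed

text \<open>All that the measure-theoretic part uses. Quantifying over \<open>cov\<close> lets one
  \<open>W\<close> serve every invariant set; \<open>c\<close> accounts for the points of
  \<open>W\<close> that hit the break point.\<close>

theorem neg_beta_dynamics:
  assumes beta: "1 < \<beta>" and ge: "gamma (n + 1) \<le> ereal \<beta>" and less: "ereal \<beta> < gamma n"
  obtains W c where "gap_decomposition \<beta> n W" "neg_beta \<beta> ` W \<subseteq> insert c W"
    "\<And>cov u v. neg_beta_covering cov \<beta> \<Longrightarrow> cov {u<..<v} \<Longrightarrow> 0 \<le> u \<Longrightarrow> u < v \<Longrightarrow> v \<le> 1 \<Longrightarrow> cov W"
proof (cases n)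
  case 0
  have "\<beta> + 1 \<le> \<beta> ^ (g 1 + 1)" using gamma_less_iff[of 1 \<beta>] beta ge 0 by auto
  then have large: "\<beta> + 1 \<le> \<beta>\<^sup>2" by (simp add: g_def power2_eq_square)
  show ?thesis
  proof (rule that[of "{0<..<1}" 1])
    show "gap_decomposition \<beta> n {0<..<1}" using gap_decomposition_0 0 by simp
    show "neg_beta \<beta> ` {0<..<1} \<subseteq> insert 1 {0<..<1}"
      using neg_beta_range[of \<beta>] by (auto simp: less_le)
    show "cov {0<..<1}"
      if "neg_beta_covering cov \<beta>" "cov {u<..<v}" "0 \<le> u" "u < v" "v \<le> 1" for cov u v
      using neg_beta_covering.cov_all_large_beta[OF that(1) large] that by blast
  qed
next
  case (Suc m)
  have "\<beta> ^ (g (Suc m) + 1) < \<beta> + 1" using gamma_less_iff[of n \<beta>] beta less Suc by simp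
  then obtain c where c: "first_return \<beta> m c"
    "gap_decomposition \<beta> (Suc m) (tower_image \<beta> m c)"
    using first_return_exists[OF beta] by blast
  interpret first_return \<beta> m c by fact
  have "\<not> \<beta> ^ (g (Suc (Suc m)) + 1) < \<beta> + 1"
    using gamma_less_iff[of "n + 1" \<beta>] beta ge Suc by auto
  then have no_gap: "r + s \<le> r * s\<^sup>2" using gap_condition[OF beta, of m] by (simp add: r_def s_def)
  show ?thesis
    using that[of W c] c(2) W_forward tower_covered[OF _ no_gap] Suc by blast
qed

section \<open>Forward invariant sets of positive measure\<close>

lemma neg_beta_measurable [measurable]: "neg_beta \<beta> \<in> borel_measurable borel"
  unfolding neg_beta_def by measurable

lemma negligible_affine_image: "negligible S \<Longrightarrow> negligible ((\<lambda>x::real. b + c * x) ` S)"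
  by (rule negligible_differentiable_image_negligible)
    (auto simp: differentiable_on_def intro!: derivative_intros)

lemma measure_affine_image: "measure lebesgue ((\<lambda>x::real. b + c * x) ` S) = \<bar>c\<bar> * measure lebesgue S"
  using measure_lebesgue_affine[of c b S] by (simp add: add.commute)

lemma neg_beta_nonsingular:
  assumes "1 < \<beta>" "negligible S"
  shows "negligible {x \<in> {0..1}. neg_beta \<beta> x \<in> S}"
proof (rule negligible_subset)
  show "negligible (\<Union>k\<in>{0..\<lfloor>\<beta>\<rfloor>}. (\<lambda>y. (of_int k + 1) / \<beta> + (- 1 / \<beta>) * y) ` S)"
    by (intro negligible_Union finite_imageI)
      (simp, elim imageE, hypsubst, rule negligible_affine_image[OF assms(2)])
  show "{x \<in> {0..1}. neg_beta \<beta> x \<in> S} \<subseteq> (\<Union>k\<in>{0..\<lfloor>\<beta>\<rfloor>}. (\<lambda>y. (of_int k + 1) / \<beta> + (- 1 / \<beta>) * y) ` S)"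
  proof clarsimp
    fix x assume x: "neg_beta \<beta> x \<in> S" "0 \<le> x" "x \<le> 1"
    have "\<beta> * x \<le> \<beta> * 1" using x assms by (intro mult_left_mono) auto
    then have "0 \<le> \<lfloor>\<beta> * x\<rfloor>"
      "\<lfloor>\<beta> * x\<rfloor> \<le> \<lfloor>\<beta>\<rfloor>"
        using x assms by (auto intro: floor_mono)
    moreover have "x = (of_int \<lfloor>\<beta> * x\<rfloor> + 1) / \<beta> - neg_beta \<beta> x / \<beta>"
      using assms by (simp add: neg_beta_def field_simps)
    ultimately show "\<exists>k\<in>{0..\<lfloor>\<beta>\<rfloor>}. x \<in> (\<lambda>y. (of_int k + 1) / \<beta> - y / \<beta>) ` S"
      using x
      by (intro bexI[of _ "\<lfloor>\<beta> * x\<rfloor>"] image_eqI[of _ _ "neg_beta \<beta> x"]) auto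
  qed
qed

lemma invariant_iterate:
  assumes beta: "1 < \<beta>" and A: "A \<subseteq> {0<..1}"
    "negligible {x \<in> A. neg_beta \<beta> x \<notin> A}"
  shows "negligible {x \<in> A. (neg_beta \<beta> ^^ m) x \<notin> A}"
proof (induction m)
  case 0
  show ?case by simp
next
  case (Suc m)
  have "negligible ({x \<in> A. neg_beta \<beta> x \<notin> A} \<union> {x \<in> {0..1}. neg_beta \<beta> x \<in> {x \<in> A. (neg_beta \<beta> ^^ m) x \<notin> A}})"
    using A(2) neg_beta_nonsingular[OF beta Suc] by (rule negligible_Un)
  then show ?case
    by (rule negligible_subset) (use A(1) in \<open>auto simp: funpow_Suc_right simp del: funpow.simps\<close>)
qed

lemma iterate_piecewise_affine:
  assumes beta: "1 < \<beta>"
  shows "\<exists>D. finite D \<and> (\<forall>u v. 0 \<le> u \<and> u < v \<and> v \<le> 1 \<and> {u<..<v} \<inter> D = {} \<longrightarrow>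
    (\<exists>b. \<forall>x\<in>{u<..<v}. (neg_beta \<beta> ^^ m) x = b + (- \<beta>) ^ m * x))"
proof (induction m)
  case 0
  show ?case by (intro exI[of _ "{}"]) (auto intro: exI[of _ 0])
next
  case (Suc m)
  then obtain D where D: "finite D"
    "\<And>u v. 0 \<le> u \<Longrightarrow> u < v \<Longrightarrow> v \<le> 1 \<Longrightarrow> {u<..<v} \<inter> D = {} \<Longrightarrow>
    (\<exists>b. \<forall>x\<in>{u<..<v}. (neg_beta \<beta> ^^ m) x = b + (- \<beta>) ^ m * x)" by meson
  \<comment> \<open>The break points of one application together with the preimages of the old ones
    under all inverse branches. The index runs one beyond the floor of \<beta> so that the right end
    of the last branch is included.\<close>
  define E where "E = (\<Union>k\<in>{0..\<lfloor>\<beta>\<rfloor> + 1}. insert (of_int k / \<beta>) ((\<lambda>y. (of_int k + 1 - y) / \<beta>) ` D))"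
  show ?case
  proof (intro exI[of _ E] conjI allI impI)
    show "finite E" using D(1) by (simp add: E_def)
    fix u v :: real assume *: "0 \<le> u \<and> u < v \<and> v \<le> 1 \<and> {u<..<v} \<inter> E = {}"
    define k where "k = \<lfloor>\<beta> * u\<rfloor>"
    have "\<beta> * u \<le> \<beta> * 1" using * beta by (intro mult_left_mono) auto
    then have k: "0 \<le> k" "k \<le> \<lfloor>\<beta>\<rfloor>"
      unfolding k_def using * beta by (auto intro: floor_mono)
    have ku: "of_int k \<le> \<beta> * u" "\<beta> * u < of_int k + 1" unfolding k_def by linarith+
    have kE: "of_int (k + 1) / \<beta> \<in> E" unfolding E_def using k by (intro UN_I[of "k + 1"]) auto
    have kv: "\<beta> * v \<le> of_int k + 1"
    proof (rule ccontr)
      assume "\<not> \<beta> * v \<le> of_int k + 1"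
      then have "of_int (k + 1) / \<beta> \<in> {u<..<v}" using ku beta by (simp add: field_simps)
      then show False using kE * by blast
    qed
    have T: "neg_beta \<beta> x = of_int k + 1 - \<beta> * x" if "x \<in> {u<..<v}" for x
    proof (rule neg_beta_floor)
      have "\<beta> * u < \<beta> * x" "\<beta> * x < \<beta> * v" using that beta by auto
      then show "of_int k \<le> \<beta> * x" "\<beta> * x < of_int k + 1" using ku kv by auto
    qed
    have "{of_int k + 1 - \<beta> * v<..<of_int k + 1 - \<beta> * u} \<inter> D = {}"
    proof (rule ccontr)
      assume "{of_int k + 1 - \<beta> * v<..<of_int k + 1 - \<beta> * u} \<inter> D \<noteq> {}"
      then obtain y where y: "y \<in> D" "of_int k + 1 - \<beta> * v < y" "y < of_int k + 1 - \<beta> * u"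
        by auto
      have "(of_int k + 1 - y) / \<beta> \<in> E" unfolding E_def using k y by (intro UN_I[of k]) auto
      moreover have "(of_int k + 1 - y) / \<beta> \<in> {u<..<v}" using y beta by (simp add: field_simps)
      ultimately show False using * by blast
    qed
    then obtain b where b: "\<And>y. y \<in> {of_int k + 1 - \<beta> * v<..<of_int k + 1 - \<beta> * u} \<Longrightarrow>
        (neg_beta \<beta> ^^ m) y = b + (- \<beta>) ^ m * y"
      using D(2)[of "of_int k + 1 - \<beta> * v" "of_int k + 1 - \<beta> * u"] ku kv * beta by auto
    have "(neg_beta \<beta> ^^ Suc m) x = (b + (- \<beta>) ^ m * (of_int k + 1)) + (- \<beta>) ^ Suc m * x"
      if x: "x \<in> {u<..<v}" for x
    proof -
      have "of_int k + 1 - \<beta> * x \<in> {of_int k + 1 - \<beta> * v<..<of_int k + 1 - \<beta> * u}"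
        using x beta by auto
      then show ?thesis
        unfolding funpow_Suc_right comp_apply T[OF x] by (subst b) (simp_all add: algebra_simps)
    qed
    then show "\<exists>b. \<forall>x\<in>{u<..<v}. (neg_beta \<beta> ^^ Suc m) x = b + (- \<beta>) ^ Suc m * x" by blast
  qed
qed

section \<open>Sets that fill no interval\<close>

lemma finite_separation:
  assumes "finite (D :: real set)"
  obtains \<delta> where "0 < \<delta>"
    "\<And>p q. p \<in> D \<Longrightarrow> q \<in> D \<Longrightarrow> p \<noteq> q \<Longrightarrow> \<delta> \<le> \<bar>p - q\<bar>"
proof -
  \<comment> \<open>The 1 keeps the set non-empty when \<open>D\<close> has fewer than two
    points.\<close>
  define S where "S = insert 1 ((\<lambda>(p, q). \<bar>p - q\<bar>) ` {(p, q) \<in> D \<times> D. p \<noteq> q})"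
  have fin: "finite S" unfolding S_def using assms by (auto intro: finite_subset[of _ "D \<times> D"])
  have "0 < Min S" using fin by (subst Min_gr_iff) (auto simp: S_def)
  moreover have "Min S \<le> \<bar>p - q\<bar>" if "p \<in> D" "q \<in> D" "p \<noteq> q" for p q
    using that fin by (intro Min_le) (auto simp: S_def)
  ultimately show ?thesis using that by blast
qed



lemma interval_minus_lmeasurable: "A \<in> sets borel \<Longrightarrow> {u<..<v} - A \<in> lmeasurable"
  for u v :: real
  by (rule fmeasurableI2[of "{u<..<v}"]) (simp, blast, simp)

text \<open>In place of density points: cover \<open>A\<close> by non-overlapping intervals of total
  length at most \<open>measure lebesgue A + e\<close>. In each of them \<open>A\<close> occupies at
  most the proportion \<open>1 - \<eta>\<close>, so its measure is at most \<open>1 - \<eta>\<close>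
  times itself.\<close>

lemma negligible_of_uniform_loss:
  fixes A :: "real set"
  assumes A: "A \<in> sets borel" "A \<subseteq> {0..1}" and "0 < \<eta>"
    and loss: "\<And>u v. 0 \<le> u \<Longrightarrow> u < v \<Longrightarrow> v \<le> 1 \<Longrightarrow> \<eta> * (v - u) \<le> measure lebesgue ({u<..<v} - A)"
  shows "negligible A"
proof -
  have Alm: "A \<in> lmeasurable"
    by (rule fmeasurableI2[of "{0..1}"]) (use A in \<open>simp_all add: sets_completionI_sets\<close>)
  have "\<eta> \<le> 1"
  proof -
    have "\<eta> * (1 - 0) \<le> measure lebesgue ({0<..<1} - A)" by (rule loss) auto
    also have "\<dots> \<le> measure lebesgue {0<..<1::real}"
      by (rule measure_mono_fmeasurable) (use A(1) in \<open>simp_all add: sets_completionI_sets\<close>)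
    finally show ?thesis by simp
  qed
  have interval: "emeasure lebesgue ({u<..<v} \<inter> A) \<le> ennreal (1 - \<eta>) * emeasure lebesgue {u<..<v}" if "0 \<le> u" "v \<le> 1" for u v
  proof (cases "u < v")
    case True
    have IA: "{u<..<v} \<inter> A \<in> lmeasurable" using Alm by (simp add: fmeasurable_Int_fmeasurable)
    have "measure lebesgue (({u<..<v} \<inter> A) \<union> ({u<..<v} - A)) = measure lebesgue ({u<..<v} \<inter> A) + measure lebesgue ({u<..<v} - A)"
    proof -
      have "({u<..<v} \<inter> A) \<inter> ({u<..<v} - A) = {}" by blast
      then show ?thesis using measure_Un3[OF IA interval_minus_lmeasurable[OF A(1)]] by simp
    qed
    then have "measure lebesgue {u<..<v} = measure lebesgue ({u<..<v} \<inter> A) + measure lebesgue ({u<..<v} - A)"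
      by (simp add: Int_Diff_Un)
    then have "measure lebesgue ({u<..<v} \<inter> A) \<le> (1 - \<eta>) * measure lebesgue {u<..<v}"
      using loss[OF that(1) True that(2)] True by (simp add: algebra_simps)
    then show ?thesis using \<open>\<eta> \<le> 1\<close> IA
      by (simp add: emeasure_eq_measure2 ennreal_mult[symmetric] ennreal_leI)
  qed auto
  have "measure lebesgue A \<le> (1 - \<eta>) * (measure lebesgue A + e)" if e: "0 < e" for e
  proof -
    obtain \<D> where D: "countable \<D>"
      "\<And>K. K \<in> \<D> \<Longrightarrow> K \<subseteq> cbox 0 1 \<and> K \<noteq> {} \<and> (\<exists>c d. K = cbox c (d::real))"
        "pairwise (\<lambda>A B. interior A \<inter> interior B = {}) \<D>"
        "A \<subseteq> \<Union>\<D>" "\<Union>\<D> \<in> lmeasurable"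
          "measure lebesgue (\<Union>\<D>) \<le> measure lebesgue A + e"
      using measurable_outer_intervals_bounded[OF Alm _ e, of 0 1] A(2) unfolding cbox_interval by metis
    \<comment> \<open>The covering intervals are closed and may share endpoints; as there are
      countably many, dropping the endpoints costs a null set.\<close>
    have K: "\<exists>u v. 0 \<le> u \<and> v \<le> 1 \<and> interior K = {u<..<v} \<and> negligible (K - interior K)" if K: "K \<in> \<D>" for K
    proof -
      obtain c d where cd: "K = {c..d}" "{c..d} \<subseteq> {0..1}" "{c..d} \<noteq> {}"
        using D(2)[OF K] by (auto simp: cbox_interval)
      have "{c..d} - {c<..<d} \<subseteq> {c, d}" by auto
      then have "negligible ({c..d} - {c<..<d})"
        using negligible_subset[OF negligible_finite[of "{c, d}"]] by simp
      then show ?thesis using cd by (intro exI[of _ c] exI[of _ d]) auto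
    qed
    define E where "E = (\<Union>K\<in>\<D>. interior K)"
    have "negligible (\<Union>((\<lambda>K. K - interior K) ` \<D>))"
      using K D(1) by (intro negligible_countable_Union) auto
    then have null: "\<Union>((\<lambda>K. K - interior K) ` \<D>) \<in> null_sets lebesgue"
      by (simp add: negligible_iff_null_sets)
    have "open E" unfolding E_def by auto
    then have EA: "E \<inter> A \<in> sets lebesgue" using A(1) by (intro sets_completionI_sets) simp
    have "A \<subseteq> (E \<inter> A) \<union> \<Union>((\<lambda>K. K - interior K) ` \<D>)"
      using D(4) by (auto simp: E_def)
    then have "emeasure lebesgue A \<le> emeasure lebesgue ((E \<inter> A) \<union> \<Union>((\<lambda>K. K - interior K) ` \<D>))"
      using EA null by (intro emeasure_mono) auto
    also have "\<dots> = emeasure lebesgue (E \<inter> A)" by (rule emeasure_Un_null_set[OF EA null])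
    also have "E \<inter> A = (\<Union>K\<in>\<D>. interior K \<inter> A)" by (auto simp: E_def)
    also have "emeasure lebesgue \<dots> = (\<integral>\<^sup>+K. emeasure lebesgue (interior K \<inter> A) \<partial>count_space \<D>)"
    proof (rule emeasure_UN_countable)
      show "interior K \<inter> A \<in> sets lebesgue" for K using A(1) by (intro sets_completionI_sets) simp
      show "disjoint_family_on (\<lambda>K. interior K \<inter> A) \<D>"
        using D(3) by (auto simp: disjoint_family_on_def pairwise_def)
    qed (fact D(1))
    also have "\<dots> \<le> (\<integral>\<^sup>+K. ennreal (1 - \<eta>) * emeasure lebesgue (interior K) \<partial>count_space \<D>)"
    proof (rule nn_integral_mono)
      fix K assume "K \<in> space (count_space \<D>)"
      then obtain u v where "0 \<le> u" "v \<le> 1" "interior K = {u<..<v}" using K[of K] by auto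
      then show "emeasure lebesgue (interior K \<inter> A) \<le> ennreal (1 - \<eta>) * emeasure lebesgue (interior K)"
        using interval by simp
    qed
    also have "\<dots> = ennreal (1 - \<eta>) * (\<integral>\<^sup>+K. emeasure lebesgue (interior K) \<partial>count_space \<D>)"
      by (rule nn_integral_cmult) auto
    also have "(\<integral>\<^sup>+K. emeasure lebesgue (interior K) \<partial>count_space \<D>) = emeasure lebesgue E"
      unfolding E_def
    proof (rule emeasure_UN_countable[symmetric])
      show "interior K \<in> sets lebesgue" for K :: "real set" by (intro sets_completionI_sets) simp
      show "disjoint_family_on interior \<D>" using D(3) by (auto simp: disjoint_family_on_def pairwise_def)
    qed (fact D(1))
    also have "emeasure lebesgue E \<le> emeasure lebesgue (\<Union>\<D>)"
      unfolding E_def using D(5) interior_subset by (intro emeasure_mono) (blast, simp)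
    also have "emeasure lebesgue (\<Union>\<D>) \<le> ennreal (measure lebesgue A + e)"
      using D(5,6) by (simp add: emeasure_eq_measure2 ennreal_leI)
    finally have "ennreal (measure lebesgue A) \<le> ennreal (1 - \<eta>) * ennreal (measure lebesgue A + e)"
      using Alm by (simp add: emeasure_eq_measure2 mult_left_mono)
    also have "\<dots> = ennreal ((1 - \<eta>) * (measure lebesgue A + e))"
      using \<open>\<eta> \<le> 1\<close> e by (simp add: ennreal_mult)
    finally show ?thesis using \<open>\<eta> \<le> 1\<close> e by (subst (asm) ennreal_le_iff) auto
  qed
  then have "measure lebesgue A \<le> (1 - \<eta>) * measure lebesgue A + e" if "0 < e" for e
  proof -
    have "(1 - \<eta>) * (measure lebesgue A + e) \<le> (1 - \<eta>) * measure lebesgue A + e"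
      using \<open>0 < \<eta>\<close> that by (simp add: algebra_simps)
    then show ?thesis
      using \<open>\<And>e. 0 < e \<Longrightarrow> measure lebesgue A \<le> (1 - \<eta>) * (measure lebesgue A + e)\<close>[OF that] by linarith
  qed
  then have "measure lebesgue A \<le> (1 - \<eta>) * measure lebesgue A" by (rule field_le_epsilon)
  then have "\<eta> * measure lebesgue A \<le> 0" by (simp add: algebra_simps)
  then have "measure lebesgue A = 0"
    using \<open>0 < \<eta>\<close> by (simp add: mult_le_0_iff measure_le_0_iff)
  then show ?thesis using Alm negligible_iff_measure0 by blast
qed


text \<open>Every interval of length at least \<delta> contains a cell of a fixed grid with mesh
  below \<open>\<delta> / 2\<close>, and among finitely many cells there is a smallest loss.\<close>

lemma uniform_loss_of_long_intervals:
  fixes A :: "real set"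
  assumes A: "A \<in> sets borel" and "0 < \<delta>"
    and pos: "\<And>u v. 0 \<le> u \<Longrightarrow> u < v \<Longrightarrow> v \<le> 1 \<Longrightarrow> \<not> negligible ({u<..<v} - A)"
  obtains \<eta> where "0 < \<eta>"
    "\<And>u v. 0 \<le> u \<Longrightarrow> v \<le> 1 \<Longrightarrow> \<delta> \<le> v - u \<Longrightarrow> \<eta> * (v - u) \<le> measure lebesgue ({u<..<v} - A)"
proof -
  obtain N :: nat where N: "2 / \<delta> < real N" using reals_Archimedean2 by blast
  have "0 < 2 / \<delta>" using \<open>0 < \<delta>\<close> by simp
  then have N0: "0 < real N" using N by linarith
  have N2: "2 / real N \<le> \<delta>" using N N0 \<open>0 < \<delta>\<close> by (simp add: field_simps)
  define cell where "cell = (\<lambda>i. {real i / N<..<(real i + 1) / N})"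
  define \<eta> where "\<eta> = Min ((\<lambda>i. measure lebesgue (cell i - A)) ` {..<N})"
  have cell_pos: "0 < measure lebesgue (cell i - A)" if "i < N" for i
  proof -
    have "real i + 1 \<le> real N" using that by linarith
    then have "\<not> negligible (cell i - A)"
      unfolding cell_def using N0 by (intro pos) (auto simp: divide_strict_right_mono)
    then have "measure lebesgue (cell i - A) \<noteq> 0"
      using interval_minus_lmeasurable[OF A] negligible_iff_measure0 by (auto simp: cell_def)
    then show ?thesis using measure_nonneg[of lebesgue "cell i - A"] by linarith
  qed
  have "0 < \<eta>" unfolding \<eta>_def using N0 cell_pos by (subst Min_gr_iff) auto
  moreover have "\<eta> * (v - u) \<le> measure lebesgue ({u<..<v} - A)"
    if uv: "0 \<le> u" "v \<le> 1" "\<delta> \<le> v - u" for u v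
  proof -
    define i where "i = nat \<lceil>u * N\<rceil>"
    have i: "u * N \<le> real i" "real i < u * N + 1"
      unfolding i_def using uv N0 by (auto simp: of_nat_nat) linarith+
    have "2 \<le> (v - u) * N" using order_trans[OF N2 uv(3)] N0 by (simp add: pos_divide_le_eq)
    then have iv: "real i + 1 \<le> v * N" using i by (simp add: algebra_simps)
    have "v * real N \<le> 1 * real N" using uv N0 by (intro mult_right_mono) auto
    then have "i < N" using iv by linarith
    then have "\<eta> \<le> measure lebesgue (cell i - A)" unfolding \<eta>_def by (intro Min_le) auto
    also have "cell i \<subseteq> {u<..<v}"
    proof -
      have "u \<le> real i / N" "(real i + 1) / N \<le> v" using i iv N0 by (simp_all add: field_simps)
      then show ?thesis by (auto simp: cell_def)
    qed
    then have "measure lebesgue (cell i - A) \<le> measure lebesgue ({u<..<v} - A)"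
      using interval_minus_lmeasurable[OF A] by (intro measure_mono_fmeasurable) (auto simp: cell_def)
    finally have "\<eta> \<le> measure lebesgue ({u<..<v} - A)" .
    moreover have "\<eta> * (v - u) \<le> \<eta> * 1"
      using uv \<open>0 < \<eta>\<close> by (intro mult_left_mono) auto
    ultimately show ?thesis by simp
  qed
  ultimately show ?thesis using that by blast
qed


text \<open>If \<open>A\<close> contained no interval up to null sets, then every interval longer than \<open>\<delta>\<close> would lose
  a fixed proportion \<open>\<eta>\<close> of its length outside \<open>A\<close>. Pulling back along an iterate of slope more than
  two, which cuts a short interval at most once, shows the same for all intervals up to an error
  that tends to zero.\<close>

theorem invariant_contains_interval:
  assumes beta: "1 < \<beta>" and A: "A \<in> sets borel" "A \<subseteq> {0<..1}"
    "negligible {x \<in> A. neg_beta \<beta> x \<notin> A}"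
    and "\<not> negligible A"
  shows "\<exists>u v. 0 \<le> u \<and> u < v \<and> v \<le> 1 \<and> negligible ({u<..<v} - A)"
proof (rule ccontr)
  assume contr: "\<not> ?thesis"
  obtain m where m: "2 < \<beta> ^ m" using real_arch_pow[OF beta] by blast
  define N where "N = {x \<in> A. (neg_beta \<beta> ^^ m) x \<notin> A}"
  have N: "negligible N" unfolding N_def using invariant_iterate[OF beta A(2,3)] .
  obtain D where D: "finite D"
    "\<And>u v. 0 \<le> u \<Longrightarrow> u < v \<Longrightarrow> v \<le> 1 \<Longrightarrow> {u<..<v} \<inter> D = {} \<Longrightarrow>
      (\<exists>b. \<forall>x\<in>{u<..<v}. (neg_beta \<beta> ^^ m) x = b + (- \<beta>) ^ m * x)"
    using iterate_piecewise_affine[OF beta, of m] by meson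
  obtain \<delta> where d: "0 < \<delta>"
    "\<And>p q. p \<in> D \<Longrightarrow> q \<in> D \<Longrightarrow> p \<noteq> q \<Longrightarrow> \<delta> \<le> \<bar>p - q\<bar>"
    using finite_separation[OF D(1)] by blast
  have pos: "\<not> negligible ({u<..<v} - A)"
    if "0 \<le> u" "u < v" "v \<le> 1" for u v using contr that by blast
  obtain \<eta> where eta: "0 < \<eta>"
    "\<And>u v. 0 \<le> u \<Longrightarrow> v \<le> 1 \<Longrightarrow> \<delta> \<le> v - u \<Longrightarrow> \<eta> * (v - u) \<le> measure lebesgue ({u<..<v} - A)"
    by (rule uniform_loss_of_long_intervals[OF A(1) d(1) pos]) blast+
  \<comment> \<open>Pulling back divides the error by \<open>\<beta> ^ m\<close>, and a cut doubles
    it because two pieces contribute.\<close>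
  define \<theta> where "\<theta> = 2 / \<beta> ^ m"
  have theta: "0 < \<theta>" "\<theta> < 1" using m by (auto simp: \<theta>_def)
  have bm: "\<beta> ^ m * \<theta> = 2" using beta by (simp add: \<theta>_def)
  have claim: "\<eta> * (v - u) - \<eta> * \<delta> * \<theta> ^ k \<le> measure lebesgue ({u<..<v} - A)"
    if "0 \<le> u" "u \<le> v" "v \<le> 1" for k u v
    using that
  proof (induction k arbitrary: u v)
    case 0
    show ?case
    proof (cases "\<delta> \<le> v - u")
      case True
      then show ?thesis using eta(2)[of u v] 0 mult_pos_pos[OF eta(1) d(1)] by simp
    next
      case False
      then have "\<eta> * (v - u) \<le> \<eta> * \<delta>" using eta(1) by (intro mult_left_mono) auto
      then show ?thesis
        unfolding power_0 mult_1_right using measure_nonneg[of lebesgue "{u<..<v} - A"] by linarith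
    qed
  next
    case (Suc k)
    \<comment> \<open>Only half of the permitted error, so that two uncut pieces together stay
      within it.\<close>
    have uncut: "\<eta> * (v - u) - \<eta> * \<delta> * \<theta> ^ Suc k / 2 \<le> measure lebesgue ({u<..<v} - A)"
      if uv: "0 \<le> u" "u \<le> v" "v \<le> 1" "{u<..<v} \<inter> D = {}" for u v
    proof (cases "u = v")
      case True
      then show ?thesis using eta d theta by simp
    next
      case False
      then have "u < v" using uv by simp
      then obtain b where b: "\<And>x. x \<in> {u<..<v} \<Longrightarrow> (neg_beta \<beta> ^^ m) x = b + (- \<beta>) ^ m * x"
        using D(2)[OF uv(1) \<open>u < v\<close> uv(3,4)] by blast
      define f where "f = (\<lambda>x. b + (- \<beta>) ^ m * x)"
      have bp: "0 < \<beta> ^ m" using beta by simp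
      have im: "f ` {u<..<v} = (\<lambda>x. b + (- \<beta>) ^ m * (x - 0)) ` {u<..<v}" by (simp add: f_def)
      obtain l w where lw: "f ` {u<..<v} = {l<..<w}" "w - l = \<beta> ^ m * (v - u)"
      proof (cases "even m")
        case True
        then have "f ` {u<..<v} = {b + \<beta> ^ m * u<..<b + \<beta> ^ m * v}"
          unfolding im using bp beta by (subst affine_image_open) auto
        then show ?thesis by (rule that) (simp add: algebra_simps)
      next
        case False
        then have "f ` {u<..<v} = {b - \<beta> ^ m * v<..<b - \<beta> ^ m * u}"
          unfolding im using bp beta by (subst affine_image_open) auto
        then show ?thesis by (rule that) (simp add: algebra_simps)
      qed
      have "f ` {u<..<v} \<subseteq> {0<..1}"
      proof clarify
        fix x assume x: "x \<in> {u<..<v}"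
        then have "0 < (neg_beta \<beta> ^^ m) x" "(neg_beta \<beta> ^^ m) x \<le> 1"
          using uv iterate_pos iterate_le_1 by auto
        then show "f x \<in> {0<..1}" using b[OF x] by (simp add: f_def)
      qed
      moreover have "l < w" using lw(2) mult_pos_pos[OF bp, of "v - u"] \<open>u < v\<close> by simp
      ultimately have lw01: "0 \<le> l" "l \<le> w" "w \<le> 1"
        unfolding lw by (auto simp: greaterThanLessThan_subseteq_greaterThanAtMost_iff)
      \<comment> \<open>The preimage of what the image interval loses. By invariance its points lie
        outside \<open>A\<close> up to the null set \<open>N\<close>, so the loss is inherited by
        \<open>(u, v)\<close>.\<close>
      define S where "S = {x \<in> {u<..<v}. f x \<notin> A}"
      have "{l<..<w} - A = f ` S" unfolding lw(1)[symmetric] S_def by blast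
      then have "measure lebesgue ({l<..<w} - A) = \<beta> ^ m * measure lebesgue S"
        using beta unfolding f_def by (simp add: measure_affine_image power_abs)
      also have "measure lebesgue S \<le> measure lebesgue ({u<..<v} - A)"
      proof -
        have "S \<subseteq> ({u<..<v} - A) \<union> N" using b by (auto simp: S_def N_def f_def)
        moreover have "S \<in> sets lebesgue"
        proof (rule sets_completionI_sets)
          have "f \<in> borel_measurable borel" unfolding f_def by measurable
          then have "f -` A \<in> sets borel" using A(1) by (rule measurable_sets_borel)
          moreover have "S = {u<..<v} - f -` A" by (auto simp: S_def)
          ultimately show "S \<in> sets lborel" by simp
        qed
        ultimately have "measure lebesgue S \<le> measure lebesgue (({u<..<v} - A) \<union> N)"
          using N interval_minus_lmeasurable[OF A(1)] negligible_iff_measure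
          by (intro measure_mono_fmeasurable fmeasurable.Un) blast+
        also have "\<dots> \<le> measure lebesgue ({u<..<v} - A) + measure lebesgue N"
          using N interval_minus_lmeasurable[OF A(1)] negligible_iff_measure
          by (intro measure_Un_le) blast+
        finally show ?thesis using negligible_imp_measure0[OF N] by simp
      qed
      then have "\<beta> ^ m * measure lebesgue S \<le> \<beta> ^ m * measure lebesgue ({u<..<v} - A)"
        using beta by (intro mult_left_mono) auto
      finally have "\<eta> * (w - l) - \<eta> * \<delta> * \<theta> ^ k \<le> \<beta> ^ m * measure lebesgue ({u<..<v} - A)"
        using Suc.IH[OF lw01] by linarith
      moreover have "\<eta> * (w - l) - \<eta> * \<delta> * \<theta> ^ k = \<beta> ^ m * (\<eta> * (v - u) - \<eta> * \<delta> * \<theta> ^ Suc k / 2)"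
      proof -
        have "\<beta> ^ m * (\<eta> * (v - u) - \<eta> * \<delta> * \<theta> ^ Suc k / 2) = \<eta> * (\<beta> ^ m * (v - u)) - \<eta> * \<delta> * \<theta> ^ k * (\<beta> ^ m * \<theta>) / 2"
          by (simp add: algebra_simps)
        then show ?thesis unfolding bm lw(2) by simp
      qed
      ultimately show ?thesis using beta by simp
    qed
    have nn: "0 \<le> \<eta> * \<delta> * \<theta> ^ Suc k" using eta d theta by simp
    show ?case
    proof (cases "{u<..<v} \<inter> D = {}")
      case True
      then show ?thesis using uncut[OF Suc.prems True] nn by linarith
    next
      case False
      then obtain p where p: "p \<in> D" "u < p" "p < v" by auto
      show ?thesis
      proof (cases "\<delta> \<le> v - u")
        case True
        then show ?thesis using eta(2)[of u v] Suc.prems nn by linarith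
      next
        case False
        have "q \<notin> {u<..<p}" "q \<notin> {p<..<v}" if "q \<in> D" for q
          using d(2)[of q p] that p False by (cases "q = p"; force)+
        then have "{u<..<p} \<inter> D = {}" "{p<..<v} \<inter> D = {}" by blast+
        then have "\<eta> * (p - u) - \<eta> * \<delta> * \<theta> ^ Suc k / 2 \<le> measure lebesgue ({u<..<p} - A)"
          "\<eta> * (v - p) - \<eta> * \<delta> * \<theta> ^ Suc k / 2 \<le> measure lebesgue ({p<..<v} - A)"
          using uncut[of u p] uncut[of p v] p Suc.prems by auto
        moreover have "measure lebesgue ({u<..<p} - A) + measure lebesgue ({p<..<v} - A)
            = measure lebesgue (({u<..<p} - A) \<union> ({p<..<v} - A))"
        proof -
          have "({u<..<p} - A) \<inter> ({p<..<v} - A) = {}" by auto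
          then show ?thesis
            using measure_Un3[OF interval_minus_lmeasurable[OF A(1), of u p] interval_minus_lmeasurable[OF A(1), of p v]] by simp
        qed
        moreover have "\<dots> \<le> measure lebesgue ({u<..<v} - A)"
          using interval_minus_lmeasurable[OF A(1)] p by (intro measure_mono_fmeasurable) auto
        ultimately show ?thesis by (simp add: algebra_simps)
      qed
    qed
  qed
  have "\<eta> * (v - u) \<le> measure lebesgue ({u<..<v} - A)" if "0 \<le> u" "u < v" "v \<le> 1" for u v
  proof (rule LIMSEQ_le_const2)
    have "(\<lambda>k. \<eta> * (v - u) - \<eta> * \<delta> * \<theta> ^ k) \<longlonglongrightarrow> \<eta> * (v - u) - \<eta> * \<delta> * 0"
      using theta by (intro tendsto_intros LIMSEQ_power_zero) auto
    then show "(\<lambda>k. \<eta> * (v - u) - \<eta> * \<delta> * \<theta> ^ k) \<longlonglongrightarrow> \<eta> * (v - u)" by simp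
  qed (use claim that in auto)
  then have "negligible A" using A eta(1) by (intro negligible_of_uniform_loss[of A \<eta>]) auto
  then show False using \<open>\<not> negligible A\<close> by blast
qed


lemma neg_beta_covering_of_invariant:
  assumes beta: "1 < \<beta>" and A: "negligible {x \<in> A. neg_beta \<beta> x \<notin> A}"
  shows "neg_beta_covering (\<lambda>S. negligible (S - A)) \<beta>"
proof
  fix S S' assume "negligible (S - A)" "S' \<subseteq> S"
  then show "negligible (S' - A)" by (meson Diff_mono negligible_subset order_refl)
next
  fix S S' assume "negligible (S - A)" "negligible (S' - A)"
  then show "negligible (S \<union> S' - A)" by (simp add: Un_Diff negligible_Un)
next
  fix u v b assume uv: "u < v" "negligible ({u<..<v} - A)"
    and T: "\<And>x. u < x \<Longrightarrow> x < v \<Longrightarrow> neg_beta \<beta> x = b - \<beta> * x"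
  have "{b - \<beta> * v<..<b - \<beta> * u} - A \<subseteq> (\<lambda>x. b + (- \<beta>) * x) ` (({u<..<v} - A) \<union> {x \<in> A. neg_beta \<beta> x \<notin> A})"
  proof
    fix y assume y: "y \<in> {b - \<beta> * v<..<b - \<beta> * u} - A"
    define x where "x = (b - y) / \<beta>"
    have x: "u < x" "x < v" "y = b - \<beta> * x" using y beta by (auto simp: x_def field_simps)
    then show "y \<in> (\<lambda>x. b + (- \<beta>) * x) ` (({u<..<v} - A) \<union> {x \<in> A. neg_beta \<beta> x \<notin> A})"
      using T[of x] y by (intro image_eqI[of _ _ x]) auto
  qed
  then show "negligible ({b - \<beta> * v<..<b - \<beta> * u} - A)"
    using negligible_affine_image[OF negligible_Un[OF uv(2) A], of b "- \<beta>"] negligible_subset by blast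
qed (use beta in \<open>auto intro: negligible_subset[OF negligible_finite]\<close>)

lemma invariant_contains_covered:
  assumes beta: "1 < \<beta>" and A: "A \<in> sets borel" "A \<subseteq> {0<..1}"
    "negligible {x \<in> A. neg_beta \<beta> x \<notin> A}" "\<not> negligible A"
    and W: "\<And>cov u v. neg_beta_covering cov \<beta> \<Longrightarrow> cov {u<..<v} \<Longrightarrow> 0 \<le> u \<Longrightarrow> u < v \<Longrightarrow> v \<le> 1 \<Longrightarrow> cov W"
  shows "negligible (W - A)"
proof -
  obtain u v where "0 \<le> u" "u < v" "v \<le> 1" "negligible ({u<..<v} - A)"
    using invariant_contains_interval[OF beta A] by blast
  then show ?thesis using W[OF neg_beta_covering_of_invariant[OF beta A(3)], of u v] by simp
qed

section \<open>The absolutely continuous invariant measure\<close>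

lemma space_leb01: "space leb01 = {0<..1}"
  by (simp add: leb01_def space_restrict_space)

lemma sets_leb01: "E \<in> sets leb01 \<longleftrightarrow> E \<in> sets borel \<and> E \<subseteq> {0<..1}"
  by (auto simp: leb01_def sets_restrict_space_iff)

lemma emeasure_leb01: "E \<in> sets leb01 \<Longrightarrow> emeasure leb01 E = emeasure lborel E"
  unfolding leb01_def by (subst emeasure_restrict_space) (auto simp: sets_restrict_space_iff)

lemma negligible_iff_leb01:
  assumes "E \<in> sets leb01"
  shows "negligible E \<longleftrightarrow> (AE x in leb01. x \<notin> E)"
proof -
  have E: "E \<in> sets borel" using assms by (simp add: sets_leb01)
  then have "negligible E \<longleftrightarrow> emeasure lebesgue E = 0"
    by (intro negligible_iff_emeasure0 sets_completionI_sets) simp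
  also have "\<dots> \<longleftrightarrow> emeasure leb01 E = 0" using E assms by (simp add: emeasure_leb01)
  also have "\<dots> \<longleftrightarrow> (AE x in leb01. x \<notin> E)"
    using assms by (subst AE_iff_null_sets[symmetric]) auto
  finally show ?thesis .
qed

lemma prob_space_leb01: "prob_space leb01"
  by (rule prob_spaceI) (simp add: space_leb01 emeasure_leb01 sets_leb01)

lemma neg_beta_measurable_leb01 [measurable]: "neg_beta \<beta> \<in> leb01 \<rightarrow>\<^sub>M leb01"
  unfolding leb01_def using neg_beta_range by (intro measurable_restrict_space3) auto

lemma neg_beta_preimage_sets:
  assumes "E \<in> sets leb01"
  shows "{x \<in> {0<..1}. neg_beta \<beta> x \<in> E} \<in> sets leb01"
proof -
  have "neg_beta \<beta> -` E \<inter> space leb01 \<in> sets leb01"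
    by (rule measurable_sets[OF neg_beta_measurable_leb01 assms])
  then show ?thesis by (simp add: space_leb01 vimage_def Int_def conj_commute)
qed

lemma is_acimI:
  assumes sets: "sets \<mu> = sets leb01" and "prob_space \<mu>" "absolutely_continuous leb01 \<mu>"
    and inv: "\<And>E. E \<in> sets leb01 \<Longrightarrow> emeasure \<mu> {x \<in> {0<..1}. neg_beta \<beta> x \<in> E} = emeasure \<mu> E"
  shows "is_acim \<beta> \<mu>"
proof -
  have space: "space \<mu> = {0<..1}" using sets_eq_imp_space_eq[OF sets] by (simp add: space_leb01)
  have "neg_beta \<beta> \<in> \<mu> \<rightarrow>\<^sub>M \<mu>"
    using neg_beta_measurable_leb01 measurable_cong_sets[OF sets sets] by blast
  then have "distr \<mu> \<mu> (neg_beta \<beta>) = \<mu>"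
    by (intro measure_eqI)
      (simp_all add: emeasure_distr space sets inv[symmetric] vimage_def Int_def conj_commute)
  then show ?thesis using assms by (simp add: is_acim_def)
qed

locale acim_density =
  fixes \<beta> :: real and \<mu> :: "real measure" and f :: "real \<Rightarrow> ennreal"
  assumes beta: "1 < \<beta>" and acim: "is_acim \<beta> \<mu>"
    and f_meas [measurable]: "f \<in> borel_measurable leb01" and density: "density leb01 f = \<mu>"
begin

lemma sets_mu: "sets \<mu> = sets leb01"
  using acim by (simp add: is_acim_def)

lemma space_mu: "space \<mu> = {0<..1}"
  using sets_eq_imp_space_eq[OF sets_mu] by (simp add: space_leb01)

sublocale prob_space \<mu>
  using acim by (simp add: is_acim_def)

lemma invariant:
  assumes E: "E \<in> sets leb01"
  shows "emeasure \<mu> {x \<in> {0<..1}. neg_beta \<beta> x \<in> E} = emeasure \<mu> E"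
proof -
  have T: "neg_beta \<beta> \<in> \<mu> \<rightarrow>\<^sub>M \<mu>"
    using neg_beta_measurable_leb01 measurable_cong_sets[OF sets_mu sets_mu] by blast
  have "emeasure (distr \<mu> \<mu> (neg_beta \<beta>)) E = emeasure \<mu> (neg_beta \<beta> -` E \<inter> space \<mu>)"
    using E sets_mu by (intro emeasure_distr[OF T]) simp
  then show ?thesis using acim by (simp add: is_acim_def space_mu vimage_def Int_def conj_commute)
qed

definition supp where "supp = {x \<in> {0<..1}. f x \<noteq> 0}"

lemma supp_sets: "supp \<in> sets leb01"
proof -
  have "{x \<in> space leb01. f x \<noteq> 0} \<in> sets leb01" by measurable
  then show ?thesis by (simp add: supp_def space_leb01)
qed

lemma null_iff:
  assumes E: "E \<in> sets leb01"
  shows "emeasure \<mu> E = 0 \<longleftrightarrow> negligible (E \<inter> supp)"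
proof -
  have "emeasure \<mu> E = 0 \<longleftrightarrow> E \<in> null_sets (density leb01 f)"
    using E sets_mu by (simp add: density null_sets_def)
  also have "\<dots> \<longleftrightarrow> (AE x in leb01. x \<in> E \<longrightarrow> f x = 0)"
    using E by (simp add: null_sets_density_iff)
  also have "\<dots> \<longleftrightarrow> (AE x in leb01. x \<notin> E \<inter> supp)"
    by (rule AE_cong) (auto simp: supp_def space_leb01)
  also have "\<dots> \<longleftrightarrow> negligible (E \<inter> supp)"
    using negligible_iff_leb01[of "E \<inter> supp"] E supp_sets by auto
  finally show ?thesis .
qed

lemma supp_not_negligible: "\<not> negligible supp"
proof
  assume "negligible supp"
  then have "emeasure \<mu> {0<..1} = 0"
    by (subst null_iff) (auto simp: sets_leb01 intro: negligible_subset)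
  then show False using emeasure_space_1 space_mu by simp
qed

text \<open>The complement of the support has mass 0, hence so has its preimage, which therefore
  meets the support in a null set.\<close>

lemma supp_forward: "negligible {x \<in> supp. neg_beta \<beta> x \<notin> supp}"
proof -
  have c: "{0<..1} - supp \<in> sets leb01" using supp_sets by (auto simp: sets_leb01)
  have "emeasure \<mu> ({0<..1} - supp) = 0" by (subst null_iff[OF c]) (auto simp: Int_commute)
  then have "emeasure \<mu> {x \<in> {0<..1}. neg_beta \<beta> x \<in> {0<..1} - supp} = 0"
    using invariant[OF c] by simp
  then have "negligible ({x \<in> {0<..1}. neg_beta \<beta> x \<in> {0<..1} - supp} \<inter> supp)"
    using null_iff neg_beta_preimage_sets[OF c] by blast
  then show ?thesis
    by (rule negligible_subset) (use neg_beta_range in \<open>auto simp: supp_def\<close>)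
qed

text \<open>A balance of mass: forward invariance lets no mass leave \<open>W\<close>, and
  invariance of the finite measure then lets none enter it.\<close>

lemma supp_minus_forward:
  assumes W: "W \<in> sets leb01" "negligible {x \<in> W. neg_beta \<beta> x \<notin> W}"
  shows "negligible {x \<in> supp - W. neg_beta \<beta> x \<notin> supp - W}"
proof -
  define V where "V = {x \<in> {0<..1}. neg_beta \<beta> x \<in> W}"
  have V: "V \<in> sets leb01" unfolding V_def using W(1) by (rule neg_beta_preimage_sets)
  have sets: "W - V \<in> sets leb01" "V - W \<in> sets leb01" "W \<inter> V \<in> sets leb01"
    using W V by auto
  have "W - V \<subseteq> {x \<in> W. neg_beta \<beta> x \<notin> W}"
    using W(1) by (auto simp: V_def sets_leb01)
  then have "emeasure \<mu> (W - V) = 0"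
    using null_iff[OF sets(1)] W(2) negligible_subset by (meson inf_le1 order_trans)
  moreover have "emeasure \<mu> W = emeasure \<mu> (W - V) + emeasure \<mu> (W \<inter> V)"
    using sets sets_mu by (subst plus_emeasure) (auto intro!: arg_cong[of _ _ "emeasure \<mu>"])
  moreover have "emeasure \<mu> V = emeasure \<mu> (V - W) + emeasure \<mu> (W \<inter> V)"
    using sets sets_mu by (subst plus_emeasure) (auto intro!: arg_cong[of _ _ "emeasure \<mu>"])
  moreover have "emeasure \<mu> V = emeasure \<mu> W" unfolding V_def by (rule invariant[OF W(1)])
  ultimately have "emeasure \<mu> (V - W) + emeasure \<mu> (W \<inter> V) = 0 + emeasure \<mu> (W \<inter> V)"
    by simp
  then have "emeasure \<mu> (V - W) = 0"
    using ennreal_add_left_cancel[of "emeasure \<mu> (W \<inter> V)"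
    "emeasure \<mu> (V - W)" 0] emeasure_finite
    by (simp add: add.commute)
  then have "negligible ((V - W) \<inter> supp)" using null_iff[OF sets(2)] by blast
  then have "negligible ({x \<in> supp. neg_beta \<beta> x \<notin> supp} \<union> ((V - W) \<inter> supp))"
    using supp_forward negligible_Un by blast
  then show ?thesis by (rule negligible_subset) (auto simp: V_def supp_def)
qed

text \<open>The support and its part outside \<open>W\<close> are both forward invariant, so the second, which does not
  contain \<open>W\<close>, is negligible.\<close>

lemma supp_eq_ergodic_set:
  assumes W: "W \<in> sets leb01" "negligible {x \<in> W. neg_beta \<beta> x \<notin> W}"
    "\<not> negligible W"
    and erg: "\<And>A. A \<in> sets leb01 \<Longrightarrow> \<not> negligible A \<Longrightarrow> negligible {x \<in> A. neg_beta \<beta> x \<notin> A} \<Longrightarrow> negligible (W - A)"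
  shows "negligible (W - supp)" "negligible (supp - W)"
proof -
  show "negligible (W - supp)" using erg[OF supp_sets supp_not_negligible supp_forward] .
  show "negligible (supp - W)"
  proof (rule ccontr)
    assume "\<not> negligible (supp - W)"
    then have "negligible (W - (supp - W))"
      using erg[of "supp - W"] supp_minus_forward[OF W(1,2)] supp_sets W(1) by blast
    moreover have "W - (supp - W) = W" by blast
    ultimately show False using W(3) by simp
  qed
qed

end

section \<open>Uniqueness of the invariant measure\<close>

lemma acim_density_RN_deriv:
  assumes "1 < \<beta>" "is_acim \<beta> \<mu>"
  shows "acim_density \<beta> \<mu> (RN_deriv leb01 \<mu>)"
proof
  interpret prob_space leb01 by (rule prob_space_leb01)
  show "density leb01 (RN_deriv leb01 \<mu>) = \<mu>"
    using assms(2) by (intro density_RN_deriv) (auto simp: is_acim_def)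
qed (use assms in auto)

text \<open>The points leaving \<open>D\<close> form \<open>X\<close> and those entering it form
  \<open>Y\<close>, and every invariant measure gives both the same mass. On \<open>Y\<close> the
  first density is at most the second, so \<open>X\<close> has no more mass for the first measure
  than for the second. But \<open>f1\<close> exceeds \<open>f2\<close> on \<open>X\<close>, so
  \<open>X\<close> is null.\<close>

lemma acim_excess_forward:
  assumes "acim_density \<beta> \<mu>1 f1" "acim_density \<beta> \<mu>2 f2"
  defines "D \<equiv> {x \<in> {0<..1}. f2 x < f1 x}"
  shows "D \<in> sets leb01" "negligible {x \<in> D. neg_beta \<beta> x \<notin> D}"
proof -
  interpret m1: acim_density \<beta> \<mu>1 f1 by fact
  interpret m2: acim_density \<beta> \<mu>2 f2 by fact
  have "{x \<in> space leb01. f2 x < f1 x} \<in> sets leb01" by measurable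
  then show D: "D \<in> sets leb01" by (simp add: D_def space_leb01)
  define D' where "D' = {x \<in> {0<..1}. neg_beta \<beta> x \<in> D}"
  have D': "D' \<in> sets leb01" unfolding D'_def using D by (rule neg_beta_preimage_sets)
  define X Y where "X = D - D'" and "Y = D' - D"
  have XY: "X \<in> sets leb01" "Y \<in> sets leb01" using D D' by (auto simp: X_def Y_def)
  have swap: "emeasure \<mu> X = emeasure \<mu> Y" if "acim_density \<beta> \<mu> f" for \<mu> f
  proof -
    interpret acim_density \<beta> \<mu> f by fact
    have "emeasure \<mu> D = emeasure \<mu> X + emeasure \<mu> (D \<inter> D')"
      using D D' XY sets_mu
      by (subst plus_emeasure) (auto simp: X_def intro!: arg_cong[of _ _ "emeasure \<mu>"])
    moreover have "emeasure \<mu> D' = emeasure \<mu> Y + emeasure \<mu> (D \<inter> D')"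
      using D D' XY sets_mu
      by (subst plus_emeasure) (auto simp: Y_def intro!: arg_cong[of _ _ "emeasure \<mu>"])
    moreover have "emeasure \<mu> D' = emeasure \<mu> D" unfolding D'_def by (rule invariant[OF D])
    ultimately show ?thesis
      using ennreal_add_left_cancel[of "emeasure \<mu> (D \<inter> D')" "emeasure \<mu> X"
      "emeasure \<mu> Y"] emeasure_finite
      by (simp add: add.commute)
  qed
  have dens: "emeasure \<mu>1 E = (\<integral>\<^sup>+x. f1 x * indicator E x \<partial>leb01)"
    "emeasure \<mu>2 E = (\<integral>\<^sup>+x. f2 x * indicator E x \<partial>leb01)"
    if "E \<in> sets leb01" for E
    using that emeasure_density[of f1 leb01 E] emeasure_density[of f2 leb01 E]
    by (simp_all add: m1.density m2.density)
  have "emeasure \<mu>1 Y \<le> emeasure \<mu>2 Y"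
    unfolding dens[OF XY(2)]
    by (intro nn_integral_mono) (auto simp: Y_def D_def D'_def space_leb01 split: split_indicator)
  then have le: "(\<integral>\<^sup>+x. f1 x * indicator X x \<partial>leb01) \<le> (\<integral>\<^sup>+x. f2 x * indicator X x \<partial>leb01)"
    unfolding dens[OF XY(1), symmetric] using swap[OF assms(1)] swap[OF assms(2)] by simp
  have "negligible X"
  proof (rule ccontr)
    assume "\<not> negligible X"
    then have "\<not> (AE x in leb01. x \<notin> X)" using negligible_iff_leb01[OF XY(1)] by simp
    moreover have "(AE x in leb01. f1 x * indicator X x \<le> f2 x * indicator X x) \<longleftrightarrow> (AE x in leb01. x \<notin> X)"
      by (rule AE_cong) (auto simp: X_def D_def split: split_indicator)
    ultimately have "\<not> (AE x in leb01. f1 x * indicator X x \<le> f2 x * indicator X x)" by simp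
    moreover have "AE x in leb01. f2 x * indicator X x \<le> f1 x * indicator X x"
      by (rule AE_I2) (auto simp: X_def D_def split: split_indicator)
    moreover have "(\<integral>\<^sup>+x. f2 x * indicator X x \<partial>leb01) \<noteq> \<infinity>"
      unfolding dens(2)[OF XY(1), symmetric] using m2.emeasure_finite by simp
    ultimately have "(\<integral>\<^sup>+x. f2 x * indicator X x \<partial>leb01) < (\<integral>\<^sup>+x. f1 x * indicator X x \<partial>leb01)"
      using XY by (intro nn_integral_less) auto
    then show False using le by simp
  qed
  then show "negligible {x \<in> D. neg_beta \<beta> x \<notin> D}"
    by (rule negligible_subset) (auto simp: X_def D'_def D_def)
qed

lemma acim_eqI:
  assumes "acim_density \<beta> \<mu>1 f1"
    "acim_density \<beta> \<mu>2 f2" and neg: "negligible {x \<in> {0<..1}. f2 x < f1 x}"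
  shows "\<mu>1 = \<mu>2"
proof -
  interpret m1: acim_density \<beta> \<mu>1 f1 by fact
  interpret m2: acim_density \<beta> \<mu>2 f2 by fact
  have "{x \<in> space leb01. f2 x < f1 x} \<in> sets leb01" by measurable
  then have "AE x in leb01. x \<notin> {x \<in> {0<..1}. f2 x < f1 x}"
    using neg negligible_iff_leb01 by (simp add: space_leb01)
  then have le: "AE x in leb01. f1 x \<le> f2 x"
    using AE_space by eventually_elim (auto simp: space_leb01)
  have mass: "(\<integral>\<^sup>+x. f x \<partial>leb01) = 1" if "acim_density \<beta> \<mu> f" for \<mu> f
  proof -
    interpret acim_density \<beta> \<mu> f by fact
    have "(\<integral>\<^sup>+x. f x \<partial>leb01) = (\<integral>\<^sup>+x. f x * indicator (space leb01) x \<partial>leb01)"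
      by (rule nn_integral_cong) simp
    also have "\<dots> = emeasure \<mu> (space \<mu>)"
      using emeasure_density[of f leb01 "space leb01"] by (simp add: density space_mu space_leb01 sets_leb01)
    finally show ?thesis using emeasure_space_1 by simp
  qed
  have "AE x in leb01. f2 x \<le> f1 x"
  proof (rule ccontr)
    assume "\<not> (AE x in leb01. f2 x \<le> f1 x)"
    then have "(\<integral>\<^sup>+x. f1 x \<partial>leb01) < (\<integral>\<^sup>+x. f2 x \<partial>leb01)"
      using le mass[OF assms(1)] by (intro nn_integral_less) auto
    then show False using mass[OF assms(1)] mass[OF assms(2)] by simp
  qed
  then have "AE x in leb01. f1 x = f2 x" using le by eventually_elim auto
  then have "density leb01 f1 = density leb01 f2" by (intro density_cong) auto
  then show ?thesis by (simp add: m1.density m2.density)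
qed

lemma acim_unique:
  assumes beta: "1 < \<beta>" and acim: "is_acim \<beta> \<mu>1"
    "is_acim \<beta> \<mu>2" and W: "\<not> negligible W"
    and erg: "\<And>A. A \<in> sets leb01 \<Longrightarrow> \<not> negligible A \<Longrightarrow> negligible {x \<in> A. neg_beta \<beta> x \<notin> A} \<Longrightarrow> negligible (W - A)"
  shows "\<mu>1 = \<mu>2"
proof -
  obtain f1 f2 where f: "acim_density \<beta> \<mu>1 f1" "acim_density \<beta> \<mu>2 f2"
    using acim_density_RN_deriv[OF beta] acim by blast
  let ?D = "{x \<in> {0<..1}. f2 x < f1 x}" and ?E = "{x \<in> {0<..1}. f1 x < f2 x}"
  have "negligible ?D \<or> negligible ?E"
  proof (rule ccontr)
    assume "\<not> ?thesis"
    \<comment> \<open>Both sets would contain almost all of \<open>W\<close>, although they are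
      disjoint.\<close>
    then have "negligible (W - ?D)" "negligible (W - ?E)"
      using erg acim_excess_forward[OF f] acim_excess_forward[OF f(2,1)] by blast+
    then have "negligible ((W - ?D) \<union> (W - ?E))" by (rule negligible_Un)
    moreover have "(W - ?D) \<union> (W - ?E) = W" by auto
    ultimately show False using W by metis
  qed
  then show ?thesis using acim_eqI[OF f] acim_eqI[OF f(2,1)] by auto
qed

section \<open>Existence by summing along the orbit of 1\<close>

lemma leb01_lmeasurable: "E \<in> sets leb01 \<Longrightarrow> E \<in> lmeasurable"
  by (rule fmeasurableI2[of "{0..1}"]) (auto simp: sets_leb01 intro!: sets_completionI_sets)

lemma measure_leb01: "E \<in> sets leb01 \<Longrightarrow> measure leb01 E = measure lebesgue E"
  by (simp add: measure_def emeasure_leb01 sets_leb01)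

lemma measure_affine_preimage:
  assumes "0 < \<beta>"
  shows "measure lebesgue {x. b - \<beta> * x \<in> F} = measure lebesgue F / \<beta>"
proof -
  have "{x. b - \<beta> * x \<in> F} = (\<lambda>y. b / \<beta> + (- 1 / \<beta>) * y) ` F"
  proof (intro equalityI subsetI)
    fix x assume "x \<in> {x. b - \<beta> * x \<in> F}"
    then show "x \<in> (\<lambda>y. b / \<beta> + (- 1 / \<beta>) * y) ` F"
      using assms by (intro image_eqI[of _ _ "b - \<beta> * x"]) (auto simp: field_simps)
  qed (use assms in \<open>auto simp: field_simps\<close>)
  then show ?thesis unfolding \<open>_ = _\<close> measure_affine_image using assms by simp
qed

lemma measure_split:
  assumes "A \<in> lmeasurable" "B \<in> sets lebesgue"
  shows "measure lebesgue A = measure lebesgue (A \<inter> B) + measure lebesgue (A - B)"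
proof -
  have "A \<inter> B \<in> lmeasurable" "A - B \<in> lmeasurable"
    using assms by (auto intro: fmeasurable_Diff fmeasurable_Int_fmeasurable)
  from measure_Un3[OF this] show ?thesis by (simp add: Int_Diff_Un Int_Diff Diff_Int_distrib)
qed

text \<open>The transfer operator maps the indicator function of \<open>{0<..t}\<close> to a constant minus \<open>1 / \<beta>\<close> times
  the indicator function of \<open>{0<..neg_beta \<beta> t}\<close>.\<close>

lemma measure_neg_beta_preimage:
  assumes beta: "1 < \<beta>" and E: "E \<in> sets leb01" and t: "0 \<le> t"
  shows "measure lebesgue {x \<in> {0<..t}. neg_beta \<beta> x \<in> E} =
    ((neg_beta \<beta> t + \<beta> * t) * measure lebesgue E - measure lebesgue (E \<inter> {0<..neg_beta \<beta> t})) / \<beta>"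
proof -
  have Eb: "E \<in> sets borel" "E \<subseteq> {0<..1}" using E by (auto simp: sets_leb01)
  have "neg_beta \<beta> -` E \<in> sets borel"
    using neg_beta_measurable Eb(1) by (rule measurable_sets_borel)
  then have lm: "{x \<in> I. neg_beta \<beta> x \<in> E} \<in> lmeasurable"
    if "I \<in> sets borel" "I \<subseteq> {0..t}" for I
  proof -
    have "{x \<in> I. neg_beta \<beta> x \<in> E} = I \<inter> neg_beta \<beta> -` E" by auto
    then have "{x \<in> I. neg_beta \<beta> x \<in> E} \<in> sets lborel"
      using that(1) \<open>neg_beta \<beta> -` E \<in> sets borel\<close> by simp
    then have S: "{x \<in> I. neg_beta \<beta> x \<in> E} \<in> sets lebesgue" by (rule sets_completionI_sets)
    have sub: "{x \<in> I. neg_beta \<beta> x \<in> E} \<subseteq> {0..t}" using that(2) by auto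
    have "{0..t} \<in> lmeasurable" by simp
    then show ?thesis using sub S by (rule fmeasurableI2)
  qed
  have T: "neg_beta \<beta> x = real k + 1 - \<beta> * x"
    if "real k \<le> \<beta> * x" "\<beta> * x < real k + 1" for x k
    using neg_beta_floor[of "int k" \<beta> x] that by simp
  have mem: "x \<in> {real k / \<beta>..<(real k + 1) / \<beta>} \<longleftrightarrow> real k \<le> \<beta> * x \<and> \<beta> * x < real k + 1" for x k
    using beta by (auto simp: field_simps)
  have full: "measure lebesgue {x \<in> {real k / \<beta>..<(real k + 1) / \<beta>}. neg_beta \<beta> x \<in> E} = measure lebesgue E / \<beta>" for k
  proof -
    have "{x \<in> {real k / \<beta>..<(real k + 1) / \<beta>}. neg_beta \<beta> x \<in> E} = {x. (real k + 1) - \<beta> * x \<in> E}"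
    proof (intro set_eqI iffI)
      fix x assume x: "x \<in> {x. (real k + 1) - \<beta> * x \<in> E}"
      then have "0 < (real k + 1) - \<beta> * x" "(real k + 1) - \<beta> * x \<le> 1" using Eb(2) by auto
      then have k: "real k \<le> \<beta> * x" "\<beta> * x < real k + 1" by linarith+
      show "x \<in> {x \<in> {real k / \<beta>..<(real k + 1) / \<beta>}. neg_beta \<beta> x \<in> E}"
        unfolding mem_Collect_eq mem T[OF k] using x k by simp
    next
      fix x assume "x \<in> {x \<in> {real k / \<beta>..<(real k + 1) / \<beta>}. neg_beta \<beta> x \<in> E}"
      then show "x \<in> {x. (real k + 1) - \<beta> * x \<in> E}"
        unfolding mem_Collect_eq mem using T[of k x] by simp
    qed
    then show ?thesis using measure_affine_preimage[of \<beta> "real k + 1" E] beta by simp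
  qed
  let ?S = "\<lambda>I. {x \<in> I. neg_beta \<beta> x \<in> E}"
  have additive: "measure lebesgue (?S (I \<union> I')) = measure lebesgue (?S I) + measure lebesgue (?S I')"
    if "I \<in> sets borel" "I' \<in> sets borel" "I \<subseteq> {0..t}" "I' \<subseteq> {0..t}"
    "I \<inter> I' = {}" for I I'
  proof -
    have "?S (I \<union> I') = ?S I \<union> ?S I'" "?S I \<inter> ?S I' = {}" using that(5) by auto
    then show ?thesis using measure_Un3[OF lm[OF that(1,3)] lm[OF that(2,4)]] by simp
  qed
  have full_sum: "measure lebesgue (?S {0..<real k / \<beta>}) = real k * measure lebesgue E / \<beta>"
    if "real k / \<beta> \<le> t" for k
    using that
  proof (induction k)
    case 0
    show ?case by simp
  next
    case (Suc k)
    define p q where "p = real k / \<beta>" and "q = (real k + 1) / \<beta>"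
    have q: "real (Suc k) / \<beta> = q" by (simp add: q_def add.commute)
    have pq: "0 \<le> p" "p < q" "q \<le> t"
      using Suc.prems beta unfolding q by (auto simp: p_def q_def divide_strict_right_mono)
    then have pieces: "{0..<p} \<union> {p..<q} = {0..<q}" by auto
    have "measure lebesgue (?S ({0..<p} \<union> {p..<q})) = measure lebesgue (?S {0..<p}) + measure lebesgue (?S {p..<q})"
      by (rule additive) (use pq in auto)
    then have "measure lebesgue (?S {0..<q}) = measure lebesgue (?S {0..<p}) + measure lebesgue (?S {p..<q})"
      unfolding pieces .
    also have "measure lebesgue (?S {p..<q}) = measure lebesgue E / \<beta>"
      unfolding p_def q_def by (rule full)
    also have "measure lebesgue (?S {0..<p}) = real k * measure lebesgue E / \<beta>"
      using Suc.IH pq unfolding p_def by linarith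
    finally show ?case unfolding q by (simp add: add_divide_distrib algebra_simps)
  qed
  \<comment> \<open>Below \<open>t\<close> there are \<open>k\<close> full branches, each
    contributing \<open>measure lebesgue E / \<beta>\<close>. The branch cut at \<open>t\<close> is
    decreasing and sees only the part of \<open>E\<close> above \<open>neg_beta \<beta> t\<close>.
    The factor in the claim is \<open>neg_beta \<beta> t + \<beta> * t = k + 1\<close>.\<close>
  define k where "k = nat \<lfloor>\<beta> * t\<rfloor>"
  have rk: "real k = of_int \<lfloor>\<beta> * t\<rfloor>" using t beta by (simp add: k_def)
  have k: "real k \<le> \<beta> * t" "\<beta> * t < real k + 1" unfolding rk by linarith+
  have kt: "real k / \<beta> \<le> t" using k beta by (simp add: field_simps)
  have Tt: "neg_beta \<beta> t = real k + 1 - \<beta> * t" using T[OF k] .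
  have mem': "x \<in> {real k / \<beta>..t} \<longleftrightarrow> real k \<le> \<beta> * x \<and> \<beta> * x \<le> \<beta> * t" for x
    using beta by (auto simp: field_simps)
  have "?S {real k / \<beta>..t} = {x. (real k + 1) - \<beta> * x \<in> E - {0<..<neg_beta \<beta> t}}"
  proof (intro set_eqI iffI)
    fix x assume x: "x \<in> {x. (real k + 1) - \<beta> * x \<in> E - {0<..<neg_beta \<beta> t}}"
    then have "0 < (real k + 1) - \<beta> * x" "(real k + 1) - \<beta> * x \<le> 1"
      "neg_beta \<beta> t \<le> (real k + 1) - \<beta> * x"
      using Eb(2) by auto
    then have kx: "real k \<le> \<beta> * x" "\<beta> * x < real k + 1" "\<beta> * x \<le> \<beta> * t"
      unfolding Tt by linarith+
    then show "x \<in> ?S {real k / \<beta>..t}" unfolding mem_Collect_eq mem' T[OF kx(1,2)] using x by simp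
  next
    fix x assume x: "x \<in> ?S {real k / \<beta>..t}"
    then have kx: "real k \<le> \<beta> * x" "\<beta> * x \<le> \<beta> * t"
      unfolding mem_Collect_eq mem' by auto
    then have "neg_beta \<beta> x = real k + 1 - \<beta> * x" using T[of k x] k by linarith
    moreover have "neg_beta \<beta> t \<le> real k + 1 - \<beta> * x" using kx unfolding Tt by linarith
    ultimately show "x \<in> {x. (real k + 1) - \<beta> * x \<in> E - {0<..<neg_beta \<beta> t}}"
      using x by auto
  qed
  then have last: "measure lebesgue {x \<in> {real k / \<beta>..t}. neg_beta \<beta> x \<in> E} = measure lebesgue (E - {0<..<neg_beta \<beta> t}) / \<beta>"
    using measure_affine_preimage[of \<beta> "real k + 1" "E - {0<..<neg_beta \<beta> t}"] beta
    by (simp only:)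
  have "measure lebesgue (E \<inter> {0<..neg_beta \<beta> t}) = measure lebesgue (E \<inter> {0<..<neg_beta \<beta> t})"
  proof (rule measure_negligible_symdiff)
    show "E \<inter> {0<..<neg_beta \<beta> t} \<in> lmeasurable"
      using leb01_lmeasurable[OF E] by (simp add: fmeasurable_Int_fmeasurable)
    show "negligible (E \<inter> {0<..<neg_beta \<beta> t} - E \<inter> {0<..neg_beta \<beta> t} \<union> (E \<inter> {0<..neg_beta \<beta> t} - E \<inter> {0<..<neg_beta \<beta> t}))"
      by (rule negligible_subset[of "{neg_beta \<beta> t}"]) auto
  qed
  then have diff: "measure lebesgue (E - {0<..<neg_beta \<beta> t}) = measure lebesgue E - measure lebesgue (E \<inter> {0<..neg_beta \<beta> t})"
    using measure_split[OF leb01_lmeasurable[OF E], of "{0<..<neg_beta \<beta> t}"] by simp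
  have "0 \<le> real k / \<beta>" using beta by simp
  then have pieces: "{0..<real k / \<beta>} \<union> {real k / \<beta>..t} = {0..t}" using kt by auto
  have "measure lebesgue (?S ({0..<real k / \<beta>} \<union> {real k / \<beta>..t})) =
      measure lebesgue (?S {0..<real k / \<beta>}) + measure lebesgue (?S {real k / \<beta>..t})"
    by (rule additive) (use kt \<open>0 \<le> real k / \<beta>\<close> in auto)
  then have "measure lebesgue (?S {0..t}) = measure lebesgue (?S {0..<real k / \<beta>}) + measure lebesgue (?S {real k / \<beta>..t})"
    unfolding pieces .
  also have "\<dots> = (real k * measure lebesgue E + (measure lebesgue E - measure lebesgue (E \<inter> {0<..neg_beta \<beta> t}))) / \<beta>"
    unfolding full_sum[OF kt] last diff by (simp add: add_divide_distrib)
  also have "\<dots> = ((neg_beta \<beta> t + \<beta> * t) * measure lebesgue E - measure lebesgue (E \<inter> {0<..neg_beta \<beta> t})) / \<beta>"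
    unfolding Tt by (simp add: algebra_simps)
  also have "measure lebesgue (?S {0..t}) = measure lebesgue (?S {0<..t})"
  proof (rule measure_negligible_symdiff)
    show "?S {0<..t} \<in> lmeasurable" by (rule lm) auto
    show "negligible (?S {0<..t} - ?S {0..t} \<union> (?S {0..t} - ?S {0<..t}))"
      by (rule negligible_subset[of "{0}"]) auto
  qed
  finally show ?thesis .
qed

text \<open>The fixed point of the transfer operator obtained by summing along the orbit of 1. It may take
  negative values, but its positive part is again invariant.\<close>

definition signed_density :: "real \<Rightarrow> real \<Rightarrow> real" where
  "signed_density \<beta> x = (\<Sum>n. (- 1 / \<beta>) ^ n * indicator {0<..orb \<beta> n} x)"

context
  fixes \<beta> :: real
  assumes beta: "1 < \<beta>"
begin

lemma summable_weights: "summable (\<lambda>n. norm ((- 1 / \<beta>) ^ n))"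
  unfolding norm_power using beta by (intro summable_geometric) auto

lemma orb_range: "0 < orb \<beta> n" "orb \<beta> n \<le> 1"
  by (rule iterate_pos, simp) (rule iterate_le_1, simp)

lemma signed_density_mult:
  "signed_density \<beta> x * indicator E x = (\<Sum>n. (- 1 / \<beta>) ^ n * indicator (E \<inter> {0<..orb \<beta> n}) x)"
proof -
  have "summable (\<lambda>n. (- 1 / \<beta>) ^ n * indicator {0<..orb \<beta> n} x)"
    by (rule summable_comparison_test'[OF summable_weights, of 0]) (auto simp: norm_mult split: split_indicator)
  from suminf_mult2[OF this, of "indicator E x"] show ?thesis
    unfolding signed_density_def by (simp add: indicator_inter_arith mult_ac)
qed

lemma signed_density_integral:
  assumes E: "E \<in> sets leb01"
  shows "integrable leb01 (\<lambda>x. signed_density \<beta> x * indicator E x)"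
    and "(\<lambda>n. (- 1 / \<beta>) ^ n * measure lebesgue (E \<inter> {0<..orb \<beta> n})) sums (\<integral>x. signed_density \<beta> x * indicator E x \<partial>leb01)"
proof -
  interpret prob_space leb01 by (rule prob_space_leb01)
  let ?f = "\<lambda>n x. (- 1 / \<beta>) ^ n * indicator (E \<inter> {0<..orb \<beta> n}) x :: real"
  have sets: "E \<inter> {0<..orb \<beta> n} \<in> sets leb01" for n using E by (auto simp: sets_leb01)
  have int: "integrable leb01 (?f n)" for n
    using sets
    by (intro integrable_mult_right integrable_real_indicator) (auto simp: emeasure_finite less_top[symmetric])
  have val: "(\<integral>x. ?f n x \<partial>leb01) = (- 1 / \<beta>) ^ n * measure lebesgue (E \<inter> {0<..orb \<beta> n})" for n
    using sets[of n] sets.sets_into_space[OF sets[of n]] by (simp add: measure_leb01 Int_absorb2)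
  have sm: "AE x in leb01. summable (\<lambda>n. norm (?f n x))"
    by (intro AE_I2 summable_comparison_test'[OF summable_weights, of 0]) (auto simp: norm_mult split: split_indicator)
  have norm_int: "(\<integral>x. norm (?f n x) \<partial>leb01) \<le> norm ((- 1 / \<beta>) ^ n)" for n
  proof -
    have "(\<integral>x. norm (?f n x) \<partial>leb01) \<le> (\<integral>x. norm ((- 1 / \<beta>) ^ n) \<partial>leb01)"
      by (intro integral_mono integrable_norm int) (auto simp: norm_mult split: split_indicator)
    then show ?thesis by (simp add: prob_space)
  qed
  have sm2: "summable (\<lambda>n. \<integral>x. norm (?f n x) \<partial>leb01)"
    by (rule summable_comparison_test'[OF summable_weights, of 0]) (use norm_int in auto)
  show "integrable leb01 (\<lambda>x. signed_density \<beta> x * indicator E x)"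
    unfolding signed_density_mult by (rule integrable_suminf[OF int sm sm2])
  show "(\<lambda>n. (- 1 / \<beta>) ^ n * measure lebesgue (E \<inter> {0<..orb \<beta> n})) sums (\<integral>x. signed_density \<beta> x * indicator E x \<partial>leb01)"
    using sums_integral[OF int sm sm2] unfolding signed_density_mult val .
qed

lemma signed_density_measurable: "signed_density \<beta> \<in> borel_measurable leb01"
proof -
  have "{0<..1} \<in> sets leb01" by (simp add: sets_leb01)
  from borel_measurable_integrable[OF signed_density_integral(1)[OF this]]
  show ?thesis by (rule measurable_cong[THEN iffD1, rotated]) (simp add: space_leb01)
qed

definition signed_measure :: "real set \<Rightarrow> real" where
  "signed_measure E = (\<integral>x. signed_density \<beta> x * indicator E x \<partial>leb01)"

lemma signed_measure_Un:
  assumes "A \<in> sets leb01" "B \<in> sets leb01" "A \<inter> B = {}"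
  shows "signed_measure (A \<union> B) = signed_measure A + signed_measure B"
proof -
  have "signed_measure (A \<union> B) = (\<integral>x. signed_density \<beta> x * indicator A x + signed_density \<beta> x * indicator B x \<partial>leb01)"
    unfolding signed_measure_def
    using assms(3) by (intro Bochner_Integration.integral_cong) (auto split: split_indicator)
  then show ?thesis
    unfolding signed_measure_def
    using signed_density_integral(1) assms by (simp add: Bochner_Integration.integral_add)
qed

text \<open>In the formula for preimages the constants telescope. Their sum is
  \<open>measure lebesgue E\<close> because the orbit starts at 1, and this is exactly the term of
  index 0 that the shift of the indicator terms has dropped.\<close>

lemma signed_measure_invariant:
  assumes E: "E \<in> sets leb01"
  shows "signed_measure {x \<in> {0<..1}. neg_beta \<beta> x \<in> E} = signed_measure E"
proof -
  let ?V = "{x \<in> {0<..1}. neg_beta \<beta> x \<in> E}" and ?z = "- 1 / \<beta>"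
  let ?m = "measure lebesgue"
  have V: "?V \<in> sets leb01" using E by (rule neg_beta_preimage_sets)
  define a where "a = (\<lambda>n. ?z ^ n * ?m (E \<inter> {0<..orb \<beta> n}))"
  define c where "c = (\<lambda>n. ?z ^ n * orb \<beta> n)"
  have term_eq: "?z ^ n * ?m (?V \<inter> {0<..orb \<beta> n}) = ?m E * (c n - c (Suc n)) + a (Suc n)" for n
  proof -
    have "?V \<inter> {0<..orb \<beta> n} = {x \<in> {0<..orb \<beta> n}. neg_beta \<beta> x \<in> E}"
      using orb_range[of n] by auto
    then have "?m (?V \<inter> {0<..orb \<beta> n}) = ((orb \<beta> (Suc n) + \<beta> * orb \<beta> n) * ?m E - ?m (E \<inter> {0<..orb \<beta> (Suc n)})) / \<beta>"
      using measure_neg_beta_preimage[OF beta E, of "orb \<beta> n"] orb_range[of n] by simp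
    then have "?z ^ n * ?m (?V \<inter> {0<..orb \<beta> n}) =
        ?z ^ n * (((orb \<beta> (Suc n) + \<beta> * orb \<beta> n) * ?m E - ?m (E \<inter> {0<..orb \<beta> (Suc n)})) / \<beta>)"
      by (rule arg_cong)
    also have "\<dots> = ?m E * (c n - c (Suc n)) + a (Suc n)"
      using beta unfolding a_def c_def power_Suc by (simp add: field_simps)
    finally show ?thesis .
  qed
  have "c \<longlonglongrightarrow> 0"
  proof (rule Lim_null_comparison)
    have "norm (c n) \<le> norm (?z ^ n)" for n
      unfolding c_def using orb_range[of n] by (simp add: abs_mult mult_left_le)
    then show "\<forall>\<^sub>F n in sequentially. norm (c n) \<le> norm (?z ^ n)" by simp
    show "(\<lambda>n. norm (?z ^ n)) \<longlonglongrightarrow> 0"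
      using summable_weights by (rule summable_LIMSEQ_zero)
  qed
  from sums_mult[OF telescope_sums'[OF this], of "?m E"]
  have s1: "(\<lambda>n. ?m E * (c n - c (Suc n))) sums ?m E" by (simp add: c_def)
  have "a sums signed_measure E" unfolding a_def signed_measure_def by (rule signed_density_integral(2)[OF E])
  then have s2: "(\<lambda>n. a (Suc n)) sums (signed_measure E - a 0)" by (simp add: sums_Suc_iff)
  have "a 0 = ?m E" using E by (simp add: a_def sets_leb01 Int_absorb2)
  then have "(\<lambda>n. ?z ^ n * ?m (?V \<inter> {0<..orb \<beta> n})) sums signed_measure E"
    using sums_add[OF s1 s2] unfolding term_eq by simp
  then show ?thesis
    using signed_density_integral(2)[OF V] sums_unique2 unfolding signed_measure_def by blast
qed

text \<open>As \<open>x\<close> tends to 0, more and more indicators equal 1 and the sum approaches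
  the geometric series with value \<open>\<beta> / (\<beta> + 1)\<close>. This keeps the positive
  part from vanishing.\<close>

lemma signed_density_pos_near_0: "\<exists>\<epsilon>>0. \<forall>x. 0 < x \<and> x \<le> \<epsilon> \<longrightarrow> 0 < signed_density \<beta> x"
proof -
  define b where "b = 1 / \<beta>"
  have b: "0 < b" "b < 1" using beta by (simp_all add: b_def)
  \<comment> \<open>The bound that puts the tail \<open>b ^ N / (1 - b)\<close> below the limit
    \<open>1 / (1 + b)\<close>.\<close>
  obtain N where N: "b ^ N < (1 - b) / (1 + b)" using real_arch_pow_inv[of "(1 - b) / (1 + b)" b] b by auto
  define \<epsilon> where "\<epsilon> = Min (orb \<beta> ` {..N})"
  have "0 < \<epsilon>" unfolding \<epsilon>_def using orb_range by (subst Min_gr_iff) auto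
  moreover have "0 < signed_density \<beta> x" if x: "0 < x" "x \<le> \<epsilon>" for x
  proof -
    have le: "x \<le> orb \<beta> n" if "n < N" for n
      using x(2) Min_le[of "orb \<beta> ` {..N}" "orb \<beta> n"] that unfolding \<epsilon>_def by auto
    define e where "e = (\<lambda>n. (- b) ^ n * (1 - indicator {0<..orb \<beta> n} x))"
    have e_le: "norm (e n) \<le> b ^ n" for n
      using b by (auto simp: e_def abs_mult power_abs split: split_indicator)
    have sb: "summable (\<lambda>n. b ^ n)" using b by (intro summable_geometric) auto
    have se: "summable e" by (rule summable_comparison_test'[OF sb, of 0]) (use e_le in auto)
    have sz: "(\<lambda>n. (- b) ^ n) sums (1 / (1 - (- b)))" using b by (intro geometric_sums) auto
    have "(\<lambda>n. (- b) ^ n - e n) sums (1 / (1 + b) - suminf e)"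
      using sums_diff[OF sz summable_sums[OF se]] by simp
    moreover have "(- b) ^ n - e n = (- 1 / \<beta>) ^ n * indicator {0<..orb \<beta> n} x" for n
      by (simp add: e_def b_def algebra_simps)
    ultimately have "(\<lambda>n. (- 1 / \<beta>) ^ n * indicator {0<..orb \<beta> n} x) sums (1 / (1 + b) - suminf e)" by simp
    then have h: "signed_density \<beta> x = 1 / (1 + b) - suminf e"
      unfolding signed_density_def by (rule sums_unique[symmetric])
    have "suminf e = (\<Sum>n. e (n + N)) + (\<Sum>i<N. e i)" by (rule suminf_split_initial_segment[OF se])
    also have "(\<Sum>i<N. e i) = 0" using le x(1) by (intro sum.neutral) (auto simp: e_def)
    finally have tail: "suminf e = (\<Sum>n. e (n + N))" by simp
    have sbN: "(\<lambda>n. b ^ (n + N)) sums (b ^ N * (1 / (1 - b)))"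
      unfolding power_add using b sums_mult2[OF geometric_sums[of b], of "b ^ N"] by (simp add: mult.commute)
    have "(\<Sum>n. e (n + N)) \<le> (\<Sum>n. b ^ (n + N))"
    proof (rule suminf_le)
      show "e (n + N) \<le> b ^ (n + N)" for n using e_le[of "n + N"] by simp
      show "summable (\<lambda>n. e (n + N))" using se by (rule summable_ignore_initial_segment)
      show "summable (\<lambda>n. b ^ (n + N))" using sbN by (rule sums_summable)
    qed
    also have "\<dots> = b ^ N / (1 - b)" using sums_unique[OF sbN] by simp
    also have "\<dots> < 1 / (1 + b)" using N b by (simp add: field_simps)
    finally show ?thesis using h tail by simp
  qed
  ultimately show ?thesis by blast
qed

lemma signed_measure_AE_0:
  assumes "AE x in leb01. signed_density \<beta> x * indicator A x = 0" "B \<subseteq> A"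
  shows "signed_measure B = 0"
proof -
  have "AE x in leb01. signed_density \<beta> x * indicator B x = 0"
    using assms(1) by eventually_elim (use assms(2) in \<open>auto split: split_indicator_asm\<close>)
  then show ?thesis unfolding signed_measure_def by (rule integral_eq_zero_AE)
qed

text \<open>Let \<open>D\<close> be the set where the signed density is positive. Points leaving
  \<open>D\<close> carry mass at least 0 and points entering it mass at most 0, but the two amounts
  agree, so both vanish and the restriction to \<open>D\<close> stays invariant.\<close>

theorem acim_exists: "\<exists>\<mu>. is_acim \<beta> \<mu>"
proof -
  let ?h = "signed_density \<beta>" and ?\<nu> = signed_measure
  note [measurable] = signed_density_measurable
  define D where "D = {x \<in> {0<..1}. 0 < ?h x}"
  have "{x \<in> space leb01. 0 < ?h x} \<in> sets leb01" by measurable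
  then have D: "D \<in> sets leb01" by (simp add: D_def space_leb01)
  define D' where "D' = {x \<in> {0<..1}. neg_beta \<beta> x \<in> D}"
  have D': "D' \<in> sets leb01" unfolding D'_def using D by (rule neg_beta_preimage_sets)
  have split: "?\<nu> A = ?\<nu> (A \<inter> B) + ?\<nu> (A - B)"
    if "A \<in> sets leb01" "B \<in> sets leb01" for A B
    using signed_measure_Un[of "A \<inter> B" "A - B"] that by (auto simp: Int_Diff_Un)
  have sets: "D - D' \<in> sets leb01" "D' - D \<in> sets leb01" using D D' by auto
  have "?\<nu> D' = ?\<nu> D" unfolding D'_def by (rule signed_measure_invariant[OF D])
  then have eq: "?\<nu> (D - D') = ?\<nu> (D' - D)"
    using split[OF D D'] split[OF D' D] by (simp add: Int_commute)
  have nonneg: "0 \<le> ?h x * indicator (D - D') x" for x by (auto simp: D_def split: split_indicator)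
  have nonpos: "0 \<le> - (?h x * indicator (D' - D) x)" for x
    by (auto simp: D_def D'_def split: split_indicator)
  have "0 \<le> ?\<nu> (D - D')" unfolding signed_measure_def by (rule integral_nonneg_AE) (simp add: nonneg)
  moreover have "0 \<le> - ?\<nu> (D' - D)"
    unfolding signed_measure_def integral_minus[symmetric]
    by (rule integral_nonneg_AE) (simp only: nonpos AE_I2)
  ultimately have zero: "?\<nu> (D - D') = 0" "?\<nu> (D' - D) = 0" using eq by linarith+
  have ae1: "AE x in leb01. ?h x * indicator (D - D') x = 0"
    using zero(1) integral_nonneg_eq_0_iff_AE[OF signed_density_integral(1)[OF sets(1)]] nonneg
    by (simp add: signed_measure_def)
  have ae2: "AE x in leb01. ?h x * indicator (D' - D) x = 0"
    using zero(2) integral_nonneg_eq_0_iff_AE[OF integrable_minus[OF signed_density_integral(1)[OF sets(2)]]] nonpos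
    by (simp add: signed_measure_def)
  have inv: "?\<nu> ({x \<in> {0<..1}. neg_beta \<beta> x \<in> E} \<inter> D) = ?\<nu> (E \<inter> D)"
    if E: "E \<in> sets leb01" for E
  proof -
    let ?V = "{x \<in> {0<..1}. neg_beta \<beta> x \<in> E}"
    have V: "?V \<in> sets leb01" using E by (rule neg_beta_preimage_sets)
    have "?\<nu> (?V \<inter> D) = ?\<nu> (?V \<inter> D \<inter> D') + ?\<nu> (?V \<inter> D - D')"
      using V D D' by (intro split) auto
    also have "?\<nu> (?V \<inter> D - D') = 0" by (rule signed_measure_AE_0[OF ae1]) auto
    finally have 1: "?\<nu> (?V \<inter> D) = ?\<nu> (?V \<inter> D \<inter> D')" by simp
    have "?\<nu> (?V \<inter> D') = ?\<nu> (?V \<inter> D' \<inter> D) + ?\<nu> (?V \<inter> D' - D)"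
      using V D D' by (intro split) auto
    also have "?\<nu> (?V \<inter> D' - D) = 0" by (rule signed_measure_AE_0[OF ae2]) auto
    finally have "?\<nu> (?V \<inter> D') = ?\<nu> (?V \<inter> D)" using 1 by (simp add: Int_ac)
    moreover have "{x \<in> {0<..1}. neg_beta \<beta> x \<in> E \<inter> D} = ?V \<inter> D'"
      by (auto simp: D'_def)
    ultimately show ?thesis using signed_measure_invariant[of "E \<inter> D"] E D by (metis sets.Int)
  qed
  define c where "c = ?\<nu> D"
  have hD: "0 \<le> ?h x * indicator (E \<inter> D) x" for x E by (auto simp: D_def split: split_indicator)
  have "c \<noteq> 0"
  proof
    assume "c = 0"
    then have "AE x in leb01. ?h x * indicator D x = 0"
      using integral_nonneg_eq_0_iff_AE[OF signed_density_integral(1)[OF D]] hD[of _ UNIV]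
      by (simp add: signed_measure_def c_def)
    then have "AE x in leb01. x \<notin> D" by eventually_elim (auto simp: D_def)
    then have "negligible D" using negligible_iff_leb01[OF D] by simp
    moreover obtain \<epsilon> where eps: "0 < \<epsilon>"
      "\<And>x. 0 < x \<Longrightarrow> x \<le> \<epsilon> \<Longrightarrow> 0 < ?h x"
        using signed_density_pos_near_0 by blast
    then have "{0<..<min \<epsilon> 1} \<subseteq> D" by (auto simp: D_def)
    ultimately have "negligible {0<..<min \<epsilon> 1}" by (rule negligible_subset)
    moreover have "{0<..<min \<epsilon> 1} \<noteq> {}" using eps(1) by simp
    ultimately show False using open_not_negligible[OF open_greaterThanLessThan] by blast
  qed
  moreover have "0 \<le> c"
    unfolding c_def signed_measure_def by (rule integral_nonneg_AE) (use hD[of _ UNIV] in simp)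
  ultimately have c: "0 < c" by simp
  \<comment> \<open>Since \<open>ennreal\<close> sends negative numbers to 0, this is the normalised
    positive part.\<close>
  define \<mu> where "\<mu> = density leb01 (\<lambda>x. ennreal (?h x / c))"
  have em: "emeasure \<mu> E = ennreal (?\<nu> (E \<inter> D) / c)" if E: "E \<in> sets leb01" for E
  proof -
    have ED: "E \<inter> D \<in> sets leb01" using E D by auto
    have "emeasure \<mu> E = (\<integral>\<^sup>+x. ennreal (?h x / c) * indicator E x \<partial>leb01)"
      unfolding \<mu>_def using E by (intro emeasure_density) measurable
    also have "\<dots> = (\<integral>\<^sup>+x. ennreal (?h x * indicator (E \<inter> D) x / c) \<partial>leb01)"
      using c by (intro nn_integral_cong)
        (auto simp: D_def space_leb01 divide_nonpos_pos ennreal_neg split: split_indicator)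
    also have "\<dots> = ennreal (\<integral>x. ?h x * indicator (E \<inter> D) x / c \<partial>leb01)"
      using signed_density_integral(1)[OF ED] hD c by (intro nn_integral_eq_integral) auto
    finally show ?thesis by (simp add: signed_measure_def)
  qed
  have "is_acim \<beta> \<mu>"
  proof (rule is_acimI)
    show "sets \<mu> = sets leb01" by (simp add: \<mu>_def)
    show "prob_space \<mu>"
    proof (rule prob_spaceI)
      have "space leb01 \<inter> D = D" using D by (auto simp: sets_leb01 space_leb01)
      then show "emeasure \<mu> (space \<mu>) = 1"
        using em[OF sets.top] c by (simp add: \<mu>_def c_def)
    qed
    show "absolutely_continuous leb01 \<mu>"
      unfolding \<mu>_def by (rule absolutely_continuousI_density) measurable
    show "emeasure \<mu> {x \<in> {0<..1}. neg_beta \<beta> x \<in> E} = emeasure \<mu> E"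
      if "E \<in> sets leb01" for E
      using em[OF that] em[OF neg_beta_preimage_sets[OF that]] inv[OF that] by simp
  qed
  then show ?thesis by blast
qed

end

section \<open>The gaps\<close>

lemma gap_index_finite: "finite (gap_index n)"
  by (simp add: gap_index_def)

lemma card_gap_index: "card (gap_index n) = g n"
  unfolding gap_index_def by (subst card_SigmaI) (auto simp: sum_gap_count)

lemma G_set_eq: "G_set n \<beta> = (\<lambda>(m, k). G \<beta> m k) ` gap_index n"
  by (auto simp: G_set_def gap_index_def)

lemma gap_decompositionD:
  assumes "gap_decomposition \<beta> n W" "(m, k) \<in> gap_index n"
  shows "\<exists>l u. l < u \<and> G \<beta> m k = {l<..<u}" "G \<beta> m k \<subseteq> {0<..<1}"
    "G \<beta> m k \<inter> W = {}"
  using assms unfolding gap_decomposition_def by blast+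

lemma gap_closures_disjoint:
  assumes dec: "gap_decomposition \<beta> n W" and p: "p \<in> gap_index n" "p' \<in> gap_index n"
    "p \<noteq> p'"
  shows "closure (case p of (m, k) \<Rightarrow> G \<beta> m k) \<inter> closure (case p' of (m, k) \<Rightarrow> G \<beta> m k) = {}"
proof -
  have "disjoint_family_on (\<lambda>(m, k). closure (G \<beta> m k)) (gap_index n)"
    using dec by (simp add: gap_decomposition_def)
  from disjoint_family_onD[OF this p] show ?thesis by (simp add: case_prod_beta)
qed

lemma gap_decomposition_family:
  assumes dec: "gap_decomposition \<beta> n W"
  shows "card (G_set n \<beta>) = g n" "disjoint (G_set n \<beta>)"
    "\<forall>I\<in>G_set n \<beta>. I \<noteq> {}"
proof -
  let ?G = "\<lambda>(m, k). G \<beta> m k"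
  have ne: "?G p \<noteq> {}" if "p \<in> gap_index n" for p
    using gap_decompositionD(1)[OF dec, of "fst p" "snd p"] that by (auto simp: case_prod_beta)
  have disj: "?G p \<inter> ?G p' = {}"
    if "p \<in> gap_index n" "p' \<in> gap_index n" "p \<noteq> p'" for p p'
    using gap_closures_disjoint[OF dec that] closure_subset[of "?G p"] closure_subset[of "?G p'"] by blast
  have "inj_on ?G (gap_index n)"
  proof (rule inj_onI)
    fix p p' assume p: "p \<in> gap_index n" "p' \<in> gap_index n" "?G p = ?G p'"
    then show "p = p'" using ne[OF p(1)] disj[OF p(1,2)] by (metis Int_absorb)
  qed
  then show "card (G_set n \<beta>) = g n" unfolding G_set_eq by (simp add: card_image card_gap_index)
  show "disjoint (G_set n \<beta>)" unfolding G_set_eq pairwise_def disjnt_def using disj by blast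
  show "\<forall>I\<in>G_set n \<beta>. I \<noteq> {}" unfolding G_set_eq using ne by blast
qed

lemma open_subset_closure_minus_finite:
  fixes S :: "real set"
  assumes "open S" "finite F"
  shows "S \<subseteq> closure (S - F)"
proof (rule ccontr)
  assume "\<not> ?thesis"
  then have "S - closure (S - F) \<noteq> {}" by blast
  moreover have "open (S - closure (S - F))" using assms(1) by (simp add: open_Diff)
  ultimately have "\<not> negligible (S - closure (S - F))" using open_not_negligible by blast
  moreover have "S - closure (S - F) \<subseteq> F" using closure_subset[of "S - F"] by blast
  ultimately show False using negligible_subset negligible_finite[OF assms(2)] by blast
qed

text \<open>After removal of finitely many points the interval lies in the gaps, so it is covered by
  their closures. These are finitely many disjoint closed sets, and connectedness leaves only one of
  them.\<close>

lemma interval_in_gap: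
  assumes dec: "gap_decomposition \<beta> n W" and I: "a < b" "{a<..<b} \<subseteq> {0<..1}"
    "{a<..<b} \<inter> W = {}"
  shows "\<exists>(m, k)\<in>gap_index n. {a<..<b} \<subseteq> G \<beta> m k"
proof -
  let ?G = "\<lambda>(m, k). G \<beta> m k" and ?I = "{a<..<b}"
  define F where "F = {0<..<1} - W - (\<Union>p\<in>gap_index n. ?G p)"
  have F: "finite F" using dec by (simp add: F_def gap_decomposition_def)
  have "?I \<subseteq> {0<..<1}" using I(2) by (intro open_subset_Ioc) auto
  then have "?I - F \<subseteq> (\<Union>p\<in>gap_index n. closure (?G p))"
    using I(3) closure_subset unfolding F_def by fast
  moreover have "closed (\<Union>p\<in>gap_index n. closure (?G p))"
    using gap_index_finite by (intro closed_UN) auto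
  ultimately have "closure (?I - F) \<subseteq> (\<Union>p\<in>gap_index n. closure (?G p))"
    by (rule closure_minimal)
  then have cover: "?I \<subseteq> (\<Union>p\<in>gap_index n. closure (?G p))"
    using open_subset_closure_minus_finite[OF _ F, of ?I] by auto
  obtain x where x: "x \<in> ?I" using I(1) dense by auto
  then obtain p where p: "p \<in> gap_index n" "x \<in> closure (?G p)" using cover by blast
  define B where "B = (\<Union>p'\<in>gap_index n - {p}. closure (?G p'))"
  have "closed B" unfolding B_def using gap_index_finite by (intro closed_UN) auto
  moreover have "?I \<subseteq> closure (?G p) \<union> B" using cover by (auto simp: B_def)
  moreover have "closure (?G p) \<inter> B = {}"
  proof -
    have "closure (?G p) \<inter> closure (?G p') = {}" if "p' \<in> gap_index n" "p' \<noteq> p" for p'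
      using gap_closures_disjoint[OF dec p(1) that(1)] that(2) by blast
    then show ?thesis by (auto simp: B_def)
  qed
  ultimately have "closure (?G p) \<inter> ?I = {} \<or> B \<inter> ?I = {}"
    using connected_closedD[of ?I "closure (?G p)" B] by auto
  then have "B \<inter> ?I = {}" using x p(2) by blast
  then have "?I \<subseteq> closure (?G p)"
    using \<open>?I \<subseteq> closure (?G p) \<union> B\<close> by blast
  moreover obtain l u where lu: "l < u" "?G p = {l<..<u}"
    using gap_decompositionD(1)[OF dec, of "fst p" "snd p"] p(1) by (auto simp: case_prod_beta)
  ultimately have "?I \<subseteq> interior {l..u}" by (intro interior_maximal) auto
  then have "?I \<subseteq> ?G p" using lu by (simp add: interior_atLeastAtMost_real)
  then show ?thesis using p(1) by (intro bexI[of _ p]) auto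
qed

lemma gaps_eq_G_set:
  assumes dec: "gap_decomposition \<beta> n W"
    and vanish: "\<And>I. vanishing_interval \<beta> I \<longleftrightarrow> (\<exists>a b. a < b \<and> I = {a<..<b}) \<and> I \<subseteq> {0<..1} \<and> I \<inter> W = {}"
  shows "gaps \<beta> = G_set n \<beta>"
proof -
  have inG: "\<exists>H\<in>G_set n \<beta>. I \<subseteq> H" if "vanishing_interval \<beta> I" for I
  proof -
    have v: "\<exists>a b. a < b \<and> I = {a<..<b}" "I \<subseteq> {0<..1}" "I \<inter> W = {}"
      using vanish[of I] that by simp_all
    then obtain a b where ab: "a < b" "I = {a<..<b}" by blast
    obtain m k where "(m, k) \<in> gap_index n" "I \<subseteq> G \<beta> m k"
      using interval_in_gap[OF dec ab(1)] v(2,3) unfolding ab(2) by auto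
    then show ?thesis unfolding G_set_eq by (intro bexI[of _ "G \<beta> m k"]) (auto intro: rev_image_eqI)
  qed
  have Gv: "vanishing_interval \<beta> H" if H: "H \<in> G_set n \<beta>" for H
  proof -
    obtain m k where mk: "(m, k) \<in> gap_index n" "H = G \<beta> m k" using H by (auto simp: G_set_eq)
    then have "(\<exists>l u. l < u \<and> H = {l<..<u}) \<and> H \<subseteq> {0<..<1} \<and> H \<inter> W = {}"
      using gap_decompositionD[OF dec] by blast
    moreover have "{0<..<1} \<subseteq> {0<..1::real}" by auto
    ultimately show ?thesis by (subst vanish) blast
  qed
  have sub: "H = H'" if "H \<in> G_set n \<beta>" "H' \<in> G_set n \<beta>" "H \<subseteq> H'" for H H'
  proof (rule ccontr)
    assume "H \<noteq> H'"
    then have "H \<inter> H' = {}"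
      using pairwiseD[OF gap_decomposition_family(2)[OF dec] that(1,2)] by (simp add: disjnt_def)
    moreover have "H \<noteq> {}" using gap_decomposition_family(3)[OF dec] that(1) by blast
    ultimately show False using that(3) by blast
  qed
  show ?thesis
  proof (intro equalityI subsetI)
    fix I assume "I \<in> gaps \<beta>"
    then have I: "vanishing_interval \<beta> I"
      "\<And>J. vanishing_interval \<beta> J \<Longrightarrow> I \<subseteq> J \<Longrightarrow> J = I"
      by (auto simp: gaps_def)
    then show "I \<in> G_set n \<beta>" using inG Gv by blast
  next
    fix H assume H: "H \<in> G_set n \<beta>"
    have "J = H" if J: "vanishing_interval \<beta> J" "H \<subseteq> J" for J
    proof -
      obtain H' where "H' \<in> G_set n \<beta>" "J \<subseteq> H'" using inG[OF J(1)] by blast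
      then show ?thesis using sub[OF H, of H'] J(2) by blast
    qed
    then show "H \<in> gaps \<beta>" using Gv[OF H] by (auto simp: gaps_def)
  qed
qed

theorem theorem2p1:
  fixes n :: nat and \<beta> :: real
  assumes "\<beta> > 1"
    and "gamma (n + 1) \<le> ereal \<beta>"
    and "ereal \<beta> < gamma n"
  shows "gaps \<beta> = G_set n \<beta> \<and>
         card (G_set n \<beta>) = g n \<and>
         disjoint (G_set n \<beta>) \<and>
         (\<forall>I \<in> G_set n \<beta>. I \<noteq> {})"
proof -
  obtain W c where dec: "gap_decomposition \<beta> n W" and fwd: "neg_beta \<beta> ` W \<subseteq> insert c W"
    and cov: "\<And>cov u v. neg_beta_covering cov \<beta> \<Longrightarrow> cov {u<..<v} \<Longrightarrow> 0 \<le> u \<Longrightarrow> u < v \<Longrightarrow> v \<le> 1 \<Longrightarrow> cov W"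
    using neg_beta_dynamics[OF assms] by blast
  have Wo: "open W" "W \<subseteq> {0<..<1}" "W \<noteq> {}"
    using dec by (simp_all add: gap_decomposition_def)
  have W_sets: "W \<in> sets leb01" using Wo by (auto simp: sets_leb01)
  have W_neg: "\<not> negligible W" using open_not_negligible Wo by blast
  \<comment> \<open>Only preimages of \<open>c\<close> can leave \<open>W\<close>, and they form a
    null set.\<close>
  have W_fwd: "negligible {x \<in> W. neg_beta \<beta> x \<notin> W}"
  proof (rule negligible_subset)
    show "negligible {x \<in> {0..1}. neg_beta \<beta> x \<in> {c}}"
      using assms(1) by (intro neg_beta_nonsingular) auto
    show "{x \<in> W. neg_beta \<beta> x \<notin> W} \<subseteq> {x \<in> {0..1}. neg_beta \<beta> x \<in> {c}}" using fwd Wo(2) by fastforce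
  qed
  have erg: "negligible (W - A)"
    if "A \<in> sets leb01" "\<not> negligible A" "negligible {x \<in> A. neg_beta \<beta> x \<notin> A}"
    for A
    by (rule invariant_contains_covered[OF assms(1)]) (use that cov in \<open>auto simp: sets_leb01\<close>)
  have uniq: "\<mu>1 = \<mu>2" if "is_acim \<beta> \<mu>1" "is_acim \<beta> \<mu>2" for \<mu>1 \<mu>2
    using acim_unique[OF assms(1) that W_neg] erg by blast
  obtain \<mu> where mu: "is_acim \<beta> \<mu>" using acim_exists[OF assms(1)] by blast
  have "is_acim \<beta> (acim \<beta>)"
    unfolding acim_def by (rule theI[where a = \<mu>]) (use mu uniq in auto)
  then interpret acim_density \<beta> "acim \<beta>" "inv_density \<beta>"
    unfolding inv_density_def by (rule acim_density_RN_deriv[OF assms(1)])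
  have supp_W: "negligible (W - supp)" "negligible (supp - W)"
    using supp_eq_ergodic_set[OF W_sets W_fwd W_neg] erg by blast+
  have "vanishing_interval \<beta> I \<longleftrightarrow> (\<exists>a b. a < b \<and> I = {a<..<b}) \<and> I \<subseteq> {0<..1} \<and> I \<inter> W = {}" for I
  proof -
    have "(AE x in leb01. x \<in> I \<longrightarrow> inv_density \<beta> x = 0) \<longleftrightarrow> I \<inter> W = {}" if I: "open I" "I \<subseteq> {0<..1}"
    proof -
      have I_sets: "I \<in> sets leb01" using I by (simp add: sets_leb01)
      have "(AE x in leb01. x \<in> I \<longrightarrow> inv_density \<beta> x = 0) \<longleftrightarrow> (AE x in leb01. x \<notin> I \<inter> supp)"
        by (rule AE_cong) (auto simp: supp_def space_leb01)
      also have "\<dots> \<longleftrightarrow> negligible (I \<inter> supp)"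
        using negligible_iff_leb01[of "I \<inter> supp"] I_sets supp_sets by blast
      \<comment> \<open>An open negligible set is empty, which turns the almost everywhere condition
        into an exact one.\<close>
      also have "\<dots> \<longleftrightarrow> I \<inter> W = {}"
      proof
        assume "negligible (I \<inter> supp)"
        then have "negligible ((I \<inter> supp) \<union> (W - supp))" using supp_W(1) by (rule negligible_Un)
        then have "negligible (I \<inter> W)" by (rule negligible_subset) blast
        then show "I \<inter> W = {}" using open_not_negligible I(1) Wo(1) by blast
      next
        assume "I \<inter> W = {}"
        then have "I \<inter> supp \<subseteq> supp - W" by blast
        then show "negligible (I \<inter> supp)" by (rule negligible_subset[OF supp_W(2)])
      qed
      finally show ?thesis .
    qed
    moreover have "open I" if "\<exists>a b. a < b \<and> I = {a<..<b}" using that by auto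
    ultimately show ?thesis unfolding vanishing_interval_def by metis
  qed
  then show ?thesis using gaps_eq_G_set[OF dec] gap_decomposition_family[OF dec] by blast
qed

end
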